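(* Let $G$ be a finite connected graph without cycles with its vertex set decomposed as $G_v=G^\circ\sqcup G^\bullet$ into even and odd vertices. The assignments $F^\circ$ and $F^\bullet$ described in the context define functors (functors of even and odd reflections) $$F^\circ:\mathrm{Rep}_\circ(G,\textstyle\coprod)\to \mathrm{Rep}_\circ(G,\coprod),\qquad F^\bullet:\mathrm{Rep}_\bullet(G,\textstyle\coprod)\to \mathrm{Rep}_\bullet(G,\coprod),$$ each of which is an equivalence of the category with itself; they also realize equivalences of the following full subcategories: $$F^\circ:\mathrm{Rep}_\circ(G,d,f)\to \mathrm{Rep}_\circ(G,c^\circ(d),f^\circ_d)\quad\text{for } (d,f)\in S_\circ,$$ $$F^\bullet:\mathrm{Rep}_\bullet(G,d,f)\to \mathrm{Rep}_\bullet(G,c^\bullet(d),f^\bullet_d)\quad\text{for } (d,f)\in S_\bullet.$$ Moreover $(F^\circ)^2\cong\mathrm{Id}$ and $(F^\bullet)^2\cong \mathrm{Id}$.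
   Context: Graphs. $G$ is a finite connected (nonoriented) graph without cycles (in particular without loops and multiple edges), with vertex set $G_v$; $M_i$ is the set of vertices adjacent to $i$. Fix the decomposition $G_v=G^\circ\sqcup G^\bullet$ such that each edge joins a vertex of $G^\circ$ (even vertices) with a vertex of $G^\bullet$ (odd vertices). Representations. A representation $\pi$ of $G$ assigns to each vertex $i$ a separable complex Hilbert space $\pi(i)=H_i$ and to each edge joining $i$ and $j$ a pair of mutually adjoint bounded operators $\Gamma_{ij}:H_j\to H_i$, $\Gamma_{ji}=\Gamma_{ij}^*:H_i\to H_j$. A morphism $C:\pi\to\tilde\pi$ is a family of bounded operators $C_i:\pi(i)\to\tilde\pi(i)$ with $C_j\Gamma_{ji}=\tilde\Gamma_{ji}C_i$ for all ordered pairs of adjacent vertices $i,j$. $\pi$ is locally-scalar if for every $i$ the operator $A_i=\sum_{j\in M_i}\Gamma_{ij}\Gamma_{ji}$ is scalar, $A_i=\alpha_iI_{H_i}$ (empty sum $=0$). A function $f:G_v\to\mathbb R$ is a character of $\pi$ if $A_i=f(i)I_{H_i}$ for all $i$ (it is determined only at vertices with $\pi(i)\ne0$). The dimension of a finite-dimensional $\pi$ is $d(i)=\dim\pi(i)$. Vectors. $V_G$ is the real vector space of functions $x=(x_i)_{i\in G_v}$; $V_G^+=\{x\in V_G: x\neq0,\ x_i\ge 0\ \forall i\}$; $Z_G^+$ is the set of integer-valued elements of $V_G^+$. For $x\in V_G$: $c^\circ(x)_i=-x_i+\sum_{j\in M_i}x_j$ for $i\in G^\circ$ and $c^\circ(x)_i=x_i$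 for $i\in G^\bullet$; $c^\bullet(x)_i=-x_i+\sum_{j\in M_i}x_j$ for $i\in G^\bullet$ and $c^\bullet(x)_i=x_i$ for $i\in G^\circ$. For $d$ put $X_d=\{i: d(i)\ne0\}$, $X_d^\circ=X_d\cap G^\circ$, $X_d^\bullet=X_d\cap G^\bullet$. Let $S=\{(d,f)\in Z_G^+\times V_G^+: d(i)+f(i)>0\ \forall i\in G_v\}$, $S_\circ=\{(d,f)\in S: f(i)>0 \text{ for } i\in X_d^\circ\}$, $S_\bullet=\{(d,f)\in S: f(i)>0 \text{ for } i\in X_d^\bullet\}$. Define $f_d^\circ(i)=c^\bullet(f)(i)$ if $i\in X_d^\bullet$ and $f^\circ_d(i)=f(i)$ otherwise; $f_d^\bullet(i)=c^\circ(f)(i)$ if $i\in X_d^\circ$ and $f_d^\bullet(i)=f(i)$ otherwise. Categories. For $d\in\mathbb Z^{G_v}$ and $f\in V_G$, $\mathrm{Rep}(G,d,f)$ is the category whose objects are pairs $(\pi,f)$ with $\pi$ a finite-dimensional locally-scalar representation of dimension $d$ having $f$ as a character, with morphisms those of representations (it is empty if there is no such $\pi$). $\mathrm{Rep}_\circ(G,d,f)$ (resp. $\mathrm{Rep}_\bullet(G,d,f)$) is its full subcategory of objects with $f(i)>0$ for $i\in X_d^\circ$ (resp. for $i\in X_d^\bullet$). $\mathrm{Rep}(G,\coprod)$ has as objects the disjoint union of the objects of $\mathrm{Rep}(G,d,f)$ over $(d,f)\in S$; morphisms between two objects with the same $(d,f)$ are those of $\mathrm{Rep}(G,d,f)$,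 and there are no morphisms between objects with different $(d,f)$. $\mathrm{Rep}_\circ(G,\coprod)$ and $\mathrm{Rep}_\bullet(G,\coprod)$ are the full subcategories with objects having $(d,f)\in S_\circ$, respectively $(d,f)\in S_\bullet$. The functor $F^\circ$. Let $(\pi,f)$ be an object with $(d,f)\in S_\circ$ (so $f(i)>0$ for all $i\in G^\circ$). For $i\in G^\circ$ put $\alpha_i=f(i)$, $H^{(i)}=\bigoplus_{j\in M_i}H_j$; by local scalarity $\Gamma_i=\alpha_i^{-1/2}(\Gamma_{ji})_{j\in M_i}:H_i\to H^{(i)}$ is an isometry. Let $\widehat H_i$ be the orthogonal complement of $\mathrm{Im}\,\Gamma_i$ in $H^{(i)}$, write the inclusion $\widehat H_i\to H^{(i)}$ as $\alpha_i^{-1/2}(\Delta_{ji})_{j\in M_i}$ with $\Delta_{ji}:\widehat H_i\to H_j$, and put $\Delta_{ij}=\Delta_{ji}^*$. Then $F^\circ(\pi,f)=(\pi^\circ,f_d^\circ)$, where $\pi^\circ(i)=\widehat H_i$ for $i\in G^\circ$, $\pi^\circ(j)=H_j$ for $j\in G^\bullet$, with operators $\Delta_{ji},\Delta_{ij}$ on each edge. For a morphism $C:(\pi,f)\to(\tilde\pi,f)$, $F^\circ(C)=C^\circ$ with $C^\circ_j=C_j$ for $j\in G^\bullet$ and $C^\circ_i=\frac1{\alpha_i}\sum_{j\in M_i}\tilde\Delta_{ij}C_j\Delta_{ji}$ for $i\in G^\circ$. The functor $F^\bullet$ is defined in the same way with the roles of even and odd vertices interchanged, $F^\bullet(\pi,f)=(\pi^\bullet,f_d^\bullet)$.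 *)

theory Defs
  imports
    "HOL-Analysis.Analysis"
    "Graph_Theory.Graph_Theory"
    "Jordan_Normal_Form.VS_Connect"
begin

section \<open>Hilbert spaces and bounded operators\<close>

text \<open>Hilbert spaces are carrier-based, because the spaces of a representation vary from vertex to
  vertex. The fields \<open>mult\<close> and \<open>one\<close> that the HOL-Algebra record of modules inherits from rings
  carry no information.\<close>

record 'a inner_module = "(complex, 'a) module" +
  ip :: "'a \<Rightarrow> 'a \<Rightarrow> complex"

definition hnorm :: "'a inner_module \<Rightarrow> 'a \<Rightarrow> real" where
  "hnorm H x = sqrt (Re (ip H x x))"

text \<open>\<^locale>\<open>Metric_space\<close> wants a symmetric nonnegative function on the whole type, hence the
  dummy value off the carrier.\<close>

definition hdist :: "'a inner_module \<Rightarrow> 'a \<Rightarrow> 'a \<Rightarrow> real" where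
  "hdist H x y =
     (if x \<in> carrier H \<and> y \<in> carrier H then hnorm H (x \<ominus>\<^bsub>H\<^esub> y) else 0)"

locale complex_inner_space =
  vectorspace "class_ring :: complex ring" H for H :: "'a inner_module" (structure) +
  assumes ip_add: "\<lbrakk>x \<in> carrier H; y \<in> carrier H; z \<in> carrier H\<rbrakk>
      \<Longrightarrow> ip H (x \<oplus> y) z = ip H x z + ip H y z"
    and ip_smult: "\<lbrakk>x \<in> carrier H; y \<in> carrier H\<rbrakk> \<Longrightarrow> ip H (a \<odot>\<^bsub>H\<^esub> x) y = a * ip H x y"
    and ip_commute: "\<lbrakk>x \<in> carrier H; y \<in> carrier H\<rbrakk> \<Longrightarrow> ip H x y = cnj (ip H y x)"
    and ip_nonneg: "x \<in> carrier H \<Longrightarrow> 0 \<le> Re (ip H x x)"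
    and ip_definite: "\<lbrakk>x \<in> carrier H; ip H x x = 0\<rbrakk> \<Longrightarrow> x = \<zero>"

locale separable_hilbert_space = complex_inner_space +
  assumes complete: "Metric_space.mcomplete (carrier H) (hdist H)"
    and separable: "separable_space (Metric_space.mtopology (carrier H) (hdist H))"

definition finite_dimensional :: "'a inner_module \<Rightarrow> bool" where
  "finite_dimensional H \<longleftrightarrow> vectorspace.fin_dim (class_ring :: complex ring) H"

definition hdim :: "'a inner_module \<Rightarrow> nat" where
  "hdim H = vectorspace.dim (class_ring :: complex ring) H"

text \<open>Operators are extensional, so that two operators are equal iff they agree on the carrier.\<close>

definition bounded_ops :: "'a inner_module \<Rightarrow> 'b inner_module \<Rightarrow> ('a \<Rightarrow> 'b) set" where
  "bounded_ops H K = {T \<in> module_hom (class_ring :: complex ring) H K \<inter> extensional (carrier H).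
     \<exists>B. \<forall>x\<in>carrier H. hnorm K (T x) \<le> B * hnorm H x}"

definition is_adjoint ::
    "'a inner_module \<Rightarrow> 'b inner_module \<Rightarrow> ('a \<Rightarrow> 'b) \<Rightarrow> ('b \<Rightarrow> 'a) \<Rightarrow> bool" where
  "is_adjoint H K T S \<longleftrightarrow>
     (\<forall>x\<in>carrier H. \<forall>y\<in>carrier K. ip K (T x) y = ip H x (S y))"

definition adjoint_op ::
    "'a inner_module \<Rightarrow> 'b inner_module \<Rightarrow> ('a \<Rightarrow> 'b) \<Rightarrow> ('b \<Rightarrow> 'a)" where
  "adjoint_op H K T = (THE S. S \<in> bounded_ops K H \<and> is_adjoint H K T S)"

text \<open>The reflection functors need a collection of Hilbert spaces that is closed under direct sums
  indexed by vertices. The elements of all spaces are taken from the following type, which contains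
  an arbitrary type \<open>'b\<close> and is closed under formation of vertex-indexed tuples. The carrier of a
  Hilbert space may be any subset of it, with any operations.\<close>

datatype ('v, 'b) hvec = Atom 'b | Tuple (coord: "'v \<Rightarrow> ('v, 'b) hvec")

definition hilbert_sum ::
    "'v set \<Rightarrow> ('v \<Rightarrow> ('v, 'b) hvec inner_module) \<Rightarrow> ('v, 'b) hvec inner_module" where
  "hilbert_sum J H =
    \<lparr>carrier = Tuple ` (\<Pi>\<^sub>E j\<in>J. carrier (H j)),
     mult = (\<lambda>x y. Tuple (\<lambda>j\<in>J. \<zero>\<^bsub>H j\<^esub>)),
     one = Tuple (\<lambda>j\<in>J. \<zero>\<^bsub>H j\<^esub>),
     zero = Tuple (\<lambda>j\<in>J. \<zero>\<^bsub>H j\<^esub>),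
     add = (\<lambda>x y. Tuple (\<lambda>j\<in>J. coord x j \<oplus>\<^bsub>H j\<^esub> coord y j)),
     smult = (\<lambda>a x. Tuple (\<lambda>j\<in>J. a \<odot>\<^bsub>H j\<^esub> coord x j)),
     ip = (\<lambda>x y. \<Sum>j\<in>J. ip (H j) (coord x j) (coord y j))\<rparr>"

definition orth_complement :: "'a inner_module \<Rightarrow> 'a set \<Rightarrow> 'a inner_module" where
  "orth_complement H W = H\<lparr>carrier := {x \<in> carrier H. \<forall>w\<in>W. ip H w x = 0}\<rparr>"


section \<open>Categories, functors, equivalences\<close>

text \<open>Arrows need not determine their source and target, so composition and the arrow part of a
  functor take the objects involved as arguments: \<open>Comp C X Y Z g h\<close> is the composite of
  \<open>h : X \<rightarrow> Y\<close> and \<open>g : Y \<rightarrow> Z\<close>.\<close>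

record ('o, 'm) cat =
  Obj :: "'o set"
  Hom :: "'o \<Rightarrow> 'o \<Rightarrow> 'm set"
  Ident :: "'o \<Rightarrow> 'm"
  Comp :: "'o \<Rightarrow> 'o \<Rightarrow> 'o \<Rightarrow> 'm \<Rightarrow> 'm \<Rightarrow> 'm"

definition is_category :: "('o, 'm) cat \<Rightarrow> bool" where
  "is_category C \<longleftrightarrow>
     (\<forall>X\<in>Obj C. Ident C X \<in> Hom C X X) \<and>
     (\<forall>X\<in>Obj C. \<forall>Y\<in>Obj C. \<forall>Z\<in>Obj C. \<forall>h\<in>Hom C X Y. \<forall>g\<in>Hom C Y Z.
        Comp C X Y Z g h \<in> Hom C X Z) \<and>
     (\<forall>X\<in>Obj C. \<forall>Y\<in>Obj C. \<forall>h\<in>Hom C X Y.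
        Comp C X X Y h (Ident C X) = h \<and> Comp C X Y Y (Ident C Y) h = h) \<and>
     (\<forall>W\<in>Obj C. \<forall>X\<in>Obj C. \<forall>Y\<in>Obj C. \<forall>Z\<in>Obj C.
        \<forall>h\<in>Hom C W X. \<forall>g\<in>Hom C X Y. \<forall>k\<in>Hom C Y Z.
        Comp C W Y Z k (Comp C W X Y g h) = Comp C W X Z (Comp C X Y Z k g) h)"

definition full_sub :: "('o, 'm) cat \<Rightarrow> ('o \<Rightarrow> bool) \<Rightarrow> ('o, 'm) cat" where
  "full_sub C P = C\<lparr>Obj := {X \<in> Obj C. P X}\<rparr>"

definition is_full_subcategory :: "('o, 'm) cat \<Rightarrow> ('o, 'm) cat \<Rightarrow> bool" where
  "is_full_subcategory D C \<longleftrightarrow> Obj D \<subseteq> Obj C \<and>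
     (\<forall>X\<in>Obj D. Ident D X = Ident C X) \<and>
     (\<forall>X\<in>Obj D. \<forall>Y\<in>Obj D. Hom D X Y = Hom C X Y) \<and>
     (\<forall>X\<in>Obj D. \<forall>Y\<in>Obj D. \<forall>Z\<in>Obj D. \<forall>h\<in>Hom D X Y. \<forall>g\<in>Hom D Y Z.
        Comp D X Y Z g h = Comp C X Y Z g h)"

record ('o, 'm, 'p, 'n) fctr =
  omap :: "'o \<Rightarrow> 'p"
  amap :: "'o \<Rightarrow> 'o \<Rightarrow> 'm \<Rightarrow> 'n"

definition is_functor :: "('o, 'm) cat \<Rightarrow> ('p, 'n) cat \<Rightarrow> ('o, 'm, 'p, 'n) fctr \<Rightarrow> bool" where
  "is_functor C D F \<longleftrightarrow> is_category C \<and> is_category D \<and>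
     (\<forall>X\<in>Obj C. omap F X \<in> Obj D) \<and>
     (\<forall>X\<in>Obj C. \<forall>Y\<in>Obj C. \<forall>h\<in>Hom C X Y. amap F X Y h \<in> Hom D (omap F X) (omap F Y)) \<and>
     (\<forall>X\<in>Obj C. amap F X X (Ident C X) = Ident D (omap F X)) \<and>
     (\<forall>X\<in>Obj C. \<forall>Y\<in>Obj C. \<forall>Z\<in>Obj C. \<forall>h\<in>Hom C X Y. \<forall>g\<in>Hom C Y Z.
        amap F X Z (Comp C X Y Z g h)
          = Comp D (omap F X) (omap F Y) (omap F Z) (amap F Y Z g) (amap F X Y h))"

definition id_fctr :: "('o, 'm, 'o, 'm) fctr" where
  "id_fctr = \<lparr>omap = (\<lambda>X. X), amap = (\<lambda>X Y h. h)\<rparr>"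

definition comp_fctr ::
    "('p, 'n, 'q, 'k) fctr \<Rightarrow> ('o, 'm, 'p, 'n) fctr \<Rightarrow> ('o, 'm, 'q, 'k) fctr" where
  "comp_fctr E F = \<lparr>omap = (\<lambda>X. omap E (omap F X)),
     amap = (\<lambda>X Y h. amap E (omap F X) (omap F Y) (amap F X Y h))\<rparr>"

definition is_isomorphism :: "('o, 'm) cat \<Rightarrow> 'o \<Rightarrow> 'o \<Rightarrow> 'm \<Rightarrow> bool" where
  "is_isomorphism C X Y h \<longleftrightarrow> h \<in> Hom C X Y \<and>
     (\<exists>g\<in>Hom C Y X. Comp C X Y X g h = Ident C X \<and> Comp C Y X Y h g = Ident C Y)"

definition naturally_isomorphic ::
    "('o, 'm) cat \<Rightarrow> ('p, 'n) cat \<Rightarrow> ('o, 'm, 'p, 'n) fctr \<Rightarrow> ('o, 'm, 'p, 'n) fctr \<Rightarrow> bool" where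
  "naturally_isomorphic C D E F \<longleftrightarrow> is_functor C D E \<and> is_functor C D F \<and>
     (\<exists>\<eta>. (\<forall>X\<in>Obj C. is_isomorphism D (omap E X) (omap F X) (\<eta> X)) \<and>
          (\<forall>X\<in>Obj C. \<forall>Y\<in>Obj C. \<forall>h\<in>Hom C X Y.
             Comp D (omap E X) (omap E Y) (omap F Y) (\<eta> Y) (amap E X Y h)
               = Comp D (omap E X) (omap F X) (omap F Y) (amap F X Y h) (\<eta> X)))"

definition is_equivalence :: "('o, 'm) cat \<Rightarrow> ('p, 'n) cat \<Rightarrow> ('o, 'm, 'p, 'n) fctr \<Rightarrow> bool" where
  "is_equivalence C D F \<longleftrightarrow> is_functor C D F \<and>
     (\<exists>E. is_functor D C E \<and>
          naturally_isomorphic C C (comp_fctr E F) id_fctr \<and>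
          naturally_isomorphic D D (comp_fctr F E) id_fctr)"


section \<open>Graphs and vectors\<close>

text \<open>An undirected simple graph is a symmetric loop-free \<open>pair_pre_digraph\<close> (locale
  \<open>pair_graph\<close>), so a single edge already gives the closed walk \<open>i \<rightarrow> j \<rightarrow> i\<close>, which the library
  counts as a cycle. Cycles of the undirected graph are those of length at least 3; the library's
  \<open>forest\<close> is unsuitable here.\<close>

definition acyclic_graph :: "'v pair_pre_digraph \<Rightarrow> bool" where
  "acyclic_graph G \<longleftrightarrow> \<not> (\<exists>p. pre_digraph.cycle (with_proj G) p \<and> 3 \<le> length p)"

definition nbrs :: "'v pair_pre_digraph \<Rightarrow> 'v \<Rightarrow> 'v set" where
  "nbrs G i = {j. (i, j) \<in> parcs G}"

text \<open>In what follows \<open>A\<close> and \<open>B\<close> stand for the two parity classes: \<open>A\<close> is the reflected class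
  and \<open>B\<close> the other one, so \<open>(A, B)\<close> is (even, odd) for the functor of even reflections and
  (odd, even) for the functor of odd reflections. In particular, \<open>reflect_vec G A\<close> is
  the linear map of even reflections if \<open>A\<close> is the set of even vertices.\<close>

definition VG :: "'v pair_pre_digraph \<Rightarrow> ('v \<Rightarrow> real) set" where
  "VG G = extensional (pverts G)"

definition VG_plus :: "'v pair_pre_digraph \<Rightarrow> ('v \<Rightarrow> real) set" where
  "VG_plus G = {x \<in> VG G. (\<exists>i\<in>pverts G. x i \<noteq> 0) \<and> (\<forall>i\<in>pverts G. 0 \<le> x i)}"

definition ZG_plus :: "'v pair_pre_digraph \<Rightarrow> ('v \<Rightarrow> real) set" where
  "ZG_plus G = {x \<in> VG_plus G. \<forall>i\<in>pverts G. x i \<in> \<int>}"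

definition reflect_vec :: "'v pair_pre_digraph \<Rightarrow> 'v set \<Rightarrow> ('v \<Rightarrow> real) \<Rightarrow> ('v \<Rightarrow> real)" where
  "reflect_vec G A x = (\<lambda>i\<in>pverts G. if i \<in> A then - x i + (\<Sum>j\<in>nbrs G i. x j) else x i)"

definition X_supp :: "'v pair_pre_digraph \<Rightarrow> ('v \<Rightarrow> real) \<Rightarrow> 'v set" where
  "X_supp G d = {i \<in> pverts G. d i \<noteq> 0}"

definition S_pairs :: "'v pair_pre_digraph \<Rightarrow> (('v \<Rightarrow> real) \<times> ('v \<Rightarrow> real)) set" where
  "S_pairs G = {(d, f). d \<in> ZG_plus G \<and> f \<in> VG_plus G \<and> (\<forall>i\<in>pverts G. 0 < d i + f i)}"

definition S_parity :: "'v pair_pre_digraph \<Rightarrow> 'v set \<Rightarrow> (('v \<Rightarrow> real) \<times> ('v \<Rightarrow> real)) set" where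
  "S_parity G A = {(d, f) \<in> S_pairs G. \<forall>i \<in> X_supp G d \<inter> A. 0 < f i}"

text \<open>The character changes at the vertices of the class \<open>B\<close> that is not reflected.\<close>

definition reflect_char ::
    "'v pair_pre_digraph \<Rightarrow> 'v set \<Rightarrow> ('v \<Rightarrow> real) \<Rightarrow> ('v \<Rightarrow> real) \<Rightarrow> ('v \<Rightarrow> real)" where
  "reflect_char G B d f =
     (\<lambda>i\<in>pverts G. if i \<in> X_supp G d \<inter> B then reflect_vec G B f i else f i)"


section \<open>Representations\<close>

text \<open>\<open>gam \<pi> i j\<close> is the operator from the space at \<open>j\<close> to the space at \<open>i\<close>.\<close>

record ('v, 'a) rep =
  sp :: "'v \<Rightarrow> 'a inner_module"
  gam :: "'v \<Rightarrow> 'v \<Rightarrow> 'a \<Rightarrow> 'a"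

definition is_rep :: "'v pair_pre_digraph \<Rightarrow> ('v, 'a) rep \<Rightarrow> bool" where
  "is_rep G \<pi> \<longleftrightarrow>
     sp \<pi> \<in> extensional (pverts G) \<and>
     (\<forall>i j. (i, j) \<notin> parcs G \<longrightarrow> gam \<pi> i j = undefined) \<and>
     (\<forall>i\<in>pverts G. separable_hilbert_space (sp \<pi> i)) \<and>
     (\<forall>(i, j)\<in>parcs G. gam \<pi> i j \<in> bounded_ops (sp \<pi> j) (sp \<pi> i) \<and>
        is_adjoint (sp \<pi> j) (sp \<pi> i) (gam \<pi> i j) (gam \<pi> j i))"

definition rep_hom :: "'v pair_pre_digraph \<Rightarrow> ('v, 'a) rep \<Rightarrow> ('v, 'a) rep \<Rightarrow> ('v \<Rightarrow> 'a \<Rightarrow> 'a) set" where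
  "rep_hom G \<pi> \<rho> = {C \<in> (\<Pi>\<^sub>E i\<in>pverts G. bounded_ops (sp \<pi> i) (sp \<rho> i)).
     \<forall>(j, i)\<in>parcs G. \<forall>x\<in>carrier (sp \<pi> i). C j (gam \<pi> j i x) = gam \<rho> j i (C i x)}"

definition A_op :: "'v pair_pre_digraph \<Rightarrow> ('v, 'a) rep \<Rightarrow> 'v \<Rightarrow> 'a \<Rightarrow> 'a" where
  "A_op G \<pi> i x = finsum (sp \<pi> i) (\<lambda>j. gam \<pi> i j (gam \<pi> j i x)) (nbrs G i)"

definition locally_scalar :: "'v pair_pre_digraph \<Rightarrow> ('v, 'a) rep \<Rightarrow> bool" where
  "locally_scalar G \<pi> \<longleftrightarrow>
     (\<forall>i\<in>pverts G. \<exists>\<alpha>. \<forall>x\<in>carrier (sp \<pi> i). A_op G \<pi> i x = \<alpha> \<odot>\<^bsub>sp \<pi> i\<^esub> x)"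

definition is_character :: "'v pair_pre_digraph \<Rightarrow> ('v, 'a) rep \<Rightarrow> ('v \<Rightarrow> real) \<Rightarrow> bool" where
  "is_character G \<pi> f \<longleftrightarrow> f \<in> VG G \<and>
     (\<forall>i\<in>pverts G. \<forall>x\<in>carrier (sp \<pi> i). A_op G \<pi> i x = complex_of_real (f i) \<odot>\<^bsub>sp \<pi> i\<^esub> x)"

definition finite_dimensional_rep :: "'v pair_pre_digraph \<Rightarrow> ('v, 'a) rep \<Rightarrow> bool" where
  "finite_dimensional_rep G \<pi> \<longleftrightarrow> (\<forall>i\<in>pverts G. finite_dimensional (sp \<pi> i))"

definition dim_vec :: "'v pair_pre_digraph \<Rightarrow> ('v, 'a) rep \<Rightarrow> ('v \<Rightarrow> real)" where
  "dim_vec G \<pi> = (\<lambda>i\<in>pverts G. real (hdim (sp \<pi> i)))"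

type_synonym ('v, 'a) rep_obj = "('v, 'a) rep \<times> ('v \<Rightarrow> real)"
type_synonym ('v, 'a) rep_cat = "(('v, 'a) rep_obj, 'v \<Rightarrow> 'a \<Rightarrow> 'a) cat"

definition Rep ::
    "'v pair_pre_digraph \<Rightarrow> ('v \<Rightarrow> real) \<Rightarrow> ('v \<Rightarrow> real) \<Rightarrow> ('v, 'a) rep_cat" where
  "Rep G d f =
    \<lparr>Obj = {(\<pi>, f) |\<pi>. is_rep G \<pi> \<and> finite_dimensional_rep G \<pi> \<and> locally_scalar G \<pi> \<and>
              dim_vec G \<pi> = d \<and> is_character G \<pi> f},
     Hom = (\<lambda>X Y. rep_hom G (fst X) (fst Y)),
     Ident = (\<lambda>X. \<lambda>i\<in>pverts G. \<lambda>x\<in>carrier (sp (fst X) i). x),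
     Comp = (\<lambda>X Y Z D C. \<lambda>i\<in>pverts G. compose (carrier (sp (fst X) i)) (D i) (C i))\<rparr>"

definition Rep_parity ::
    "'v pair_pre_digraph \<Rightarrow> 'v set \<Rightarrow> ('v \<Rightarrow> real) \<Rightarrow> ('v \<Rightarrow> real) \<Rightarrow> ('v, 'a) rep_cat" where
  "Rep_parity G A d f = full_sub (Rep G d f) (\<lambda>X. \<forall>i \<in> X_supp G d \<inter> A. 0 < snd X i)"

text \<open>The union of the object sets is disjoint: an object \<open>(\<pi>, f)\<close> determines \<open>f\<close>
  and the dimension of \<open>\<pi>\<close>.\<close>

definition Rep_coprod :: "'v pair_pre_digraph \<Rightarrow> ('v, 'a) rep_cat" where
  "Rep_coprod G =
    \<lparr>Obj = (\<Union>(d, f)\<in>S_pairs G. Obj (Rep G d f)),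
     Hom = (\<lambda>X Y. {C. \<exists>(d, f)\<in>S_pairs G.
              X \<in> Obj (Rep G d f) \<and> Y \<in> Obj (Rep G d f) \<and> C \<in> Hom (Rep G d f) X Y}),
     Ident = (\<lambda>X. Ident (Rep G (dim_vec G (fst X)) (snd X)) X),
     Comp = (\<lambda>X. Comp (Rep G (dim_vec G (fst X)) (snd X)) X)\<rparr>"

definition Rep_coprod_parity :: "'v pair_pre_digraph \<Rightarrow> 'v set \<Rightarrow> ('v, 'a) rep_cat" where
  "Rep_coprod_parity G A =
     full_sub (Rep_coprod G) (\<lambda>X. (dim_vec G (fst X), snd X) \<in> S_parity G A)"


section \<open>The reflection functors\<close>

definition isometry_in ::
    "'v pair_pre_digraph \<Rightarrow> ('v, ('v, 'b) hvec) rep \<Rightarrow> ('v \<Rightarrow> real) \<Rightarrow> 'v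
      \<Rightarrow> ('v, 'b) hvec \<Rightarrow> ('v, 'b) hvec" where
  "isometry_in G \<pi> f i x =
     Tuple (\<lambda>j\<in>nbrs G i. complex_of_real (1 / sqrt (f i)) \<odot>\<^bsub>sp \<pi> j\<^esub> gam \<pi> j i x)"

definition hat_space ::
    "'v pair_pre_digraph \<Rightarrow> ('v, ('v, 'b) hvec) rep \<Rightarrow> ('v \<Rightarrow> real) \<Rightarrow> 'v
      \<Rightarrow> ('v, 'b) hvec inner_module" where
  "hat_space G \<pi> f i =
     orth_complement (hilbert_sum (nbrs G i) (sp \<pi>)) (isometry_in G \<pi> f i ` carrier (sp \<pi> i))"

text \<open>\<open>delta_out G \<pi> f j i\<close> is \<open>\<Delta>\<^sub>j\<^sub>i\<close> for \<open>i\<close> in the reflected class: the inclusion of the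
  orthogonal complement has components \<open>x \<mapsto> coord x j\<close>, which must equal \<open>\<alpha>\<^sub>i\<close> to the power \<open>-1/2\<close>
  times \<open>\<Delta>\<^sub>j\<^sub>i\<close>.\<close>

definition delta_out ::
    "'v pair_pre_digraph \<Rightarrow> ('v, ('v, 'b) hvec) rep \<Rightarrow> ('v \<Rightarrow> real) \<Rightarrow> 'v \<Rightarrow> 'v
      \<Rightarrow> ('v, 'b) hvec \<Rightarrow> ('v, 'b) hvec" where
  "delta_out G \<pi> f j i =
     (\<lambda>x\<in>carrier (hat_space G \<pi> f i). complex_of_real (sqrt (f i)) \<odot>\<^bsub>sp \<pi> j\<^esub> coord x j)"

definition reflect_rep ::
    "'v pair_pre_digraph \<Rightarrow> 'v set \<Rightarrow> ('v, ('v, 'b) hvec) rep_obj \<Rightarrow> ('v, ('v, 'b) hvec) rep" where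
  "reflect_rep G A X = (case X of (\<pi>, f) \<Rightarrow>
    \<lparr>sp = (\<lambda>i\<in>pverts G. if i \<in> A then hat_space G \<pi> f i else sp \<pi> i),
     gam = (\<lambda>k l.
       if (k, l) \<notin> parcs G then undefined
       else if l \<in> A then delta_out G \<pi> f k l
       else adjoint_op (hat_space G \<pi> f k) (sp \<pi> l) (delta_out G \<pi> f l k))\<rparr>)"

definition reflect_hom ::
    "'v pair_pre_digraph \<Rightarrow> 'v set \<Rightarrow> ('v, ('v, 'b) hvec) rep_obj \<Rightarrow> ('v, ('v, 'b) hvec) rep_obj
      \<Rightarrow> ('v \<Rightarrow> ('v, 'b) hvec \<Rightarrow> ('v, 'b) hvec) \<Rightarrow> ('v \<Rightarrow> ('v, 'b) hvec \<Rightarrow> ('v, 'b) hvec)" where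
  "reflect_hom G A X Y C =
    (let \<pi>' = reflect_rep G A X; \<rho>' = reflect_rep G A Y; f = snd X in
     (\<lambda>i\<in>pverts G. if i \<in> A
       then (\<lambda>x\<in>carrier (sp \<pi>' i). complex_of_real (1 / f i) \<odot>\<^bsub>sp \<rho>' i\<^esub>
               finsum (sp \<rho>' i) (\<lambda>j. gam \<rho>' i j (C j (gam \<pi>' j i x))) (nbrs G i))
       else C i))"

type_synonym ('v, 'b) rep_fctr =
  "(('v, ('v, 'b) hvec) rep_obj, 'v \<Rightarrow> ('v, 'b) hvec \<Rightarrow> ('v, 'b) hvec,
    ('v, ('v, 'b) hvec) rep_obj, 'v \<Rightarrow> ('v, 'b) hvec \<Rightarrow> ('v, 'b) hvec) fctr"

definition reflection_functor ::
    "'v pair_pre_digraph \<Rightarrow> 'v set \<Rightarrow> 'v set \<Rightarrow> ('v, 'b) rep_fctr" where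
  "reflection_functor G A B =
    \<lparr>omap = (\<lambda>X. (reflect_rep G A X, reflect_char G B (dim_vec G (fst X)) (snd X))),
     amap = reflect_hom G A\<rparr>"

end

theory Submission
  imports Defs
begin

text \<open>
Let \<open>A\<close> be the reflected parity class, \<open>B\<close> the other one, and let \<open>i\<close> be a vertex in \<open>A\<close>, with
\<open>\<alpha> = f i > 0\<close>. Local scalarity at \<open>i\<close> says that \<open>U i = \<alpha>\<close> to the power \<open>-1/2\<close> times the column of the operators
\<open>gam \<pi> j i\<close> is an isometry from the space at \<open>i\<close> into the direct sum of the spaces at its neighbours;
the reflection replaces the space at \<open>i\<close> by the orthogonal complement of the image of \<open>U i\<close>. The
neighbours of \<open>i\<close> lie in \<open>B\<close>, where the spaces do not change, so the reflections at the vertices of \<open>A\<close>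
do not interfere with each other.

Objects. With respect to the inclusion of the complement, the operator from the space at \<open>j\<close> into the
complement is a multiple of the orthogonal projection of the \<open>j\<close>-th summand, which has an explicit
formula (\<open>delta_in\<close>). From it, the operators on the edge between \<open>i\<close> and \<open>j\<close> compose, on the space at
\<open>j\<close>, to \<open>\<alpha>\<close> minus what they composed to before. Summing over the neighbours \<open>i\<close> of \<open>j\<close> gives the new
character (\<open>character'\<close>); the new dimension is a difference of dimensions, since \<open>U i\<close> is an isometry
(\<open>hat_hdim\<close>).

Morphisms. The complement of the image of \<open>U i\<close> is the kernel of its adjoint, and a morphism intertwines
these adjoints. Therefore its reflection is just the restriction to the complements of the morphism
applied to each component (\<open>C'_A\<close>), and functoriality is immediate.

The square. The second reflection forms the complement of the complement, which is the image of \<open>U i\<close>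
again (\<open>U_surj_hat''\<close>). So the maps \<open>U i\<close> for \<open>i\<close> in \<open>A\<close> and the identities at the vertices of \<open>B\<close> form a unitary
morphism from a representation to its double reflection, and it is natural because reflected morphisms
act componentwise (\<open>square_unit_isomorphism\<close>, \<open>square_unit_natural\<close>).

A functor whose square is isomorphic to the identity is its own quasi-inverse, and it restricts to an
equivalence between any two full subcategories that it interchanges
(\<open>is_equivalence_of_involution\<close>). For the subcategories given by a pair \<open>(d, f)\<close> and its reflection,
this follows since reflecting pairs is an involution as well. The reflected pair can violate the
positivity conditions, but then there is no representation with this dimension and character, and the
two categories are both empty (\<open>S_parity_reflect\<close>).

All spaces are finite-dimensional, and the facts about them that are needed (boundedness of linear maps,
completeness, separability, dimensions of sums and complements) are read off from orthonormal bases.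
\<close>

section \<open>Inner product spaces\<close>

context complex_inner_space
begin

lemma zero_in [simp]: "\<zero>\<^bsub>H\<^esub> \<in> carrier H"
  by simp

lemma add_in [simp]: "\<lbrakk>x \<in> carrier H; y \<in> carrier H\<rbrakk> \<Longrightarrow> x \<oplus>\<^bsub>H\<^esub> y \<in> carrier H"
  by simp

lemma smult_in [simp]: "x \<in> carrier H \<Longrightarrow> a \<odot>\<^bsub>H\<^esub> x \<in> carrier H"
  by simp

lemma finsum_in [simp]: "f \<in> J \<rightarrow> carrier H \<Longrightarrow> finsum H f J \<in> carrier H"
  by (rule M.finsum_closed)

lemma diff_in [simp]: "\<lbrakk>x \<in> carrier H; y \<in> carrier H\<rbrakk> \<Longrightarrow> x \<ominus>\<^bsub>H\<^esub> y \<in> carrier H"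
  by simp

lemma smult_zero_left: "x \<in> carrier H \<Longrightarrow> 0 \<odot>\<^bsub>H\<^esub> x = \<zero>\<^bsub>H\<^esub>"
  using lmult_0[of x] by simp

lemma diff_eq: "\<lbrakk>x \<in> carrier H; y \<in> carrier H\<rbrakk> \<Longrightarrow> x \<ominus>\<^bsub>H\<^esub> y = x \<oplus>\<^bsub>H\<^esub> (- 1) \<odot>\<^bsub>H\<^esub> y"
  using smult_minus_1[of y] class_ring.ring_axioms by (simp add: a_minus_def class_ring_simps)

lemma ip_add_right:
  "\<lbrakk>x \<in> carrier H; y \<in> carrier H; z \<in> carrier H\<rbrakk> \<Longrightarrow> ip H z (x \<oplus>\<^bsub>H\<^esub> y) = ip H z x + ip H z y"
  by (subst (1 2 3) ip_commute) (simp_all add: ip_add)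

lemma ip_smult_right:
  "\<lbrakk>x \<in> carrier H; y \<in> carrier H\<rbrakk> \<Longrightarrow> ip H x (a \<odot>\<^bsub>H\<^esub> y) = cnj a * ip H x y"
  by (subst (1 2) ip_commute) (simp_all add: ip_smult)

lemma ip_zero_left [simp]: "x \<in> carrier H \<Longrightarrow> ip H \<zero>\<^bsub>H\<^esub> x = 0"
  using ip_smult[of "\<zero>\<^bsub>H\<^esub>" x 0] smult_zero_left[of "\<zero>\<^bsub>H\<^esub>"] by simp

lemma ip_zero_right [simp]: "x \<in> carrier H \<Longrightarrow> ip H x \<zero>\<^bsub>H\<^esub> = 0"
  by (subst ip_commute) simp_all

lemma ip_diff_left:
  "\<lbrakk>x \<in> carrier H; y \<in> carrier H; z \<in> carrier H\<rbrakk> \<Longrightarrow> ip H (x \<ominus>\<^bsub>H\<^esub> y) z = ip H x z - ip H y z"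
  by (simp add: diff_eq ip_add ip_smult)

lemma ip_diff_right:
  "\<lbrakk>x \<in> carrier H; y \<in> carrier H; z \<in> carrier H\<rbrakk> \<Longrightarrow> ip H z (x \<ominus>\<^bsub>H\<^esub> y) = ip H z x - ip H z y"
  by (simp add: diff_eq ip_add_right ip_smult_right)

lemma ip_finsum_left:
  assumes "finite J" "f \<in> J \<rightarrow> carrier H" "z \<in> carrier H"
  shows "ip H (finsum H f J) z = (\<Sum>j\<in>J. ip H (f j) z)"
  using assms by (induction J rule: finite_induct) (auto simp: ip_add Pi_iff)

lemma ip_finsum_right:
  assumes "finite J" "f \<in> J \<rightarrow> carrier H" "z \<in> carrier H"
  shows "ip H z (finsum H f J) = (\<Sum>j\<in>J. ip H z (f j))"
  using assms by (induction J rule: finite_induct) (auto simp: ip_add_right Pi_iff)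

text \<open>Definiteness lets an equation between vectors be tested against all vectors, which turns
  identities between vectors into identities between complex numbers.\<close>

lemma ip_ext:
  assumes "x \<in> carrier H" "y \<in> carrier H" "\<And>z. z \<in> carrier H \<Longrightarrow> ip H x z = ip H y z"
  shows "x = y"
proof -
  have "ip H (x \<ominus>\<^bsub>H\<^esub> y) (x \<ominus>\<^bsub>H\<^esub> y) = 0"
    using assms by (simp add: ip_diff_left)
  then have "x \<ominus>\<^bsub>H\<^esub> y = \<zero>\<^bsub>H\<^esub>"
    using assms by (intro ip_definite) auto
  then show ?thesis using assms by simp
qed

lemma ip_self: "x \<in> carrier H \<Longrightarrow> ip H x x = complex_of_real ((hnorm H x)\<^sup>2)"
  using ip_nonneg[of x] ip_commute[of x x]
  by (simp add: hnorm_def complex_eq_iff)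

lemma hnorm_zero_iff: "x \<in> carrier H \<Longrightarrow> hnorm H x = 0 \<longleftrightarrow> x = \<zero>\<^bsub>H\<^esub>"
  using ip_self[of x] ip_definite[of x] by (auto simp: hnorm_def)

lemma add_commute: "\<lbrakk>x \<in> carrier H; y \<in> carrier H\<rbrakk> \<Longrightarrow> x \<oplus>\<^bsub>H\<^esub> y = y \<oplus>\<^bsub>H\<^esub> x"
  by (rule M.a_comm)

lemma add_assoc: "\<lbrakk>x \<in> carrier H; y \<in> carrier H; z \<in> carrier H\<rbrakk>
    \<Longrightarrow> (x \<oplus>\<^bsub>H\<^esub> y) \<oplus>\<^bsub>H\<^esub> z = x \<oplus>\<^bsub>H\<^esub> (y \<oplus>\<^bsub>H\<^esub> z)"
  by (rule M.a_assoc)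

lemma add_zero: "x \<in> carrier H \<Longrightarrow> x \<oplus>\<^bsub>H\<^esub> \<zero>\<^bsub>H\<^esub> = x"
  by simp

lemma smult_one': "x \<in> carrier H \<Longrightarrow> 1 \<odot>\<^bsub>H\<^esub> x = x"
  using smult_one[of x] by simp

lemma smult_smult: "x \<in> carrier H \<Longrightarrow> a \<odot>\<^bsub>H\<^esub> (b \<odot>\<^bsub>H\<^esub> x) = (a * b) \<odot>\<^bsub>H\<^esub> x"
  using smult_assoc1[of a b x] by simp

lemma smult_add_scalar: "x \<in> carrier H \<Longrightarrow> (a + b) \<odot>\<^bsub>H\<^esub> x = a \<odot>\<^bsub>H\<^esub> x \<oplus>\<^bsub>H\<^esub> b \<odot>\<^bsub>H\<^esub> x"
  using smult_l_distr[of a b x] by simp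

lemma smult_add_vector: "\<lbrakk>x \<in> carrier H; y \<in> carrier H\<rbrakk>
    \<Longrightarrow> a \<odot>\<^bsub>H\<^esub> (x \<oplus>\<^bsub>H\<^esub> y) = a \<odot>\<^bsub>H\<^esub> x \<oplus>\<^bsub>H\<^esub> a \<odot>\<^bsub>H\<^esub> y"
  using smult_r_distr[of a x y] by simp

end

text \<open>Inverses need not be exhibited: once multiplication by zero gives zero, the multiple by \<open>- 1\<close> is an
  inverse.\<close>

lemma complex_inner_spaceI:
  fixes H :: "'a inner_module" (structure)
  assumes "\<zero> \<in> carrier H"
    and "\<And>x y. \<lbrakk>x \<in> carrier H; y \<in> carrier H\<rbrakk> \<Longrightarrow> x \<oplus> y \<in> carrier H"
    and "\<And>a x. x \<in> carrier H \<Longrightarrow> a \<odot>\<^bsub>H\<^esub> x \<in> carrier H"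
    and "\<And>x y. \<lbrakk>x \<in> carrier H; y \<in> carrier H\<rbrakk> \<Longrightarrow> x \<oplus> y = y \<oplus> x"
    and "\<And>x y z. \<lbrakk>x \<in> carrier H; y \<in> carrier H; z \<in> carrier H\<rbrakk> \<Longrightarrow> (x \<oplus> y) \<oplus> z = x \<oplus> (y \<oplus> z)"
    and "\<And>x. x \<in> carrier H \<Longrightarrow> x \<oplus> \<zero> = x"
    and "\<And>x. x \<in> carrier H \<Longrightarrow> 0 \<odot>\<^bsub>H\<^esub> x = \<zero>"
    and "\<And>x. x \<in> carrier H \<Longrightarrow> 1 \<odot>\<^bsub>H\<^esub> x = x"
    and "\<And>a b x. x \<in> carrier H \<Longrightarrow> (a * b) \<odot>\<^bsub>H\<^esub> x = a \<odot>\<^bsub>H\<^esub> (b \<odot>\<^bsub>H\<^esub> x)"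
    and "\<And>a b x. x \<in> carrier H \<Longrightarrow> (a + b) \<odot>\<^bsub>H\<^esub> x = a \<odot>\<^bsub>H\<^esub> x \<oplus> b \<odot>\<^bsub>H\<^esub> x"
    and "\<And>a x y. \<lbrakk>x \<in> carrier H; y \<in> carrier H\<rbrakk> \<Longrightarrow> a \<odot>\<^bsub>H\<^esub> (x \<oplus> y) = a \<odot>\<^bsub>H\<^esub> x \<oplus> a \<odot>\<^bsub>H\<^esub> y"
    and "\<And>x y z. \<lbrakk>x \<in> carrier H; y \<in> carrier H; z \<in> carrier H\<rbrakk> \<Longrightarrow> ip H (x \<oplus> y) z = ip H x z + ip H y z"
    and "\<And>a x y. \<lbrakk>x \<in> carrier H; y \<in> carrier H\<rbrakk> \<Longrightarrow> ip H (a \<odot>\<^bsub>H\<^esub> x) y = a * ip H x y"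
    and "\<And>x y. \<lbrakk>x \<in> carrier H; y \<in> carrier H\<rbrakk> \<Longrightarrow> ip H x y = cnj (ip H y x)"
    and "\<And>x. x \<in> carrier H \<Longrightarrow> 0 \<le> Re (ip H x x)"
    and "\<And>x. \<lbrakk>x \<in> carrier H; ip H x x = 0\<rbrakk> \<Longrightarrow> x = \<zero>"
  shows "complex_inner_space H"
proof (rule complex_inner_space.intro)
  have inv: "x \<oplus> (- 1) \<odot>\<^bsub>H\<^esub> x = \<zero>" if "x \<in> carrier H" for x
    using assms(7,8)[OF that] assms(10)[OF that, of 1 "-1"] by simp
  show "vectorspace (class_ring :: complex ring) H"
  proof (rule vs_criteria[OF class_field], goal_cases)
    case 3
    then show ?case using inv assms(3) by blast
  qed (simp_all, (blast intro: assms(1-6,8-11))+)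
  show "complex_inner_space_axioms H"
    by (rule complex_inner_space_axioms.intro; (rule assms(12-16); assumption))
qed

section \<open>Orthonormal bases and finite dimension\<close>

context complex_inner_space
begin

definition orthonormal :: "'a set \<Rightarrow> bool" where
  "orthonormal B \<longleftrightarrow> finite B \<and> B \<subseteq> carrier H \<and>
     (\<forall>b\<in>B. \<forall>c\<in>B. ip H b c = (if b = c then 1 else 0))"

text \<open>Totality of an orthonormal basis is stated as triviality of its orthogonal complement, because
  this is the form in which it is verified; that it spans is then \<open>onb_expansion\<close>.\<close>

definition onb :: "'a set \<Rightarrow> bool" where
  "onb B \<longleftrightarrow> orthonormal B \<and> (\<forall>x\<in>carrier H. (\<forall>b\<in>B. ip H x b = 0) \<longrightarrow> x = \<zero>\<^bsub>H\<^esub>)"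

lemma orthonormal_lincomb_coeff:
  assumes "orthonormal B" "b \<in> B"
  shows "ip H (finsum H (\<lambda>c. a c \<odot>\<^bsub>H\<^esub> c) B) b = a b"
proof -
  have B: "finite B" "B \<subseteq> carrier H" using assms by (auto simp: orthonormal_def)
  have "ip H (finsum H (\<lambda>c. a c \<odot>\<^bsub>H\<^esub> c) B) b = (\<Sum>c\<in>B. ip H (a c \<odot>\<^bsub>H\<^esub> c) b)"
    using B assms by (intro ip_finsum_left) auto
  also have "\<dots> = (\<Sum>c\<in>B. if c = b then a c else 0)"
    using B assms by (intro sum.cong) (auto simp: orthonormal_def ip_smult subset_iff)
  also have "\<dots> = a b"
    using B assms by simp
  finally show ?thesis .
qed

text \<open>The difference of the two sides is orthogonal to every basis vector.\<close>

lemma onb_expansion: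
  assumes "onb B" "x \<in> carrier H"
  shows "finsum H (\<lambda>b. ip H x b \<odot>\<^bsub>H\<^esub> b) B = x"
proof -
  let ?s = "finsum H (\<lambda>b. ip H x b \<odot>\<^bsub>H\<^esub> b) B"
  have B: "orthonormal B" "B \<subseteq> carrier H" using assms by (auto simp: onb_def orthonormal_def)
  have s: "?s \<in> carrier H" using B by (intro finsum_in) auto
  have "ip H (?s \<ominus>\<^bsub>H\<^esub> x) b = 0" if "b \<in> B" for b
    using that B s assms by (subst ip_diff_left) (auto simp: orthonormal_lincomb_coeff)
  then have "?s \<ominus>\<^bsub>H\<^esub> x = \<zero>\<^bsub>H\<^esub>"
    using assms s by (auto simp: onb_def)
  then show ?thesis using s assms by simp
qed

lemma parseval:
  assumes "onb B" "x \<in> carrier H" "y \<in> carrier H"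
  shows "ip H x y = (\<Sum>b\<in>B. ip H x b * cnj (ip H y b))"
proof -
  have B: "finite B" "B \<subseteq> carrier H" using assms by (auto simp: onb_def orthonormal_def)
  have "ip H x y = ip H (finsum H (\<lambda>b. ip H x b \<odot>\<^bsub>H\<^esub> b) B) y"
    using assms by (simp add: onb_expansion)
  also have "\<dots> = (\<Sum>b\<in>B. ip H x b * ip H b y)"
    using B assms by (subst ip_finsum_left) (auto simp: ip_smult intro!: sum.cong)
  also have "\<dots> = (\<Sum>b\<in>B. ip H x b * cnj (ip H y b))"
  proof (rule sum.cong[OF refl])
    fix b assume "b \<in> B"
    then show "ip H x b * ip H b y = ip H x b * cnj (ip H y b)"
      using B assms ip_commute[of b y] by auto
  qed
  finally show ?thesis .
qed

lemma hnorm_onb: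
  assumes "onb B" "x \<in> carrier H"
  shows "hnorm H x = L2_set (\<lambda>b. cmod (ip H x b)) B"
proof -
  have "ip H x x = complex_of_real (\<Sum>b\<in>B. (cmod (ip H x b))\<^sup>2)"
    using parseval[OF assms assms(2)] by (simp add: complex_norm_square[symmetric])
  then show ?thesis by (simp add: hnorm_def L2_set_def)
qed

lemma orthonormal_lin_indpt:
  assumes "orthonormal B"
  shows "lin_indpt B"
proof (rule finite_lin_indpt2)
  show "finite B" "B \<subseteq> carrier H" using assms by (auto simp: orthonormal_def)
  fix a assume "lincomb a B = \<zero>\<^bsub>H\<^esub>"
  then have "a b = 0" if "b \<in> B" for b
    using that orthonormal_lincomb_coeff[OF assms that, of a] \<open>B \<subseteq> carrier H\<close>
    by (auto simp: lincomb_def)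
  then show "\<forall>v\<in>B. a v = \<zero>\<^bsub>class_ring\<^esub>" by simp
qed

lemma onb_basis:
  assumes "onb B"
  shows "basis B"
proof -
  have B: "orthonormal B" "finite B" "B \<subseteq> carrier H" using assms by (auto simp: onb_def orthonormal_def)
  have "x \<in> span B" if "x \<in> carrier H" for x
  proof -
    have "x = lincomb (ip H x) B" using onb_expansion[OF assms that] by (simp add: lincomb_def)
    then show ?thesis unfolding span_def using B by (intro CollectI exI[of _ "ip H x"] exI[of _ B]) simp
  qed
  then have "span B = carrier H"
    using span_is_subset2[OF B(3)] by auto
  then show ?thesis
    using orthonormal_lin_indpt[OF B(1)] B by (simp add: basis_def)
qed

lemma onb_finite_dimensional: "onb B \<Longrightarrow> finite_dimensional H"
  using onb_basis[of B] unfolding finite_dimensional_def fin_dim_def basis_def onb_def orthonormal_def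
  by blast

lemma onb_hdim: "onb B \<Longrightarrow> hdim H = card B"
  using onb_basis[of B] dim_basis[of B] unfolding hdim_def onb_def orthonormal_def by blast

text \<open>An orthonormal set of maximal cardinality is total, since otherwise the normalisation of a
  vector orthogonal to it could be added. Only a bound on the cardinalities is used, so the
  argument applies to subspaces of finite-dimensional spaces as well.\<close>

lemma onb_exists_if_bounded:
  assumes "\<And>B. orthonormal B \<Longrightarrow> card B \<le> N"
  obtains B where "onb B"
proof -
  have "orthonormal {}" by (simp add: orthonormal_def)
  moreover have "\<forall>B. orthonormal B \<longrightarrow> card B < Suc N" using assms by (simp add: less_Suc_eq_le)
  ultimately obtain B where B: "orthonormal B" and max: "\<And>C. orthonormal C \<Longrightarrow> card C \<le> card B"
    using ex_has_greatest_nat[of orthonormal "{}" card "Suc N"] by blast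
  have Bfin: "finite B" "B \<subseteq> carrier H" using B by (auto simp: orthonormal_def)
  have "x = \<zero>\<^bsub>H\<^esub>" if x: "x \<in> carrier H" "\<And>b. b \<in> B \<Longrightarrow> ip H x b = 0" for x
  proof (rule ccontr)
    assume "x \<noteq> \<zero>\<^bsub>H\<^esub>"
    then have nz: "hnorm H x \<noteq> 0" using x hnorm_zero_iff by simp
    define u where "u = complex_of_real (1 / hnorm H x) \<odot>\<^bsub>H\<^esub> x"
    have u: "u \<in> carrier H" using x by (simp add: u_def)
    have uu: "ip H u u = 1"
      using x nz by (simp add: u_def ip_smult ip_smult_right ip_self[OF x(1)] power2_eq_square)
    have ub: "ip H u b = 0" if "b \<in> B" for b
      using that Bfin x by (auto simp: u_def ip_smult)
    have bu: "ip H b u = 0" if "b \<in> B" for b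
      using that Bfin u ub[OF that] ip_commute[of b u] by auto
    have "u \<notin> B" using ub uu by auto
    moreover have "orthonormal (insert u B)"
      using B u uu ub bu \<open>u \<notin> B\<close> by (auto simp: orthonormal_def)
    ultimately show False using max[of "insert u B"] Bfin by simp
  qed
  then have "onb B" using B by (auto simp: onb_def)
  then show thesis by (rule that)
qed

lemma orthonormal_card_le:
  assumes "finite_dimensional H" "orthonormal B"
  shows "card B \<le> hdim H"
  using assms li_le_dim[of B] orthonormal_lin_indpt
  by (simp add: finite_dimensional_def hdim_def orthonormal_def)

lemma onb_exists:
  assumes "finite_dimensional H"
  obtains B where "onb B"
  using onb_exists_if_bounded orthonormal_card_le[OF assms] by blast

lemma hdim_zero_carrier:
  assumes "finite_dimensional H" "hdim H = 0"
  shows "carrier H = {\<zero>\<^bsub>H\<^esub>}"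
proof -
  obtain B where B: "onb B" using onb_exists[OF assms(1)] .
  then have "B = {}" using onb_hdim[OF B] assms(2) by (auto simp: onb_def orthonormal_def)
  then show ?thesis using B by (auto simp: onb_def)
qed

text \<open>In coordinates with respect to an orthonormal basis, a finite-dimensional space is a Euclidean
  space; completeness and separability come from those of the complex numbers.\<close>

lemma hdist_onb:
  assumes "onb B" "x \<in> carrier H" "y \<in> carrier H"
  shows "hdist H x y = L2_set (\<lambda>b. cmod (ip H x b - ip H y b)) B"
proof -
  have "B \<subseteq> carrier H" using assms by (auto simp: onb_def orthonormal_def)
  then show ?thesis
    using assms by (auto simp: hdist_def hnorm_onb ip_diff_left intro!: L2_set_cong)
qed

lemma metric_space_if_onb:
  assumes B: "onb B"
  shows "Metric_space (carrier H) (hdist H)"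
proof
  show "0 \<le> hdist H x y" for x y
    using hdist_onb[OF B, of x y] by (auto simp: hdist_def)
  show "hdist H x y = hdist H y x" for x y
    using hdist_onb[OF B, of x y] hdist_onb[OF B, of y x]
    by (cases "x \<in> carrier H \<and> y \<in> carrier H") (auto simp: hdist_def norm_minus_commute)
  show "(hdist H x y = 0) = (x = y)" if "x \<in> carrier H" "y \<in> carrier H" for x y
    using that by (simp add: hdist_def hnorm_zero_iff)
  show "hdist H x z \<le> hdist H x y + hdist H y z"
    if "x \<in> carrier H" "y \<in> carrier H" "z \<in> carrier H" for x y z
  proof -
    have "hdist H x z \<le> L2_set (\<lambda>b. cmod (ip H x b - ip H y b) + cmod (ip H y b - ip H z b)) B"
      unfolding hdist_onb[OF B that(1,3)]
    proof (rule L2_set_mono)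
      show "cmod (ip H x b - ip H z b) \<le> cmod (ip H x b - ip H y b) + cmod (ip H y b - ip H z b)" for b
        using norm_triangle_ineq[of "ip H x b - ip H y b" "ip H y b - ip H z b"] by simp
    qed simp
    also have "\<dots> \<le> hdist H x y + hdist H y z"
      unfolding hdist_onb[OF B that(1,2)] hdist_onb[OF B that(2,3)] by (rule L2_set_triangle_ineq)
    finally show ?thesis .
  qed
qed

lemma separable_hilbert_space_if_finite_dimensional:
  assumes "finite_dimensional H"
  shows "separable_hilbert_space H"
proof -
  obtain B where B: "onb B" using onb_exists[OF assms] .
  have on: "orthonormal B" and Bf: "finite B" "B \<subseteq> carrier H"
    using B by (auto simp: onb_def orthonormal_def)
  interpret D: Metric_space "carrier H" "hdist H" by (rule metric_space_if_onb[OF B])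
  define vec where "vec c = finsum H (\<lambda>b. c b \<odot>\<^bsub>H\<^esub> b) B" for c :: "'a \<Rightarrow> complex"
  have vec_in: "vec c \<in> carrier H" for c unfolding vec_def using Bf by (intro finsum_in) auto
  have dist_vec: "hdist H x (vec c) \<le> (\<Sum>b\<in>B. cmod (ip H x b - c b))" if "x \<in> carrier H" for x c
  proof -
    have "hdist H x (vec c) = L2_set (\<lambda>b. cmod (ip H x b - c b)) B"
      unfolding hdist_onb[OF B that vec_in]
      by (rule L2_set_cong) (simp_all add: vec_def orthonormal_lincomb_coeff[OF on])
    also have "\<dots> \<le> (\<Sum>b\<in>B. cmod (ip H x b - c b))" by (rule L2_set_le_sum) simp
    finally show ?thesis .
  qed
  have "D.mcomplete"
    unfolding D.mcomplete_def
  proof (intro allI impI)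
    fix s assume s: "D.MCauchy s"
    then have s_in: "s n \<in> carrier H" for n by (auto simp: D.MCauchy_def)
    have "Cauchy (\<lambda>n. ip H (s n) b)" if b: "b \<in> B" for b
      unfolding Cauchy_def
    proof (intro allI impI)
      fix e :: real assume "0 < e"
      then obtain N where N: "\<And>m n. N \<le> m \<Longrightarrow> N \<le> n \<Longrightarrow> hdist H (s m) (s n) < e"
        using s unfolding D.MCauchy_def by blast
      have "dist (ip H (s m) b) (ip H (s n) b) \<le> hdist H (s m) (s n)" for m n
        unfolding dist_norm hdist_onb[OF B s_in s_in]
        using member_le_L2_set[OF Bf(1) b, of "\<lambda>b. cmod (ip H (s m) b - ip H (s n) b)"] .
      then show "\<exists>M. \<forall>m\<ge>M. \<forall>n\<ge>M. dist (ip H (s m) b) (ip H (s n) b) < e"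
        using N by (meson le_less_trans)
    qed
    then have "\<forall>b\<in>B. \<exists>l. (\<lambda>n. ip H (s n) b) \<longlonglongrightarrow> l"
      using Cauchy_convergent convergent_def by blast
    then obtain c where c: "\<And>b. b \<in> B \<Longrightarrow> (\<lambda>n. ip H (s n) b) \<longlonglongrightarrow> c b" by metis
    have "(\<lambda>n. \<Sum>b\<in>B. cmod (ip H (s n) b - c b)) \<longlonglongrightarrow> (\<Sum>b\<in>B. cmod (c b - c b))"
      by (intro tendsto_intros c)
    then have lim: "(\<lambda>n. \<Sum>b\<in>B. cmod (ip H (s n) b - c b)) \<longlonglongrightarrow> 0" by simp
    have "limitin D.mtopology s (vec c) sequentially"
      unfolding D.limit_metric_sequentially
    proof (intro conjI allI impI vec_in)
      fix e :: real assume "0 < e"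
      then obtain N where "\<And>n. N \<le> n \<Longrightarrow> (\<Sum>b\<in>B. cmod (ip H (s n) b - c b)) < e"
        using order_tendstoD(2)[OF lim] unfolding eventually_sequentially by blast
      then show "\<exists>N. \<forall>n\<ge>N. s n \<in> carrier H \<and> hdist H (s n) (vec c) < e"
        using dist_vec[OF s_in] s_in by (meson le_less_trans)
    qed
    then show "\<exists>x. limitin D.mtopology s x sequentially" ..
  qed
  moreover have "separable_space D.mtopology"
  proof -
    obtain Q :: "complex set" where Q: "countable Q" "\<And>X. open X \<Longrightarrow> X \<noteq> {} \<Longrightarrow> \<exists>d\<in>Q. d \<in> X"
      using countable_dense_exists by metis
    define C where "C = vec ` (\<Pi>\<^sub>E b\<in>B. Q)"
    have "countable C" unfolding C_def using Q Bf by (intro countable_image countable_PiE) auto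
    moreover have "C \<subseteq> carrier H" using vec_in by (auto simp: C_def)
    moreover have "carrier H \<subseteq> D.mtopology closure_of C"
      unfolding D.metric_closure_of
    proof (intro subsetI CollectI conjI allI impI)
      fix x and r :: real assume x: "x \<in> carrier H" and r: "0 < r"
      \<comment> \<open>The summand 1 allows for an empty basis and makes the sum of the errors smaller than \<open>r\<close>.\<close>
      define e where "e = r / (1 + real (card B))"
      have e: "0 < e" using r by (simp add: e_def add_pos_nonneg)
      have "\<exists>q\<in>Q. cmod (ip H x b - q) < e" for b
        using Q(2)[of "ball (ip H x b) e"] e by (auto simp: dist_norm)
      then obtain q where q: "\<And>b. q b \<in> Q" "\<And>b. cmod (ip H x b - q b) < e" by metis
      have "hdist H x (vec (restrict q B)) \<le> (\<Sum>b\<in>B. cmod (ip H x b - restrict q B b))"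
        by (rule dist_vec[OF x])
      also have "\<dots> \<le> (\<Sum>b\<in>B. e)" using q by (intro sum_mono) (auto intro: less_imp_le)
      also have "\<dots> < r" using r by (simp add: e_def field_simps)
      finally show "\<exists>y\<in>C. y \<in> D.mball x r"
        using q x vec_in by (auto simp: C_def intro!: bexI[of _ "vec (restrict q B)"])
    qed (assumption)
    ultimately show ?thesis
      unfolding separable_space_def using D.topspace_mtopology closure_of_subset_topspace
      by (metis subset_antisym)
  qed
  ultimately show ?thesis by unfold_locales
qed

end

text \<open>The squared norm of the image of \<open>x\<close> is a quadratic form in the coordinates of \<open>x\<close>, and no
  coordinate exceeds the norm of \<open>x\<close>.\<close>

lemma linear_bounded_if_finite_dimensional:
  assumes H: "complex_inner_space H" "finite_dimensional H" and K: "complex_inner_space K"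
    and T: "T \<in> module_hom (class_ring :: complex ring) H K"
  shows "\<exists>c. \<forall>x\<in>carrier H. hnorm K (T x) \<le> c * hnorm H x"
proof -
  interpret H: complex_inner_space H by fact
  interpret K: complex_inner_space K by fact
  interpret T: mod_hom class_ring H K T by unfold_locales fact
  obtain B where B: "H.onb B" using H.onb_exists[OF H(2)] .
  have Bf: "finite B" "B \<subseteq> carrier H" using B by (auto simp: H.onb_def H.orthonormal_def)
  have TB: "T b \<in> carrier K" if "b \<in> carrier H" for b using that by simp
  define M where "M = (\<Sum>b\<in>B. \<Sum>c\<in>B. cmod (ip K (T b) (T c)))"
  have M: "0 \<le> M" by (simp add: M_def sum_nonneg)
  have "hnorm K (T x) \<le> sqrt M * hnorm H x" if x: "x \<in> carrier H" for x
  proof -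
    have n: "cmod (ip H x b) \<le> hnorm H x" if "b \<in> B" for b
      unfolding H.hnorm_onb[OF B x] using member_le_L2_set[OF Bf(1) that, of "\<lambda>b. cmod (ip H x b)"] .
    have Tx: "T x = finsum K (\<lambda>b. ip H x b \<odot>\<^bsub>K\<^esub> T b) B"
    proof -
      have "T x = T (finsum H (\<lambda>b. ip H x b \<odot>\<^bsub>H\<^esub> b) B)" using H.onb_expansion[OF B x] by simp
      also have "\<dots> = finsum K (\<lambda>b. T (ip H x b \<odot>\<^bsub>H\<^esub> b)) B"
        using Bf by (intro T.hom_sum) auto
      also have "\<dots> = finsum K (\<lambda>b. ip H x b \<odot>\<^bsub>K\<^esub> T b) B"
        using Bf by (intro K.M.finsum_cong') auto
      finally show ?thesis .
    qed
    have "ip K (T x) (T x) = (\<Sum>b\<in>B. \<Sum>c\<in>B. ip H x b * cnj (ip H x c) * ip K (T b) (T c))"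
    proof -
      have "ip K (T x) (T x) = (\<Sum>b\<in>B. ip K (ip H x b \<odot>\<^bsub>K\<^esub> T b) (T x))"
        using Bf x by (subst (1) Tx, subst K.ip_finsum_left) (auto simp: TB)
      also have "\<dots> = (\<Sum>b\<in>B. \<Sum>c\<in>B. ip K (ip H x b \<odot>\<^bsub>K\<^esub> T b) (ip H x c \<odot>\<^bsub>K\<^esub> T c))"
        using Bf by (subst Tx, intro sum.cong refl, subst K.ip_finsum_right) (auto simp: TB subset_iff)
      also have "\<dots> = (\<Sum>b\<in>B. \<Sum>c\<in>B. ip H x b * cnj (ip H x c) * ip K (T b) (T c))"
        using Bf by (intro sum.cong refl) (auto simp: K.ip_smult K.ip_smult_right TB subset_iff)
      finally show ?thesis .
    qed
    then have "cmod (ip K (T x) (T x))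
        \<le> (\<Sum>b\<in>B. \<Sum>c\<in>B. cmod (ip H x b) * cmod (ip H x c) * cmod (ip K (T b) (T c)))"
      by (auto intro!: order_trans[OF norm_sum] sum_mono simp: norm_mult)
    also have "\<dots> \<le> (\<Sum>b\<in>B. \<Sum>c\<in>B. hnorm H x * hnorm H x * cmod (ip K (T b) (T c)))"
      using n by (intro sum_mono mult_right_mono mult_mono) (auto simp: hnorm_def intro!: H.ip_nonneg x)
    also have "\<dots> = M * (hnorm H x)\<^sup>2"
      by (simp add: M_def sum_distrib_right power2_eq_square sum_distrib_left mult_ac)
    finally have "(hnorm K (T x))\<^sup>2 \<le> M * (hnorm H x)\<^sup>2"
      using K.ip_self[of "T x"] x by (simp add: norm_power)
    then have "hnorm K (T x) \<le> sqrt (M * (hnorm H x)\<^sup>2)" by (rule real_le_rsqrt)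
    moreover have "0 \<le> hnorm H x" using H.ip_nonneg[OF x] by (simp add: hnorm_def)
    ultimately show ?thesis by (simp add: real_sqrt_mult)
  qed
  then show ?thesis by blast
qed

section \<open>Direct sums and orthogonal complements\<close>

locale finite_inner_space = complex_inner_space +
  assumes finite_dim: "finite_dimensional H"

lemma finite_inner_space_onb: "\<lbrakk>complex_inner_space H; complex_inner_space.onb H B\<rbrakk> \<Longrightarrow> finite_inner_space H"
  using complex_inner_space.onb_finite_dimensional
  by (auto simp: finite_inner_space_def finite_inner_space_axioms_def)

lemma hilbert_sum_carrier:
  "carrier (hilbert_sum J H) = Tuple ` (\<Pi>\<^sub>E j\<in>J. carrier (H j))"
  by (simp add: hilbert_sum_def)

lemma coord_in: "\<lbrakk>x \<in> carrier (hilbert_sum J H); j \<in> J\<rbrakk> \<Longrightarrow> coord x j \<in> carrier (H j)"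
  by (auto simp: hilbert_sum_carrier)

lemma Tuple_in:
  "(\<And>j. j \<in> J \<Longrightarrow> f j \<in> carrier (H j)) \<Longrightarrow> Tuple (\<lambda>j\<in>J. f j) \<in> carrier (hilbert_sum J H)"
  by (auto simp: hilbert_sum_carrier)

lemma hilbert_sum_ext:
  assumes "x \<in> carrier (hilbert_sum J H)" "y \<in> carrier (hilbert_sum J H)"
    and "\<And>j. j \<in> J \<Longrightarrow> coord x j = coord y j"
  shows "x = y"
proof -
  obtain f g where f: "f \<in> (\<Pi>\<^sub>E j\<in>J. carrier (H j))" "x = Tuple f"
    and g: "g \<in> (\<Pi>\<^sub>E j\<in>J. carrier (H j))" "y = Tuple g"
    using assms(1,2) by (auto simp: hilbert_sum_carrier)
  have "f = g" by (rule PiE_ext[OF f(1) g(1)]) (use assms(3) f g in simp)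
  then show ?thesis using f g by simp
qed

lemma Tuple_coord: "x \<in> carrier (hilbert_sum J H) \<Longrightarrow> Tuple (\<lambda>j\<in>J. coord x j) = x"
  by (auto simp: hilbert_sum_carrier)

lemma hilbert_sum_zero: "\<zero>\<^bsub>hilbert_sum J H\<^esub> = Tuple (\<lambda>j\<in>J. \<zero>\<^bsub>H j\<^esub>)"
  by (simp add: hilbert_sum_def)

lemma hilbert_sum_add:
  "x \<oplus>\<^bsub>hilbert_sum J H\<^esub> y = Tuple (\<lambda>j\<in>J. coord x j \<oplus>\<^bsub>H j\<^esub> coord y j)"
  by (simp add: hilbert_sum_def)

lemma hilbert_sum_smult: "a \<odot>\<^bsub>hilbert_sum J H\<^esub> x = Tuple (\<lambda>j\<in>J. a \<odot>\<^bsub>H j\<^esub> coord x j)"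
  by (simp add: hilbert_sum_def)

lemma hilbert_sum_ip:
  "ip (hilbert_sum J H) x y = (\<Sum>j\<in>J. ip (H j) (coord x j) (coord y j))"
  by (simp add: hilbert_sum_def)

lemmas hilbert_sum_ops = hilbert_sum_zero hilbert_sum_add hilbert_sum_smult

lemma complex_inner_space_hilbert_sum:
  assumes J: "finite J" and H: "\<And>j. j \<in> J \<Longrightarrow> complex_inner_space (H j)"
  shows "complex_inner_space (hilbert_sum J H)" (is "complex_inner_space ?S")
proof -
  note H_facts =
    complex_inner_space.zero_in[OF H] complex_inner_space.add_in[OF H] complex_inner_space.smult_in[OF H]
    complex_inner_space.add_zero[OF H]
    complex_inner_space.smult_zero_left[OF H] complex_inner_space.smult_one'[OF H]
    complex_inner_space.smult_smult[OF H] complex_inner_space.smult_add_scalar[OF H]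
    complex_inner_space.smult_add_vector[OF H]
    complex_inner_space.ip_add[OF H] complex_inner_space.ip_smult[OF H]
  have nonneg: "0 \<le> Re (ip (H j) (coord x j) (coord x j))" if "x \<in> carrier ?S" "j \<in> J" for x j
    using complex_inner_space.ip_nonneg[OF H[OF that(2)]] coord_in[OF that] by simp
  show ?thesis
  proof (rule complex_inner_spaceI)
    show "\<zero>\<^bsub>?S\<^esub> \<in> carrier ?S"
      unfolding hilbert_sum_ops by (rule Tuple_in) (simp add: H_facts)
    show "x \<oplus>\<^bsub>?S\<^esub> y \<in> carrier ?S" if "x \<in> carrier ?S" "y \<in> carrier ?S" for x y
      unfolding hilbert_sum_ops by (rule Tuple_in) (use that in \<open>simp add: H_facts coord_in\<close>)
    show "a \<odot>\<^bsub>?S\<^esub> x \<in> carrier ?S" if "x \<in> carrier ?S" for a x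
      unfolding hilbert_sum_ops by (rule Tuple_in) (use that in \<open>simp add: H_facts coord_in\<close>)
    show "x \<oplus>\<^bsub>?S\<^esub> y = y \<oplus>\<^bsub>?S\<^esub> x" if "x \<in> carrier ?S" "y \<in> carrier ?S" for x y
    proof -
      have "coord x j \<oplus>\<^bsub>H j\<^esub> coord y j = coord y j \<oplus>\<^bsub>H j\<^esub> coord x j" if "j \<in> J" for j
        by (rule complex_inner_space.add_commute[OF H[OF that]]; rule coord_in; fact)
      then show ?thesis
        unfolding hilbert_sum_add by - (intro arg_cong[where f = Tuple] restrict_ext)
    qed
    show "(x \<oplus>\<^bsub>?S\<^esub> y) \<oplus>\<^bsub>?S\<^esub> z = x \<oplus>\<^bsub>?S\<^esub> (y \<oplus>\<^bsub>?S\<^esub> z)"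
      if "x \<in> carrier ?S" "y \<in> carrier ?S" "z \<in> carrier ?S" for x y z
    proof -
      have "(coord x j \<oplus>\<^bsub>H j\<^esub> coord y j) \<oplus>\<^bsub>H j\<^esub> coord z j
          = coord x j \<oplus>\<^bsub>H j\<^esub> (coord y j \<oplus>\<^bsub>H j\<^esub> coord z j)" if "j \<in> J" for j
        by (rule complex_inner_space.add_assoc[OF H[OF that]]; rule coord_in; fact)
      then show ?thesis
        unfolding hilbert_sum_add
        by - (intro arg_cong[where f = Tuple] restrict_ext, simp)
    qed
    show "x \<oplus>\<^bsub>?S\<^esub> \<zero>\<^bsub>?S\<^esub> = x" if "x \<in> carrier ?S" for x
    proof -
      have "x \<oplus>\<^bsub>?S\<^esub> \<zero>\<^bsub>?S\<^esub> = Tuple (\<lambda>j\<in>J. coord x j)"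
        using that by (auto simp: hilbert_sum_ops H_facts coord_in intro!: restrict_ext)
      then show ?thesis using Tuple_coord[OF that] by simp
    qed
    show "0 \<odot>\<^bsub>?S\<^esub> x = \<zero>\<^bsub>?S\<^esub>" if "x \<in> carrier ?S" for x
      using that by (auto simp: hilbert_sum_ops H_facts coord_in intro!: restrict_ext)
    show "1 \<odot>\<^bsub>?S\<^esub> x = x" if "x \<in> carrier ?S" for x
    proof -
      have "1 \<odot>\<^bsub>?S\<^esub> x = Tuple (\<lambda>j\<in>J. coord x j)"
        using that by (auto simp: hilbert_sum_ops H_facts coord_in intro!: restrict_ext)
      then show ?thesis using Tuple_coord[OF that] by simp
    qed
    show "(a * b) \<odot>\<^bsub>?S\<^esub> x = a \<odot>\<^bsub>?S\<^esub> (b \<odot>\<^bsub>?S\<^esub> x)" if "x \<in> carrier ?S" for a b x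
      using that by (auto simp: hilbert_sum_ops H_facts coord_in intro!: restrict_ext)
    show "(a + b) \<odot>\<^bsub>?S\<^esub> x = a \<odot>\<^bsub>?S\<^esub> x \<oplus>\<^bsub>?S\<^esub> b \<odot>\<^bsub>?S\<^esub> x" if "x \<in> carrier ?S" for a b x
      using that by (auto simp: hilbert_sum_ops H_facts coord_in intro!: restrict_ext)
    show "a \<odot>\<^bsub>?S\<^esub> (x \<oplus>\<^bsub>?S\<^esub> y) = a \<odot>\<^bsub>?S\<^esub> x \<oplus>\<^bsub>?S\<^esub> a \<odot>\<^bsub>?S\<^esub> y"
      if "x \<in> carrier ?S" "y \<in> carrier ?S" for a x y
      using that by (auto simp: hilbert_sum_ops H_facts coord_in intro!: restrict_ext)
    show "ip ?S (x \<oplus>\<^bsub>?S\<^esub> y) z = ip ?S x z + ip ?S y z"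
      if "x \<in> carrier ?S" "y \<in> carrier ?S" "z \<in> carrier ?S" for x y z
      using that by (simp add: hilbert_sum_ops hilbert_sum_ip H_facts coord_in sum.distrib)
    show "ip ?S (a \<odot>\<^bsub>?S\<^esub> x) y = a * ip ?S x y"
      if "x \<in> carrier ?S" "y \<in> carrier ?S" for a x y
      using that by (simp add: hilbert_sum_ops hilbert_sum_ip H_facts coord_in sum_distrib_left)
    show "ip ?S x y = cnj (ip ?S y x)" if "x \<in> carrier ?S" "y \<in> carrier ?S" for x y
      unfolding hilbert_sum_ip cnj_sum
      by (intro sum.cong refl complex_inner_space.ip_commute[OF H]) (use that in \<open>auto intro: coord_in\<close>)
    show "0 \<le> Re (ip ?S x x)" if "x \<in> carrier ?S" for x
      unfolding hilbert_sum_ip Re_sum by (intro sum_nonneg nonneg that)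
    show "x = \<zero>\<^bsub>?S\<^esub>" if x: "x \<in> carrier ?S" and 0: "ip ?S x x = 0" for x
    proof -
      have "(\<Sum>j\<in>J. Re (ip (H j) (coord x j) (coord x j))) = 0"
        using arg_cong[OF 0, of Re] unfolding hilbert_sum_ip Re_sum by simp
      then have re: "Re (ip (H j) (coord x j) (coord x j)) = 0" if "j \<in> J" for j
        using sum_nonneg_eq_0_iff[OF J nonneg[OF x]] that by simp
      have "coord x j = \<zero>\<^bsub>H j\<^esub>" if j: "j \<in> J" for j
      proof -
        interpret Hj: complex_inner_space "H j" by (rule H[OF j])
        have "ip (H j) (coord x j) (coord x j) = 0"
          using re[OF j] Hj.ip_self[OF coord_in[OF x j]] by simp
        then show ?thesis using Hj.ip_definite coord_in[OF x j] by simp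
      qed
      then have "Tuple (\<lambda>j\<in>J. coord x j) = \<zero>\<^bsub>?S\<^esub>" by (auto simp: hilbert_sum_ops intro!: restrict_ext)
      then show ?thesis using Tuple_coord[OF x] by simp
    qed
  qed
qed

definition summand_inj ::
    "'v set \<Rightarrow> ('v \<Rightarrow> ('v, 'b) hvec inner_module) \<Rightarrow> 'v \<Rightarrow> ('v, 'b) hvec \<Rightarrow> ('v, 'b) hvec" where
  "summand_inj J H j y = Tuple (\<lambda>k\<in>J. if k = j then y else \<zero>\<^bsub>H k\<^esub>)"

lemma coord_summand_inj:
  "k \<in> J \<Longrightarrow> coord (summand_inj J H j y) k = (if k = j then y else \<zero>\<^bsub>H k\<^esub>)"
  by (simp add: summand_inj_def)

lemma summand_inj_in:
  assumes "\<And>j. j \<in> J \<Longrightarrow> complex_inner_space (H j)" "y \<in> carrier (H j)"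
  shows "summand_inj J H j y \<in> carrier (hilbert_sum J H)"
  unfolding summand_inj_def
  by (rule Tuple_in) (use assms complex_inner_space.zero_in in auto)

lemma ip_summand_inj_right:
  assumes "finite J" "\<And>j. j \<in> J \<Longrightarrow> complex_inner_space (H j)" "j \<in> J"
    and "x \<in> carrier (hilbert_sum J H)" "y \<in> carrier (H j)"
  shows "ip (hilbert_sum J H) x (summand_inj J H j y) = ip (H j) (coord x j) y"
proof -
  have "ip (hilbert_sum J H) x (summand_inj J H j y) = (\<Sum>k\<in>J. if k = j then ip (H j) (coord x j) y else 0)"
    unfolding hilbert_sum_ip
    by (rule sum.cong)
      (use assms in \<open>auto simp: coord_summand_inj coord_in complex_inner_space.ip_zero_right\<close>)
  then show ?thesis using assms by simp
qed

text \<open>Orthonormal bases of the summands, embedded into the sum, form an orthonormal basis of it.\<close>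

lemma hilbert_sum_finite_dimensional:
  assumes J: "finite J" and H: "\<And>j. j \<in> J \<Longrightarrow> finite_inner_space (H j)"
  shows "finite_inner_space (hilbert_sum J H)" "hdim (hilbert_sum J H) = (\<Sum>j\<in>J. hdim (H j))"
proof -
  have Hi: "complex_inner_space (H j)" if "j \<in> J" for j
    using H[OF that] by (simp add: finite_inner_space_def)
  interpret S: complex_inner_space "hilbert_sum J H"
    by (rule complex_inner_space_hilbert_sum[OF J Hi])
  have "\<exists>B. complex_inner_space.onb (H j) B" if "j \<in> J" for j
    using complex_inner_space.onb_exists[OF Hi[OF that]] finite_inner_space.finite_dim[OF H[OF that]] by blast
  then obtain B where B: "\<And>j. j \<in> J \<Longrightarrow> complex_inner_space.onb (H j) (B j)" by metis
  have Bf: "finite (B j)" "B j \<subseteq> carrier (H j)"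
    and Bo: "\<And>b c. \<lbrakk>b \<in> B j; c \<in> B j\<rbrakk> \<Longrightarrow> ip (H j) b c = (if b = c then 1 else 0)"
    and Bt: "\<And>x. \<lbrakk>x \<in> carrier (H j); \<And>b. b \<in> B j \<Longrightarrow> ip (H j) x b = 0\<rbrakk> \<Longrightarrow> x = \<zero>\<^bsub>H j\<^esub>"
    if "j \<in> J" for j
    using B[OF that]
    by (auto simp: complex_inner_space.onb_def[OF Hi[OF that]] complex_inner_space.orthonormal_def[OF Hi[OF that]])
  define e where "e = (\<lambda>(j, b). summand_inj J H j b)"
  define E where "E = e ` (SIGMA j:J. B j)"
  have e_in: "summand_inj J H j b \<in> carrier (hilbert_sum J H)" if "j \<in> J" "b \<in> B j" for j b
    using that Bf by (intro summand_inj_in Hi) auto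
  have ip_e: "ip (hilbert_sum J H) x (summand_inj J H j b) = ip (H j) (coord x j) b"
    if "j \<in> J" "b \<in> B j" "x \<in> carrier (hilbert_sum J H)" for j b x
    using that Bf by (intro ip_summand_inj_right J Hi) auto
  have ip_ee: "ip (hilbert_sum J H) (summand_inj J H j b) (summand_inj J H k c)
      = (if j = k \<and> b = c then 1 else 0)" if "j \<in> J" "b \<in> B j" "k \<in> J" "c \<in> B k" for j b k c
    using that Bf[OF that(3)] Bo
    by (auto simp: ip_e e_in coord_summand_inj complex_inner_space.ip_zero_left[OF Hi])
  have inj: "inj_on e (SIGMA j:J. B j)"
  proof (rule inj_onI, clarify)
    fix j b k c assume *: "j \<in> J" "b \<in> B j" "k \<in> J" "c \<in> B k" "e (j, b) = e (k, c)"
    then have "ip (hilbert_sum J H) (summand_inj J H j b) (summand_inj J H k c)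
      = ip (hilbert_sum J H) (summand_inj J H j b) (summand_inj J H j b)" by (simp add: e_def)
    then show "j = k \<and> b = c" using * by (simp add: ip_ee split: if_splits)
  qed
  have "S.orthonormal E"
    unfolding S.orthonormal_def
  proof (intro conjI ballI)
    show "finite E" using J Bf by (auto simp: E_def)
    show "E \<subseteq> carrier (hilbert_sum J H)" using e_in by (auto simp: E_def e_def)
    fix x y assume "x \<in> E" "y \<in> E"
    then obtain j b k c where *: "j \<in> J" "b \<in> B j" "k \<in> J" "c \<in> B k" "x = e (j, b)" "y = e (k, c)"
      by (auto simp: E_def)
    then have "x = y \<longleftrightarrow> j = k \<and> b = c" using inj_onD[OF inj] by auto
    then show "ip (hilbert_sum J H) x y = (if x = y then 1 else 0)"
      using * by (simp add: e_def ip_ee)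
  qed
  moreover have "x = \<zero>\<^bsub>hilbert_sum J H\<^esub>"
    if x: "x \<in> carrier (hilbert_sum J H)" "\<And>y. y \<in> E \<Longrightarrow> ip (hilbert_sum J H) x y = 0" for x
  proof (rule hilbert_sum_ext[OF x(1)])
    fix j assume j: "j \<in> J"
    have "ip (H j) (coord x j) b = 0" if "b \<in> B j" for b
      using x(2)[of "e (j, b)"] ip_e[OF j that x(1)] j that by (auto simp: E_def e_def)
    then show "coord x j = coord \<zero>\<^bsub>hilbert_sum J H\<^esub> j"
      using Bt[OF j coord_in[OF x(1) j]] j by (simp add: hilbert_sum_ops)
  qed simp
  ultimately have E: "S.onb E" by (auto simp: S.onb_def)
  show "finite_inner_space (hilbert_sum J H)"
    using finite_inner_space_onb[OF S.complex_inner_space_axioms E] .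
  have "card E = (\<Sum>j\<in>J. card (B j))"
    unfolding E_def card_image[OF inj] using J Bf by (intro card_SigmaI) auto
  also have "\<dots> = (\<Sum>j\<in>J. hdim (H j))"
    using complex_inner_space.onb_hdim[OF Hi B] by (intro sum.cong) auto
  finally show "hdim (hilbert_sum J H) = (\<Sum>j\<in>J. hdim (H j))"
    using S.onb_hdim[OF E] by simp
qed

lemma orth_complement_simps [simp]:
  "add (orth_complement H W) = add H"
  "\<zero>\<^bsub>orth_complement H W\<^esub> = \<zero>\<^bsub>H\<^esub>"
  "smult (orth_complement H W) = smult H"
  "ip (orth_complement H W) = ip H"
  by (simp_all add: orth_complement_def)

lemma orth_complement_carrier:
  "carrier (orth_complement H W) = {x \<in> carrier H. \<forall>w\<in>W. ip H w x = 0}"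
  by (simp add: orth_complement_def)

lemma complex_inner_space_orth_complement:
  assumes H: "complex_inner_space H" and W: "W \<subseteq> carrier H"
  shows "complex_inner_space (orth_complement H W)"
proof -
  interpret complex_inner_space H by fact
  have W': "w \<in> carrier H" if "w \<in> W" for w using that W by auto
  show ?thesis
  proof (rule complex_inner_spaceI, simp_all only: orth_complement_simps orth_complement_carrier mem_Collect_eq)
    fix x y assume "x \<in> carrier H \<and> (\<forall>w\<in>W. ip H w x = 0)" "y \<in> carrier H \<and> (\<forall>w\<in>W. ip H w y = 0)"
    then show "x \<oplus>\<^bsub>H\<^esub> y = y \<oplus>\<^bsub>H\<^esub> x" "ip H x y = cnj (ip H y x)"
      using add_commute ip_commute by blast+
  qed (auto simp: W' ip_add_right ip_smult_right smult_zero_left smult_one' smult_smult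
        smult_add_scalar smult_add_vector ip_add ip_smult ip_nonneg add_assoc intro: ip_definite)
qed

text \<open>Orthonormal sets in the complement are orthonormal in the whole space, which bounds their
  cardinalities.\<close>

lemma finite_inner_space_orth_complement:
  assumes H: "finite_inner_space H" and W: "W \<subseteq> carrier H"
  shows "finite_inner_space (orth_complement H W)"
proof -
  interpret H: finite_inner_space H by fact
  interpret C: complex_inner_space "orth_complement H W"
    by (rule complex_inner_space_orth_complement) (unfold_locales, fact)
  have "card B \<le> hdim H" if "C.orthonormal B" for B
    using that H.orthonormal_card_le[OF H.finite_dim, of B]
    by (auto simp: C.orthonormal_def H.orthonormal_def orth_complement_carrier)
  then obtain B where "C.onb B" using C.onb_exists_if_bounded by blast
  then show ?thesis by (rule finite_inner_space_onb[OF C.complex_inner_space_axioms])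
qed

text \<open>The image of an orthonormal basis of \<open>H\<close> and an orthonormal basis of the complement together
  form an orthonormal basis of \<open>K\<close>.\<close>

lemma hdim_orth_complement_isometry:
  assumes H: "finite_inner_space H" and K: "finite_inner_space K"
    and U: "U \<in> module_hom (class_ring :: complex ring) H K"
    and iso: "\<And>x y. \<lbrakk>x \<in> carrier H; y \<in> carrier H\<rbrakk> \<Longrightarrow> ip K (U x) (U y) = ip H x y"
  shows "hdim (orth_complement K (U ` carrier H)) + hdim H = hdim K"
proof -
  interpret H: finite_inner_space H by fact
  interpret K: finite_inner_space K by fact
  interpret U: mod_hom class_ring H K U by unfold_locales fact
  let ?C = "orth_complement K (U ` carrier H)"
  interpret C: finite_inner_space ?C
    by (rule finite_inner_space_orth_complement[OF K]) auto
  obtain B where B: "H.onb B" using H.onb_exists[OF H.finite_dim] .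
  obtain E where E: "C.onb E" using C.onb_exists[OF C.finite_dim] .
  have Bf: "finite B" "B \<subseteq> carrier H"
    and Bo: "\<And>b c. \<lbrakk>b \<in> B; c \<in> B\<rbrakk> \<Longrightarrow> ip H b c = (if b = c then 1 else 0)"
    using B by (auto simp: H.onb_def H.orthonormal_def)
  have Ef: "finite E" "E \<subseteq> carrier K"
    and Eo: "\<And>b c. \<lbrakk>b \<in> E; c \<in> E\<rbrakk> \<Longrightarrow> ip K b c = (if b = c then 1 else 0)"
    and Et: "\<And>x. \<lbrakk>x \<in> carrier K; \<And>w. w \<in> carrier H \<Longrightarrow> ip K (U w) x = 0; \<And>b. b \<in> E \<Longrightarrow> ip K x b = 0\<rbrakk>
      \<Longrightarrow> x = \<zero>\<^bsub>K\<^esub>"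
    and UE: "\<And>w b. \<lbrakk>w \<in> carrier H; b \<in> E\<rbrakk> \<Longrightarrow> ip K (U w) b = 0"
    using E by (auto simp: C.onb_def C.orthonormal_def orth_complement_carrier)
  have EU: "ip K b (U w) = 0" if "w \<in> carrier H" "b \<in> E" for w b
    using UE[OF that] K.ip_commute[of b "U w"] that Ef by auto
  have inj: "inj_on U B"
  proof (rule inj_onI)
    fix b c assume *: "b \<in> B" "c \<in> B" "U b = U c"
    then have "ip H b c = ip H b b" using Bf by (simp flip: iso add: subset_iff)
    then show "b = c" using * Bo by (auto split: if_splits)
  qed
  have disj: "U ` B \<inter> E = {}"
  proof (rule equals0I, elim IntE imageE)
    fix x b assume "x \<in> E" "b \<in> B" "x = U b"
    then have "ip K x x = 1" "ip K x x = 0" using UE[of b x] Eo[of x x] Bf by auto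
    then show False by simp
  qed
  have "K.orthonormal (U ` B \<union> E)"
    unfolding K.orthonormal_def
  proof (intro conjI ballI)
    show "finite (U ` B \<union> E)" "U ` B \<union> E \<subseteq> carrier K" using Bf Ef by auto
    fix x y assume "x \<in> U ` B \<union> E" "y \<in> U ` B \<union> E"
    then show "ip K x y = (if x = y then 1 else 0)"
    proof (elim UnE imageE)
      fix b c assume *: "b \<in> B" "x = U b" "c \<in> B" "y = U c"
      then have "ip K x y = ip H b c" using Bf iso by blast
      then show ?thesis using * Bo inj_on_eq_iff[OF inj] by simp
    next
      assume "x \<in> E" "y \<in> E"
      then show ?thesis by (rule Eo)
    next
      fix b assume *: "b \<in> B" "x = U b" "y \<in> E"
      then have "ip K x y = 0" "x \<noteq> y" using Bf UE disj by blast+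
      then show ?thesis by simp
    next
      fix c assume *: "x \<in> E" "c \<in> B" "y = U c"
      then have "ip K x y = 0" "x \<noteq> y" using Bf EU disj by blast+
      then show ?thesis by simp
    qed
  qed
  moreover have "x = \<zero>\<^bsub>K\<^esub>" if x: "x \<in> carrier K" "\<And>b. b \<in> U ` B \<union> E \<Longrightarrow> ip K x b = 0" for x
  proof (rule Et[OF x(1)])
    show "ip K x b = 0" if "b \<in> E" for b using x(2) that by simp
    fix w assume w: "w \<in> carrier H"
    have Ub: "ip K (U b) x = 0" if "b \<in> B" for b
      using x(2)[of "U b"] K.ip_commute[of "U b" x] x(1) that Bf by auto
    have "U w = U (finsum H (\<lambda>b. ip H w b \<odot>\<^bsub>H\<^esub> b) B)" using H.onb_expansion[OF B w] by simp
    also have "\<dots> = finsum K (\<lambda>b. U (ip H w b \<odot>\<^bsub>H\<^esub> b)) B"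
      using Bf by (intro U.hom_sum) auto
    finally have "ip K (U w) x = (\<Sum>b\<in>B. ip K (U (ip H w b \<odot>\<^bsub>H\<^esub> b)) x)"
      using Bf x(1) by (subst K.ip_finsum_left[symmetric]) auto
    also have "\<dots> = 0"
      using Bf Ub x(1) by (intro sum.neutral) (auto simp: K.ip_smult subset_iff)
    finally show "ip K (U w) x = 0" .
  qed
  ultimately have "K.onb (U ` B \<union> E)" by (auto simp: K.onb_def)
  then have "hdim K = card (U ` B \<union> E)" by (rule K.onb_hdim)
  also have "\<dots> = card B + card E"
    using Bf Ef disj by (simp add: card_Un_disjoint card_image[OF inj])
  finally show ?thesis using H.onb_hdim[OF B] C.onb_hdim[OF E] by simp
qed

section \<open>Functors that are inverse to themselves\<close>

lemma is_functor_id: "is_category C \<Longrightarrow> is_functor C C id_fctr"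
  by (simp add: is_functor_def id_fctr_def)

lemma is_functor_comp: "\<lbrakk>is_functor C D F; is_functor D E K\<rbrakk> \<Longrightarrow> is_functor C E (comp_fctr K F)"
  by (simp add: is_functor_def comp_fctr_def)

lemma category_comp:
  "\<lbrakk>is_category C; X \<in> Obj C; Y \<in> Obj C; Z \<in> Obj C; h \<in> Hom C X Y; g \<in> Hom C Y Z\<rbrakk>
    \<Longrightarrow> Comp C X Y Z g h \<in> Hom C X Z"
  unfolding is_category_def by blast

lemma category_id:
  "\<lbrakk>is_category C; X \<in> Obj C; Y \<in> Obj C; h \<in> Hom C X Y\<rbrakk> \<Longrightarrow> Comp C X X Y h (Ident C X) = h"
  "\<lbrakk>is_category C; X \<in> Obj C; Y \<in> Obj C; h \<in> Hom C X Y\<rbrakk> \<Longrightarrow> Comp C X Y Y (Ident C Y) h = h"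
  "\<lbrakk>is_category C; X \<in> Obj C\<rbrakk> \<Longrightarrow> Ident C X \<in> Hom C X X"
  unfolding is_category_def by blast+

lemma category_assoc:
  "\<lbrakk>is_category C; W \<in> Obj C; X \<in> Obj C; Y \<in> Obj C; Z \<in> Obj C;
     h \<in> Hom C W X; g \<in> Hom C X Y; k \<in> Hom C Y Z\<rbrakk>
    \<Longrightarrow> Comp C W Y Z k (Comp C W X Y g h) = Comp C W X Z (Comp C X Y Z k g) h"
  unfolding is_category_def by blast

text \<open>The transformation that is easy to write down goes from the identity to the square of the reflection
  functor, whereas equivalences ask for the opposite direction. Inverses of the components are natural:
  multiply the naturality square by them from both sides.\<close>

lemma naturally_isomorphic_sym:
  assumes "naturally_isomorphic C D E F"
  shows "naturally_isomorphic C D F E"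
proof -
  obtain \<eta> where E: "is_functor C D E" and F: "is_functor C D F"
    and iso: "\<And>X. X \<in> Obj C \<Longrightarrow> is_isomorphism D (omap E X) (omap F X) (\<eta> X)"
    and nat: "\<And>X Y h. \<lbrakk>X \<in> Obj C; Y \<in> Obj C; h \<in> Hom C X Y\<rbrakk> \<Longrightarrow>
      Comp D (omap E X) (omap E Y) (omap F Y) (\<eta> Y) (amap E X Y h)
        = Comp D (omap E X) (omap F X) (omap F Y) (amap F X Y h) (\<eta> X)"
    using assms unfolding naturally_isomorphic_def by blast
  have D: "is_category D" using E by (simp add: is_functor_def)
  have obj: "omap E X \<in> Obj D" "omap F X \<in> Obj D" if "X \<in> Obj C" for X
    using that E F by (auto simp: is_functor_def)
  have am: "amap E X Y h \<in> Hom D (omap E X) (omap E Y)" "amap F X Y h \<in> Hom D (omap F X) (omap F Y)"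
    if "X \<in> Obj C" "Y \<in> Obj C" "h \<in> Hom C X Y" for X Y h
    using that E F by (auto simp: is_functor_def)
  have eta: "\<eta> X \<in> Hom D (omap E X) (omap F X)" if "X \<in> Obj C" for X
    using iso[OF that] by (simp add: is_isomorphism_def)
  have "\<forall>X\<in>Obj C. \<exists>g. g \<in> Hom D (omap F X) (omap E X) \<and>
      Comp D (omap E X) (omap F X) (omap E X) g (\<eta> X) = Ident D (omap E X) \<and>
      Comp D (omap F X) (omap E X) (omap F X) (\<eta> X) g = Ident D (omap F X)"
    using iso unfolding is_isomorphism_def by blast
  then obtain \<theta> where th: "\<And>X. X \<in> Obj C \<Longrightarrow> \<theta> X \<in> Hom D (omap F X) (omap E X)"
    and thl: "\<And>X. X \<in> Obj C \<Longrightarrow> Comp D (omap E X) (omap F X) (omap E X) (\<theta> X) (\<eta> X) = Ident D (omap E X)"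
    and thr: "\<And>X. X \<in> Obj C \<Longrightarrow> Comp D (omap F X) (omap E X) (omap F X) (\<eta> X) (\<theta> X) = Ident D (omap F X)"
    by (metis (no_types, lifting))
  have "is_isomorphism D (omap F X) (omap E X) (\<theta> X)" if "X \<in> Obj C" for X
    unfolding is_isomorphism_def using th[OF that] eta[OF that] thl[OF that] thr[OF that] by blast
  moreover have "Comp D (omap F X) (omap F Y) (omap E Y) (\<theta> Y) (amap F X Y h)
        = Comp D (omap F X) (omap E X) (omap E Y) (amap E X Y h) (\<theta> X)"
    if X: "X \<in> Obj C" and Y: "Y \<in> Obj C" and h: "h \<in> Hom C X Y" for X Y h
  proof -
    let ?c = "\<lambda>X Y Z. Comp D X Y Z"
    note o = obj[OF X] obj[OF Y] and m = am[OF X Y h] th[OF X] th[OF Y] eta[OF X] eta[OF Y]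
    have "amap F X Y h = ?c (omap F X) (omap F X) (omap F Y) (amap F X Y h)
        (?c (omap F X) (omap E X) (omap F X) (\<eta> X) (\<theta> X))"
      using category_id(1)[OF D o(2,4) m(2)] thr[OF X] by simp
    also have "\<dots> = ?c (omap F X) (omap E X) (omap F Y)
        (?c (omap E X) (omap F X) (omap F Y) (amap F X Y h) (\<eta> X)) (\<theta> X)"
      by (rule category_assoc[OF D o(2) o(1) o(2) o(4) m(3) m(5) m(2)])
    also have "\<dots> = ?c (omap F X) (omap E X) (omap F Y)
        (?c (omap E X) (omap E Y) (omap F Y) (\<eta> Y) (amap E X Y h)) (\<theta> X)"
      by (simp only: nat[OF X Y h])
    also have "\<dots> = ?c (omap F X) (omap E Y) (omap F Y) (\<eta> Y)
        (?c (omap F X) (omap E X) (omap E Y) (amap E X Y h) (\<theta> X))"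
      by (rule category_assoc[OF D o(2) o(1) o(3) o(4) m(3) m(1) m(6), symmetric])
    finally have "?c (omap F X) (omap F Y) (omap E Y) (\<theta> Y) (amap F X Y h)
      = ?c (omap F X) (omap F Y) (omap E Y) (\<theta> Y) (?c (omap F X) (omap E Y) (omap F Y) (\<eta> Y)
        (?c (omap F X) (omap E X) (omap E Y) (amap E X Y h) (\<theta> X)))" by simp
    also have "\<dots> = ?c (omap F X) (omap E Y) (omap E Y)
        (?c (omap E Y) (omap F Y) (omap E Y) (\<theta> Y) (\<eta> Y))
        (?c (omap F X) (omap E X) (omap E Y) (amap E X Y h) (\<theta> X))"
      by (rule category_assoc[OF D o(2) o(3) o(4) o(3)
            category_comp[OF D o(2) o(1) o(3) m(3) m(1)] m(6) m(4)])
    also have "\<dots> = ?c (omap F X) (omap E X) (omap E Y) (amap E X Y h) (\<theta> X)"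
      using category_id(2)[OF D o(2) o(3) category_comp[OF D o(2) o(1) o(3) m(3) m(1)]] thl[OF Y]
      by simp
    finally show ?thesis .
  qed
  ultimately show ?thesis
    unfolding naturally_isomorphic_def using E F by blast
qed

lemma full_subcategory_is_category:
  assumes C: "is_category C" and D: "is_full_subcategory D C"
  shows "is_category D"
proof -
  have o: "X \<in> Obj C" if "X \<in> Obj D" for X using that D by (auto simp: is_full_subcategory_def)
  have i: "Ident D X = Ident C X" if "X \<in> Obj D" for X
    using that D by (simp add: is_full_subcategory_def)
  have h: "Hom D X Y = Hom C X Y" if "X \<in> Obj D" "Y \<in> Obj D" for X Y
    using that D by (simp add: is_full_subcategory_def)
  have c: "Comp D X Y Z g h = Comp C X Y Z g h"
    if "X \<in> Obj D" "Y \<in> Obj D" "Z \<in> Obj D" "h \<in> Hom C X Y" "g \<in> Hom C Y Z" for X Y Z g h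
    using that D by (simp add: is_full_subcategory_def)
  show ?thesis
    unfolding is_category_def
    by (simp add: o i h c category_id[OF C] category_comp[OF C] category_assoc[OF C])
qed

lemma is_functor_restrict:
  assumes F: "is_functor C C' F" and D: "is_full_subcategory D C" and D': "is_full_subcategory D' C'"
    and obj: "\<And>X. X \<in> Obj D \<Longrightarrow> omap F X \<in> Obj D'"
  shows "is_functor D D' F"
proof -
  have "is_category D" "is_category D'"
    using F D D' full_subcategory_is_category by (auto simp: is_functor_def)
  moreover have "X \<in> Obj C" if "X \<in> Obj D" for X using that D by (auto simp: is_full_subcategory_def)
  ultimately show ?thesis
    using F D D' obj unfolding is_functor_def is_full_subcategory_def by simp
qed

text \<open>The components of the isomorphism and their inverses lie in the subcategory because it is
  full.\<close>

lemma naturally_isomorphic_restrict: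
  assumes nat: "naturally_isomorphic C C E F" and D: "is_full_subcategory D C"
    and obj: "\<And>X. X \<in> Obj D \<Longrightarrow> omap E X \<in> Obj D" "\<And>X. X \<in> Obj D \<Longrightarrow> omap F X \<in> Obj D"
  shows "naturally_isomorphic D D E F"
proof -
  obtain \<eta> where E: "is_functor C C E" and F: "is_functor C C F"
    and iso: "\<And>X. X \<in> Obj C \<Longrightarrow> is_isomorphism C (omap E X) (omap F X) (\<eta> X)"
    and nat: "\<And>X Y h. \<lbrakk>X \<in> Obj C; Y \<in> Obj C; h \<in> Hom C X Y\<rbrakk> \<Longrightarrow>
      Comp C (omap E X) (omap E Y) (omap F Y) (\<eta> Y) (amap E X Y h)
        = Comp C (omap E X) (omap F X) (omap F Y) (amap F X Y h) (\<eta> X)"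
    using nat unfolding naturally_isomorphic_def by blast
  have o: "X \<in> Obj C" if "X \<in> Obj D" for X using that D by (auto simp: is_full_subcategory_def)
  have i: "Ident D X = Ident C X" if "X \<in> Obj D" for X
    using that D by (simp add: is_full_subcategory_def)
  have h: "Hom D X Y = Hom C X Y" if "X \<in> Obj D" "Y \<in> Obj D" for X Y
    using that D by (simp add: is_full_subcategory_def)
  have c: "Comp D X Y Z g h = Comp C X Y Z g h"
    if "X \<in> Obj D" "Y \<in> Obj D" "Z \<in> Obj D" "h \<in> Hom C X Y" "g \<in> Hom C Y Z" for X Y Z g h
    using that D by (simp add: is_full_subcategory_def)
  have isoD: "is_isomorphism D (omap E X) (omap F X) (\<eta> X)" if X: "X \<in> Obj D" for X
  proof -
    obtain g where g: "\<eta> X \<in> Hom C (omap E X) (omap F X)" "g \<in> Hom C (omap F X) (omap E X)"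
      "Comp C (omap E X) (omap F X) (omap E X) g (\<eta> X) = Ident C (omap E X)"
      "Comp C (omap F X) (omap E X) (omap F X) (\<eta> X) g = Ident C (omap F X)"
      using iso[OF o[OF X]] unfolding is_isomorphism_def by blast
    show ?thesis
      unfolding is_isomorphism_def
      using g obj[OF X] by (auto simp: h c i intro!: bexI[of _ g])
  qed
  moreover have "Comp D (omap E X) (omap E Y) (omap F Y) (\<eta> Y) (amap E X Y m)
        = Comp D (omap E X) (omap F X) (omap F Y) (amap F X Y m) (\<eta> X)"
    if X: "X \<in> Obj D" and Y: "Y \<in> Obj D" and m: "m \<in> Hom D X Y" for X Y m
  proof -
    have mC: "m \<in> Hom C X Y" using m h[OF X Y] by simp
    have "amap E X Y m \<in> Hom C (omap E X) (omap E Y)" "amap F X Y m \<in> Hom C (omap F X) (omap F Y)"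
      using E F mC o[OF X] o[OF Y] by (auto simp: is_functor_def)
    moreover have "\<eta> X \<in> Hom C (omap E X) (omap F X)" "\<eta> Y \<in> Hom C (omap E Y) (omap F Y)"
      using iso[OF o[OF X]] iso[OF o[OF Y]] by (auto simp: is_isomorphism_def)
    ultimately show ?thesis
      using nat[OF o[OF X] o[OF Y] mC] obj[OF X] obj[OF Y] by (simp add: c)
  qed
  moreover have "is_functor D D E" "is_functor D D F"
    using E F D obj by (auto intro: is_functor_restrict)
  ultimately show ?thesis
    unfolding naturally_isomorphic_def by blast
qed

lemma is_equivalence_of_involution:
  assumes F: "is_functor C C F" and sq: "naturally_isomorphic C C (comp_fctr F F) id_fctr"
    and D: "is_full_subcategory D C" and D': "is_full_subcategory D' C"
    and obj: "\<And>X. X \<in> Obj D \<Longrightarrow> omap F X \<in> Obj D'" "\<And>X. X \<in> Obj D' \<Longrightarrow> omap F X \<in> Obj D"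
  shows "is_equivalence D D' F"
  unfolding is_equivalence_def
proof (intro conjI exI[of _ F])
  show "is_functor D D' F" "is_functor D' D F"
    using F D D' obj by (auto intro: is_functor_restrict)
  show "naturally_isomorphic D D (comp_fctr F F) id_fctr"
    by (rule naturally_isomorphic_restrict[OF sq D]) (auto simp: comp_fctr_def id_fctr_def obj)
  show "naturally_isomorphic D' D' (comp_fctr F F) id_fctr"
    by (rule naturally_isomorphic_restrict[OF sq D']) (auto simp: comp_fctr_def id_fctr_def obj)
qed

lemma is_full_subcategory_refl: "is_full_subcategory C C"
  by (simp add: is_full_subcategory_def)

section \<open>Linear maps and adjoints\<close>

lemma bounded_opsD:
  assumes "T \<in> bounded_ops H K"
  shows bounded_ops_hom: "T \<in> module_hom (class_ring :: complex ring) H K"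
    and bounded_ops_ext: "T \<in> extensional (carrier H)"
    and bounded_ops_in: "x \<in> carrier H \<Longrightarrow> T x \<in> carrier K"
    and bounded_ops_add: "\<lbrakk>x \<in> carrier H; y \<in> carrier H\<rbrakk> \<Longrightarrow> T (x \<oplus>\<^bsub>H\<^esub> y) = T x \<oplus>\<^bsub>K\<^esub> T y"
    and bounded_ops_smult: "x \<in> carrier H \<Longrightarrow> T (a \<odot>\<^bsub>H\<^esub> x) = a \<odot>\<^bsub>K\<^esub> T x"
  using assms by (auto simp: bounded_ops_def module_hom_def)

lemma bounded_opsI:
  assumes H: "finite_inner_space H" and K: "complex_inner_space K"
    and "\<And>x. x \<in> carrier H \<Longrightarrow> T x \<in> carrier K"
    and "\<And>x y. \<lbrakk>x \<in> carrier H; y \<in> carrier H\<rbrakk> \<Longrightarrow> T (x \<oplus>\<^bsub>H\<^esub> y) = T x \<oplus>\<^bsub>K\<^esub> T y"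
    and "\<And>a x. x \<in> carrier H \<Longrightarrow> T (a \<odot>\<^bsub>H\<^esub> x) = a \<odot>\<^bsub>K\<^esub> T x"
    and "T \<in> extensional (carrier H)"
  shows "T \<in> bounded_ops H K"
proof -
  have "T \<in> module_hom (class_ring :: complex ring) H K"
    using assms by (simp add: module_hom_def)
  then show ?thesis
    using linear_bounded_if_finite_dimensional[OF _ _ K, of H T] H assms(6)
    by (simp add: bounded_ops_def finite_inner_space_def finite_inner_space_axioms_def)
qed

lemma bounded_ops_zero:
  assumes "T \<in> bounded_ops H K" and H: "complex_inner_space H" and K: "complex_inner_space K"
  shows "T \<zero>\<^bsub>H\<^esub> = \<zero>\<^bsub>K\<^esub>"
proof -
  interpret H: complex_inner_space H by fact
  interpret K: complex_inner_space K by fact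
  have "T (0 \<odot>\<^bsub>H\<^esub> \<zero>\<^bsub>H\<^esub>) = 0 \<odot>\<^bsub>K\<^esub> T \<zero>\<^bsub>H\<^esub>"
    by (rule bounded_ops_smult[OF assms(1)]) (rule H.zero_in)
  then show ?thesis
    using bounded_ops_in[OF assms(1) H.zero_in] by (simp only: H.smult_zero_left K.smult_zero_left H.zero_in)
qed

lemma bounded_ops_diff:
  assumes T: "T \<in> bounded_ops H K" and H: "complex_inner_space H" and K: "complex_inner_space K"
    and x: "x \<in> carrier H" and y: "y \<in> carrier H"
  shows "T (x \<ominus>\<^bsub>H\<^esub> y) = T x \<ominus>\<^bsub>K\<^esub> T y"
proof -
  interpret H: complex_inner_space H by fact
  interpret K: complex_inner_space K by fact
  show ?thesis
    using x y bounded_ops_in[OF T]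
    by (simp only: H.diff_eq K.diff_eq bounded_ops_add[OF T] bounded_ops_smult[OF T] H.smult_in)
qed

lemma bounded_ops_finsum:
  assumes T: "T \<in> bounded_ops H K" and H: "complex_inner_space H" and K: "complex_inner_space K"
    and "finite J" "\<And>j. j \<in> J \<Longrightarrow> g j \<in> carrier H"
  shows "T (finsum H g J) = finsum K (\<lambda>j. T (g j)) J"
proof -
  interpret H: complex_inner_space H by fact
  interpret K: complex_inner_space K by fact
  show ?thesis
    using assms(4,5)
  proof (induction J rule: finite_induct)
    case empty
    show ?case using bounded_ops_zero[OF T H K] by simp
  next
    case (insert j J)
    have g: "g j \<in> carrier H" "g \<in> J \<rightarrow> carrier H" using insert.prems by auto
    then have Tg: "T (g j) \<in> carrier K" "(\<lambda>j. T (g j)) \<in> J \<rightarrow> carrier K"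
      using bounded_ops_in[OF T] by auto
    have "T (finsum H g (insert j J)) = T (g j) \<oplus>\<^bsub>K\<^esub> T (finsum H g J)"
      using insert.hyps g bounded_ops_add[OF T g(1) H.finsum_in[OF g(2)]] by simp
    then show ?case using insert Tg by simp
  qed
qed

lemma is_adjoint_commute:
  assumes "is_adjoint H K T S" and H: "complex_inner_space H" and K: "complex_inner_space K"
    and T: "\<And>x. x \<in> carrier H \<Longrightarrow> T x \<in> carrier K" and S: "\<And>y. y \<in> carrier K \<Longrightarrow> S y \<in> carrier H"
  shows "is_adjoint K H S T"
  unfolding is_adjoint_def
proof (intro ballI)
  fix y x assume y: "y \<in> carrier K" and x: "x \<in> carrier H"
  have "ip H (S y) x = cnj (ip H x (S y))"
    using complex_inner_space.ip_commute[OF H S[OF y] x] .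
  also have "\<dots> = cnj (ip K (T x) y)" using assms(1) x y by (simp add: is_adjoint_def)
  also have "\<dots> = ip K y (T x)"
    using complex_inner_space.ip_commute[OF K y T[OF x]] by simp
  finally show "ip H (S y) x = ip K y (T x)" .
qed

text \<open>A map that satisfies the adjointness equation is automatically linear, as can be tested against
  vectors, and it is unique. So an adjoint is identified by verifying that equation for a formula.\<close>

lemma adjoint_in_bounded_ops:
  assumes H: "complex_inner_space H" and K: "finite_inner_space K"
    and T: "\<And>x. x \<in> carrier H \<Longrightarrow> T x \<in> carrier K" and S: "\<And>y. y \<in> carrier K \<Longrightarrow> S y \<in> carrier H"
    and ext: "S \<in> extensional (carrier K)" and adj: "is_adjoint K H S T"
  shows "S \<in> bounded_ops K H"
proof -
  interpret H: complex_inner_space H by fact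
  interpret K: finite_inner_space K by fact
  have adj': "ip H (S y) x = ip K y (T x)" if "y \<in> carrier K" "x \<in> carrier H" for x y
    using adj that by (simp add: is_adjoint_def)
  show ?thesis
  proof (rule bounded_opsI[OF K H S _ _ ext])
    show "S (x \<oplus>\<^bsub>K\<^esub> y) = S x \<oplus>\<^bsub>H\<^esub> S y" if "x \<in> carrier K" "y \<in> carrier K" for x y
      by (rule H.ip_ext) (use that S T in \<open>simp_all add: adj' H.ip_add K.ip_add\<close>)
    show "S (a \<odot>\<^bsub>K\<^esub> x) = a \<odot>\<^bsub>H\<^esub> S x" if "x \<in> carrier K" for a x
      by (rule H.ip_ext) (use that S T in \<open>simp_all add: adj' H.ip_smult K.ip_smult\<close>)
  qed
qed

lemma adjoint_op_eqI:
  assumes H: "complex_inner_space H" and T: "\<And>x. x \<in> carrier H \<Longrightarrow> T x \<in> carrier K"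
    and S: "S \<in> bounded_ops K H" and adj: "is_adjoint H K T S"
  shows "adjoint_op H K T = S"
  unfolding adjoint_op_def
proof (rule the_equality)
  show "S \<in> bounded_ops K H \<and> is_adjoint H K T S" using S adj by simp
  interpret H: complex_inner_space H by fact
  fix R assume R: "R \<in> bounded_ops K H \<and> is_adjoint H K T R"
  show "R = S"
  proof (rule extensionalityI[OF bounded_ops_ext[OF conjunct1[OF R]] bounded_ops_ext[OF S]])
    fix y assume y: "y \<in> carrier K"
    have in_H: "R y \<in> carrier H" "S y \<in> carrier H"
      by (rule bounded_ops_in[OF conjunct1[OF R] y], rule bounded_ops_in[OF S y])
    have "ip H x (R y) = ip H x (S y)" if "x \<in> carrier H" for x
      using R adj that y unfolding is_adjoint_def by metis
    then have "ip H (R y) x = ip H (S y) x" if "x \<in> carrier H" for x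
      using that H.ip_commute[OF in_H(1) that] H.ip_commute[OF in_H(2) that] by simp
    then show "R y = S y" using H.ip_ext in_H by blast
  qed
qed

section \<open>Representations of bipartite graphs\<close>

text \<open>The class \<open>A\<close> is the one that is going to be reflected. Both functors of the theorem are instances, with the
  roles of the two classes interchanged.\<close>

locale bipartition =
  fixes G :: "'v pair_pre_digraph" and A B :: "'v set"
  assumes graph: "pair_graph G"
    and decomposition: "A \<union> B = pverts G" "A \<inter> B = {}"
    and edges: "\<And>i j. (i, j) \<in> parcs G \<Longrightarrow> i \<in> A \<and> j \<in> B \<or> i \<in> B \<and> j \<in> A"
begin

lemma arc_sym: "(i, j) \<in> parcs G \<Longrightarrow> (j, i) \<in> parcs G"
proof -
  interpret pair_graph G by (rule graph)
  show "(i, j) \<in> parcs G \<Longrightarrow> (j, i) \<in> parcs G" by (rule arcs_symmetric)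
qed

lemma in_nbrs_iff: "j \<in> nbrs G i \<longleftrightarrow> (i, j) \<in> parcs G"
  by (simp add: nbrs_def)

lemma finite_nbrs: "finite (nbrs G i)"
proof -
  interpret pair_graph G by (rule graph)
  have "nbrs G i \<subseteq> snd ` parcs G" by (force simp: nbrs_def)
  then show ?thesis using pair_finite_arcs finite_subset by blast
qed

lemma arc_verts:
  assumes "(i, j) \<in> parcs G"
  shows "i \<in> pverts G" "j \<in> pverts G"
  using edges[OF assms] decomposition by auto

lemma arc_parity:
  assumes "(i, j) \<in> parcs G"
  shows "i \<in> A \<longleftrightarrow> j \<in> B" "j \<in> A \<longleftrightarrow> i \<in> B" "i \<in> A \<longleftrightarrow> j \<notin> A" "i \<in> B \<longleftrightarrow> j \<notin> B"
  using edges[OF assms] decomposition by auto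

lemma nbrs_verts: "j \<in> nbrs G i \<Longrightarrow> j \<in> pverts G"
  using arc_verts by (simp add: in_nbrs_iff)

lemma nbrs_A: "\<lbrakk>i \<in> A; j \<in> nbrs G i\<rbrakk> \<Longrightarrow> j \<in> B \<and> j \<notin> A \<and> (i, j) \<in> parcs G \<and> (j, i) \<in> parcs G \<and> j \<in> pverts G"
  using arc_parity arc_sym arc_verts by (simp add: in_nbrs_iff)

lemma nbrs_B: "\<lbrakk>i \<in> B; j \<in> nbrs G i\<rbrakk> \<Longrightarrow> j \<in> A \<and> j \<notin> B \<and> (i, j) \<in> parcs G \<and> (j, i) \<in> parcs G \<and> j \<in> pverts G"
  using arc_parity arc_sym arc_verts by (simp add: in_nbrs_iff)

lemma A_vert: "i \<in> A \<Longrightarrow> i \<in> pverts G" and B_vert: "i \<in> B \<Longrightarrow> i \<in> pverts G"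
  using decomposition by auto

lemma B_not_A: "i \<in> B \<Longrightarrow> i \<notin> A"
  using decomposition by auto

lemma vert_cases: "i \<in> pverts G \<Longrightarrow> i \<in> A \<or> i \<in> B"
  using decomposition by auto

end

locale fd_rep = bipartition G A B for G :: "'v pair_pre_digraph" and A B :: "'v set" +
  fixes \<pi> :: "('v, 'a) rep"
  assumes rep: "is_rep G \<pi>" and fd: "finite_dimensional_rep G \<pi>"
begin

lemma space: "i \<in> pverts G \<Longrightarrow> complex_inner_space (sp \<pi> i)"
  using rep by (auto simp: is_rep_def separable_hilbert_space_def)

lemma fspace: "i \<in> pverts G \<Longrightarrow> finite_inner_space (sp \<pi> i)"
  using space fd
  by (simp add: finite_inner_space_def finite_inner_space_axioms_def finite_dimensional_rep_def)

lemma gam_bounded: "(i, j) \<in> parcs G \<Longrightarrow> gam \<pi> i j \<in> bounded_ops (sp \<pi> j) (sp \<pi> i)"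
  using rep by (auto simp: is_rep_def)

lemma gam_in: "\<lbrakk>(i, j) \<in> parcs G; x \<in> carrier (sp \<pi> j)\<rbrakk> \<Longrightarrow> gam \<pi> i j x \<in> carrier (sp \<pi> i)"
  using bounded_ops_in[OF gam_bounded] .

lemma gam_adjoint:
  "\<lbrakk>(i, j) \<in> parcs G; x \<in> carrier (sp \<pi> j); y \<in> carrier (sp \<pi> i)\<rbrakk>
    \<Longrightarrow> ip (sp \<pi> i) (gam \<pi> i j x) y = ip (sp \<pi> j) x (gam \<pi> j i y)"
  using rep unfolding is_rep_def is_adjoint_def by blast

lemma A_op_in:
  assumes "i \<in> pverts G" "x \<in> carrier (sp \<pi> i)"
  shows "A_op G \<pi> i x \<in> carrier (sp \<pi> i)"
proof -
  interpret Hi: complex_inner_space "sp \<pi> i" by (rule space[OF assms(1)])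
  show ?thesis
    unfolding A_op_def
    using assms arc_sym by (intro Hi.finsum_in) (auto simp: in_nbrs_iff intro!: gam_in)
qed

lemma ip_A_op:
  assumes "i \<in> pverts G" "x \<in> carrier (sp \<pi> i)" "y \<in> carrier (sp \<pi> i)"
  shows "ip (sp \<pi> i) (A_op G \<pi> i x) y
    = (\<Sum>j\<in>nbrs G i. ip (sp \<pi> j) (gam \<pi> j i x) (gam \<pi> j i y))"
proof -
  interpret Hi: complex_inner_space "sp \<pi> i" by (rule space[OF assms(1)])
  have in': "gam \<pi> j i x \<in> carrier (sp \<pi> j)" if "j \<in> nbrs G i" for j
    using that assms arc_sym gam_in by (simp add: in_nbrs_iff)
  have "ip (sp \<pi> i) (A_op G \<pi> i x) y = (\<Sum>j\<in>nbrs G i. ip (sp \<pi> i) (gam \<pi> i j (gam \<pi> j i x)) y)"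
    unfolding A_op_def
    using assms in' by (intro Hi.ip_finsum_left finite_nbrs) (simp_all add: in_nbrs_iff gam_in)
  also have "\<dots> = (\<Sum>j\<in>nbrs G i. ip (sp \<pi> j) (gam \<pi> j i x) (gam \<pi> j i y))"
  proof (rule sum.cong[OF refl])
    fix j assume j: "j \<in> nbrs G i"
    then have "(i, j) \<in> parcs G" by (simp add: in_nbrs_iff)
    then show "ip (sp \<pi> i) (gam \<pi> i j (gam \<pi> j i x)) y = ip (sp \<pi> j) (gam \<pi> j i x) (gam \<pi> j i y)"
      by (rule gam_adjoint[OF _ in'[OF j] assms(3)])
  qed
  finally show ?thesis .
qed

text \<open>Being a character is an identity between Hermitian forms.\<close>

lemma is_characterI:
  assumes "f \<in> VG G"
    and "\<And>i x y. \<lbrakk>i \<in> pverts G; x \<in> carrier (sp \<pi> i); y \<in> carrier (sp \<pi> i)\<rbrakk> \<Longrightarrow>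
      (\<Sum>j\<in>nbrs G i. ip (sp \<pi> j) (gam \<pi> j i x) (gam \<pi> j i y)) = complex_of_real (f i) * ip (sp \<pi> i) x y"
  shows "is_character G \<pi> f"
  unfolding is_character_def
proof (intro conjI ballI)
  fix i x assume i: "i \<in> pverts G" and x: "x \<in> carrier (sp \<pi> i)"
  interpret Hi: complex_inner_space "sp \<pi> i" by (rule space[OF i])
  show "A_op G \<pi> i x = complex_of_real (f i) \<odot>\<^bsub>sp \<pi> i\<^esub> x"
    by (rule Hi.ip_ext) (use i x in \<open>simp_all add: A_op_in ip_A_op assms(2) Hi.ip_smult\<close>)
qed fact

lemma locally_scalar: "is_character G \<pi> f \<Longrightarrow> locally_scalar G \<pi>"
  unfolding is_character_def locally_scalar_def by blast

end

text \<open>Of the two operators on an edge, exactly one starts from a space in \<open>A\<close>, and conjugate symmetry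
  transfers its adjointness equation to the other one.\<close>

lemma (in bipartition) fd_repI:
  assumes "sp \<pi> \<in> extensional (pverts G)" "\<And>i j. (i, j) \<notin> parcs G \<Longrightarrow> gam \<pi> i j = undefined"
    and fin: "\<And>i. i \<in> pverts G \<Longrightarrow> finite_inner_space (sp \<pi> i)"
    and bd: "\<And>i j. (i, j) \<in> parcs G \<Longrightarrow> gam \<pi> i j \<in> bounded_ops (sp \<pi> j) (sp \<pi> i)"
    and adj: "\<And>i j. \<lbrakk>(i, j) \<in> parcs G; j \<in> A\<rbrakk> \<Longrightarrow> is_adjoint (sp \<pi> j) (sp \<pi> i) (gam \<pi> i j) (gam \<pi> j i)"
  shows "fd_rep G A B \<pi>"
proof
  have cis: "complex_inner_space (sp \<pi> i)" if "i \<in> pverts G" for i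
    using fin[OF that] by (simp add: finite_inner_space_def)
  have fdi: "finite_dimensional (sp \<pi> i)" if "i \<in> pverts G" for i
    using fin[OF that] by (simp add: finite_inner_space_def finite_inner_space_axioms_def)
  show "finite_dimensional_rep G \<pi>"
    using fdi by (simp add: finite_dimensional_rep_def)
  have "is_adjoint (sp \<pi> j) (sp \<pi> i) (gam \<pi> i j) (gam \<pi> j i)" if ij: "(i, j) \<in> parcs G" for i j
  proof (cases "j \<in> A")
    case False
    then have "i \<in> A" using arc_parity[OF ij] by simp
    show ?thesis
      by (rule is_adjoint_commute[OF adj[OF arc_sym[OF ij] \<open>i \<in> A\<close>]])
        (use cis arc_verts[OF ij] bounded_ops_in[OF bd] ij arc_sym in auto)
  qed (use adj ij in simp)
  then show "is_rep G \<pi>"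
    unfolding is_rep_def
    using assms(1,2) bd complex_inner_space.separable_hilbert_space_if_finite_dimensional[OF cis fdi]
    by auto
qed

locale char_rep = fd_rep G A B \<pi> for G :: "'v pair_pre_digraph" and A B and \<pi> :: "('v, 'a) rep" +
  fixes f :: "'v \<Rightarrow> real"
  assumes char: "is_character G \<pi> f"
begin

lemma f_VG: "f \<in> VG G"
  using char by (simp add: is_character_def)

lemma char_ip:
  assumes "i \<in> pverts G" "x \<in> carrier (sp \<pi> i)" "y \<in> carrier (sp \<pi> i)"
  shows "(\<Sum>j\<in>nbrs G i. ip (sp \<pi> j) (gam \<pi> j i x) (gam \<pi> j i y)) = complex_of_real (f i) * ip (sp \<pi> i) x y"
  using assms char complex_inner_space.ip_smult[OF space[OF assms(1)]]
  by (simp add: ip_A_op[symmetric] is_character_def)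

text \<open>At a unit vector, the value of the character is the sum of the squared norms of its images.\<close>

lemma char_nonneg:
  assumes i: "i \<in> pverts G" and "hdim (sp \<pi> i) \<noteq> 0"
  shows "0 \<le> f i"
proof -
  interpret Hi: finite_inner_space "sp \<pi> i" by (rule fspace[OF i])
  obtain E where E: "Hi.onb E" using Hi.onb_exists[OF Hi.finite_dim] .
  then have "E \<noteq> {}" using Hi.onb_hdim assms by auto
  then obtain x where "x \<in> E" by blast
  then have x: "x \<in> carrier (sp \<pi> i)" "ip (sp \<pi> i) x x = 1"
    using E by (auto simp: Hi.onb_def Hi.orthonormal_def)
  have "f i = Re (\<Sum>j\<in>nbrs G i. ip (sp \<pi> j) (gam \<pi> j i x) (gam \<pi> j i x))"
    using char_ip[OF i x(1) x(1)] x(2) by simp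
  also have "\<dots> \<ge> 0"
    unfolding Re_sum
  proof (rule sum_nonneg)
    fix j assume j: "j \<in> nbrs G i"
    have "gam \<pi> j i x \<in> carrier (sp \<pi> j)"
      using gam_in[OF arc_sym x(1)] j by (simp add: in_nbrs_iff)
    then show "0 \<le> Re (ip (sp \<pi> j) (gam \<pi> j i x) (gam \<pi> j i x))"
      using complex_inner_space.ip_nonneg[OF space[OF nbrs_verts[OF j]]] by blast
  qed
  finally show ?thesis .
qed

end

section \<open>The reflected representation\<close>

text \<open>The objects that can be reflected: positivity on all of \<open>A\<close> makes the scaling by the square root of
  \<open>f i\<close> invertible, also at vertices with zero space, whose complement is the whole direct sum.\<close>

locale refl_rep = char_rep G A B \<pi> f
  for G :: "'v pair_pre_digraph" and A B and \<pi> :: "('v, ('v, 'b) hvec) rep" and f +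
  assumes pos: "\<And>i. i \<in> A \<Longrightarrow> 0 < f i"
begin

abbreviation nbr_sum where "nbr_sum i \<equiv> hilbert_sum (nbrs G i) (sp \<pi>)"
abbreviation U where "U i \<equiv> isometry_in G \<pi> f i"
abbreviation hat where "hat i \<equiv> hat_space G \<pi> f i"
abbreviation rt where "rt i \<equiv> complex_of_real (sqrt (f i))"

lemma rt_eqs: "i \<in> A \<Longrightarrow> rt i * rt i = complex_of_real (f i)" "i \<in> A \<Longrightarrow> rt i \<noteq> 0"
  "i \<in> A \<Longrightarrow> complex_of_real (f i) \<noteq> 0" "cnj (rt i) = rt i"
  "complex_of_real (1 / sqrt (f i)) = 1 / rt i"
  using pos[of i] by (auto simp flip: of_real_mult)

lemma nbr_space: "j \<in> nbrs G i \<Longrightarrow> complex_inner_space (sp \<pi> j)"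
  by (rule space[OF nbrs_verts])

lemma nbr_sum_space: "complex_inner_space (nbr_sum i)"
  by (rule complex_inner_space_hilbert_sum[OF finite_nbrs nbr_space])

lemma nbr_sum_fin: "finite_inner_space (nbr_sum i)"
  and nbr_sum_hdim: "hdim (nbr_sum i) = (\<Sum>j\<in>nbrs G i. hdim (sp \<pi> j))"
  by (rule hilbert_sum_finite_dimensional[OF finite_nbrs], rule fspace, erule nbrs_verts)+

lemma coord_nbr_in: "\<lbrakk>x \<in> carrier (nbr_sum i); j \<in> nbrs G i\<rbrakk> \<Longrightarrow> coord x j \<in> carrier (sp \<pi> j)"
  by (rule coord_in)

lemma gam_nbr_in: "\<lbrakk>j \<in> nbrs G i; x \<in> carrier (sp \<pi> i)\<rbrakk> \<Longrightarrow> gam \<pi> j i x \<in> carrier (sp \<pi> j)"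
  using gam_in arc_sym by (simp add: in_nbrs_iff)

lemma coord_U: "j \<in> nbrs G i \<Longrightarrow> coord (U i x) j = (1 / rt i) \<odot>\<^bsub>sp \<pi> j\<^esub> gam \<pi> j i x"
  by (simp add: isometry_in_def)

lemma U_in: "x \<in> carrier (sp \<pi> i) \<Longrightarrow> U i x \<in> carrier (nbr_sum i)"
  unfolding isometry_in_def
  by (rule Tuple_in) (simp add: complex_inner_space.smult_in[OF nbr_space] gam_nbr_in)

lemma nbr_sum_smult_coord: "j \<in> nbrs G i \<Longrightarrow> coord (a \<odot>\<^bsub>nbr_sum i\<^esub> x) j = a \<odot>\<^bsub>sp \<pi> j\<^esub> coord x j"
  by (simp add: hilbert_sum_smult)

lemma nbr_sum_add_coord:
  "j \<in> nbrs G i \<Longrightarrow> coord (x \<oplus>\<^bsub>nbr_sum i\<^esub> y) j = coord x j \<oplus>\<^bsub>sp \<pi> j\<^esub> coord y j"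
  by (simp add: hilbert_sum_add)

lemma U_add:
  assumes i: "i \<in> pverts G" and x: "x \<in> carrier (sp \<pi> i)" and y: "y \<in> carrier (sp \<pi> i)"
  shows "U i (x \<oplus>\<^bsub>sp \<pi> i\<^esub> y) = U i x \<oplus>\<^bsub>nbr_sum i\<^esub> U i y"
proof (rule hilbert_sum_ext)
  show "U i (x \<oplus>\<^bsub>sp \<pi> i\<^esub> y) \<in> carrier (nbr_sum i)"
    by (rule U_in[OF complex_inner_space.add_in[OF space[OF i] x y]])
  show "U i x \<oplus>\<^bsub>nbr_sum i\<^esub> U i y \<in> carrier (nbr_sum i)"
    by (rule complex_inner_space.add_in[OF nbr_sum_space U_in[OF x] U_in[OF y]])
  fix j assume j: "j \<in> nbrs G i"
  have g: "gam \<pi> j i (x \<oplus>\<^bsub>sp \<pi> i\<^esub> y) = gam \<pi> j i x \<oplus>\<^bsub>sp \<pi> j\<^esub> gam \<pi> j i y"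
    using bounded_ops_add[OF gam_bounded[OF arc_sym] x y] j by (simp add: in_nbrs_iff)
  show "coord (U i (x \<oplus>\<^bsub>sp \<pi> i\<^esub> y)) j = coord (U i x \<oplus>\<^bsub>nbr_sum i\<^esub> U i y) j"
    using complex_inner_space.smult_add_vector[OF nbr_space[OF j] gam_nbr_in[OF j x] gam_nbr_in[OF j y]]
    by (simp add: nbr_sum_add_coord coord_U j g)
qed

lemma U_smult:
  assumes i: "i \<in> pverts G" and x: "x \<in> carrier (sp \<pi> i)"
  shows "U i (a \<odot>\<^bsub>sp \<pi> i\<^esub> x) = a \<odot>\<^bsub>nbr_sum i\<^esub> U i x"
proof (rule hilbert_sum_ext)
  show "U i (a \<odot>\<^bsub>sp \<pi> i\<^esub> x) \<in> carrier (nbr_sum i)"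
    by (rule U_in[OF complex_inner_space.smult_in[OF space[OF i] x]])
  show "a \<odot>\<^bsub>nbr_sum i\<^esub> U i x \<in> carrier (nbr_sum i)"
    by (rule complex_inner_space.smult_in[OF nbr_sum_space U_in[OF x]])
  fix j assume j: "j \<in> nbrs G i"
  have g: "gam \<pi> j i (a \<odot>\<^bsub>sp \<pi> i\<^esub> x) = a \<odot>\<^bsub>sp \<pi> j\<^esub> gam \<pi> j i x"
    using bounded_ops_smult[OF gam_bounded[OF arc_sym] x] j by (simp add: in_nbrs_iff)
  show "coord (U i (a \<odot>\<^bsub>sp \<pi> i\<^esub> x)) j = coord (a \<odot>\<^bsub>nbr_sum i\<^esub> U i x) j"
    using complex_inner_space.smult_smult[OF nbr_space[OF j] gam_nbr_in[OF j x]]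
    by (simp add: nbr_sum_smult_coord coord_U j g)
qed

lemma ip_U:
  assumes x: "x \<in> carrier (sp \<pi> i)" and y: "y \<in> carrier (nbr_sum i)"
  shows "ip (nbr_sum i) (U i x) y = 1 / rt i * (\<Sum>j\<in>nbrs G i. ip (sp \<pi> j) (gam \<pi> j i x) (coord y j))"
  unfolding hilbert_sum_ip sum_distrib_left
  by (intro sum.cong refl)
    (simp add: coord_U complex_inner_space.ip_smult[OF nbr_space] gam_nbr_in[OF _ x] coord_nbr_in[OF y])

lemma ip_U_U:
  assumes i: "i \<in> A" and x: "x \<in> carrier (sp \<pi> i)" and y: "y \<in> carrier (sp \<pi> i)"
  shows "ip (nbr_sum i) (U i x) (U i y) = ip (sp \<pi> i) x y"
proof -
  have "ip (nbr_sum i) (U i x) (U i y)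
      = 1 / rt i * (\<Sum>j\<in>nbrs G i. 1 / rt i * ip (sp \<pi> j) (gam \<pi> j i x) (gam \<pi> j i y))"
    unfolding ip_U[OF x U_in[OF y]]
    by (intro arg_cong2[where f = "(*)"] sum.cong refl)
      (simp add: coord_U complex_inner_space.ip_smult_right[OF nbr_space] gam_nbr_in x y)
  also have "\<dots> = 1 / rt i * (1 / rt i * (rt i * rt i * ip (sp \<pi> i) x y))"
    by (simp only: sum_distrib_left[symmetric] rt_eqs(1)[OF i] char_ip[OF A_vert[OF i] x y])
  also have "\<dots> = ip (sp \<pi> i) x y" using rt_eqs(2)[OF i] by simp
  finally show ?thesis .
qed

lemma hat_simps [simp]:
  "add (hat i) = add (nbr_sum i)" "\<zero>\<^bsub>hat i\<^esub> = \<zero>\<^bsub>nbr_sum i\<^esub>"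
  "smult (hat i) = smult (nbr_sum i)" "ip (hat i) = ip (nbr_sum i)"
  by (simp_all add: hat_space_def)

lemma hat_iff: "x \<in> carrier (hat i) \<longleftrightarrow>
    x \<in> carrier (nbr_sum i) \<and> (\<forall>w\<in>carrier (sp \<pi> i). ip (nbr_sum i) (U i w) x = 0)"
  by (auto simp: hat_space_def orth_complement_carrier)

lemma hat_in_nbr_sum: "x \<in> carrier (hat i) \<Longrightarrow> x \<in> carrier (nbr_sum i)"
  by (simp add: hat_iff)

text \<open>The complement of the image of the isometry is the kernel of its adjoint, the map that sums
  up the images of the components.\<close>

lemma hat_sum_zero:
  assumes "i \<in> A" "x \<in> carrier (hat i)" "w \<in> carrier (sp \<pi> i)"
  shows "(\<Sum>j\<in>nbrs G i. ip (sp \<pi> j) (gam \<pi> j i w) (coord x j)) = 0"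
  using assms ip_U[OF assms(3) hat_in_nbr_sum[OF assms(2)]] rt_eqs(2)[OF assms(1)] by (auto simp: hat_iff)

lemma hatI:
  assumes "i \<in> A" "x \<in> carrier (nbr_sum i)"
    and "\<And>w. w \<in> carrier (sp \<pi> i) \<Longrightarrow> (\<Sum>j\<in>nbrs G i. ip (sp \<pi> j) (gam \<pi> j i w) (coord x j)) = 0"
  shows "x \<in> carrier (hat i)"
  using assms by (simp add: hat_iff ip_U)

lemma U_image: "U i ` carrier (sp \<pi> i) \<subseteq> carrier (nbr_sum i)"
  using U_in by blast

lemma hat_fin: "finite_inner_space (hat i)"
  unfolding hat_space_def by (rule finite_inner_space_orth_complement[OF nbr_sum_fin U_image])

lemma hat_space: "complex_inner_space (hat i)"
  using hat_fin by (simp add: finite_inner_space_def)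

lemma hat_hdim:
  assumes i: "i \<in> A"
  shows "hdim (hat i) + hdim (sp \<pi> i) = (\<Sum>j\<in>nbrs G i. hdim (sp \<pi> j))"
proof -
  have "U i \<in> module_hom (class_ring :: complex ring) (sp \<pi> i) (nbr_sum i)"
    using U_in U_add[OF A_vert[OF i]] U_smult[OF A_vert[OF i]] by (simp add: module_hom_def)
  then show ?thesis
    unfolding hat_space_def nbr_sum_hdim[symmetric]
    by (rule hdim_orth_complement_isometry[OF fspace[OF A_vert[OF i]] nbr_sum_fin]) (rule ip_U_U[OF i])
qed

lemma coord_hat_in: "\<lbrakk>x \<in> carrier (hat i); j \<in> nbrs G i\<rbrakk> \<Longrightarrow> coord x j \<in> carrier (sp \<pi> j)"
  by (rule coord_nbr_in[OF hat_in_nbr_sum])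

lemma delta_out: "x \<in> carrier (hat i) \<Longrightarrow> delta_out G \<pi> f j i x = rt i \<odot>\<^bsub>sp \<pi> j\<^esub> coord x j"
  by (simp add: delta_out_def)

lemma delta_out_in: "\<lbrakk>x \<in> carrier (hat i); j \<in> nbrs G i\<rbrakk> \<Longrightarrow> delta_out G \<pi> f j i x \<in> carrier (sp \<pi> j)"
  by (simp add: delta_out complex_inner_space.smult_in[OF nbr_space] coord_hat_in)

lemma delta_out_bounded:
  assumes j: "j \<in> nbrs G i"
  shows "delta_out G \<pi> f j i \<in> bounded_ops (hat i) (sp \<pi> j)"
proof (rule bounded_opsI[OF hat_fin nbr_space[OF j]])
  interpret Hat: complex_inner_space "hat i" by (rule hat_space)
  interpret Hj: complex_inner_space "sp \<pi> j" by (rule nbr_space[OF j])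
  show "delta_out G \<pi> f j i \<in> extensional (carrier (hat i))" by (simp add: delta_out_def)
  show "delta_out G \<pi> f j i x \<in> carrier (sp \<pi> j)" if "x \<in> carrier (hat i)" for x
    using that j by (rule delta_out_in)
  show "delta_out G \<pi> f j i (x \<oplus>\<^bsub>hat i\<^esub> y) = delta_out G \<pi> f j i x \<oplus>\<^bsub>sp \<pi> j\<^esub> delta_out G \<pi> f j i y"
    if x: "x \<in> carrier (hat i)" and y: "y \<in> carrier (hat i)" for x y
    unfolding delta_out[OF x] delta_out[OF y] delta_out[OF Hat.add_in[OF x y]]
    using Hj.smult_add_vector[OF coord_hat_in[OF x j] coord_hat_in[OF y j]]
    by (simp add: nbr_sum_add_coord[OF j])
  show "delta_out G \<pi> f j i (a \<odot>\<^bsub>hat i\<^esub> x) = a \<odot>\<^bsub>sp \<pi> j\<^esub> delta_out G \<pi> f j i x"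
    if x: "x \<in> carrier (hat i)" for a x
    unfolding delta_out[OF x] delta_out[OF Hat.smult_in[OF x]]
    by (simp add: nbr_sum_smult_coord[OF j] Hj.smult_smult coord_hat_in[OF x j] mult.commute)
qed

text \<open>The projection onto the complement of the image of \<open>U i\<close> is the identity minus \<open>U i\<close> composed with its
  adjoint. Applied to a vector \<open>y\<close> of the \<open>j\<close>-th summand and scaled by the square root of \<open>f i\<close>, it has the
  following components.\<close>

definition delta_in where
  "delta_in i j = (\<lambda>y\<in>carrier (sp \<pi> j). Tuple (\<lambda>k\<in>nbrs G i. rt i \<odot>\<^bsub>sp \<pi> k\<^esub>
     ((if k = j then y else \<zero>\<^bsub>sp \<pi> k\<^esub>)
        \<ominus>\<^bsub>sp \<pi> k\<^esub> complex_of_real (1 / f i) \<odot>\<^bsub>sp \<pi> k\<^esub> gam \<pi> k i (gam \<pi> i j y))))"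

lemma coord_delta_in:
  "\<lbrakk>k \<in> nbrs G i; y \<in> carrier (sp \<pi> j)\<rbrakk> \<Longrightarrow> coord (delta_in i j y) k = rt i \<odot>\<^bsub>sp \<pi> k\<^esub>
     ((if k = j then y else \<zero>\<^bsub>sp \<pi> k\<^esub>)
        \<ominus>\<^bsub>sp \<pi> k\<^esub> complex_of_real (1 / f i) \<odot>\<^bsub>sp \<pi> k\<^esub> gam \<pi> k i (gam \<pi> i j y))"
  by (simp add: delta_in_def)

lemma gam_back_in: "\<lbrakk>j \<in> nbrs G i; y \<in> carrier (sp \<pi> j)\<rbrakk> \<Longrightarrow> gam \<pi> i j y \<in> carrier (sp \<pi> i)"
  using gam_in by (simp add: in_nbrs_iff)

lemma delta_in_component_in:
  assumes j: "j \<in> nbrs G i" and y: "y \<in> carrier (sp \<pi> j)" and k: "k \<in> nbrs G i"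
  shows "(if k = j then y else \<zero>\<^bsub>sp \<pi> k\<^esub>) \<in> carrier (sp \<pi> k)"
    "a \<odot>\<^bsub>sp \<pi> k\<^esub> gam \<pi> k i (gam \<pi> i j y) \<in> carrier (sp \<pi> k)"
proof -
  interpret Hk: complex_inner_space "sp \<pi> k" by (rule nbr_space[OF k])
  show "(if k = j then y else \<zero>\<^bsub>sp \<pi> k\<^esub>) \<in> carrier (sp \<pi> k)" using y Hk.zero_in by (cases "k = j") simp_all
  show "a \<odot>\<^bsub>sp \<pi> k\<^esub> gam \<pi> k i (gam \<pi> i j y) \<in> carrier (sp \<pi> k)"
    by (rule Hk.smult_in[OF gam_nbr_in[OF k gam_back_in[OF j y]]])
qed

lemma delta_in_nbr_sum:
  assumes j: "j \<in> nbrs G i" and y: "y \<in> carrier (sp \<pi> j)"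
  shows "delta_in i j y \<in> carrier (nbr_sum i)"
proof -
  have "Tuple (\<lambda>k\<in>nbrs G i. rt i \<odot>\<^bsub>sp \<pi> k\<^esub>
     ((if k = j then y else \<zero>\<^bsub>sp \<pi> k\<^esub>)
        \<ominus>\<^bsub>sp \<pi> k\<^esub> complex_of_real (1 / f i) \<odot>\<^bsub>sp \<pi> k\<^esub> gam \<pi> k i (gam \<pi> i j y))) \<in> carrier (nbr_sum i)"
    by (intro Tuple_in complex_inner_space.smult_in[OF nbr_space]
        complex_inner_space.diff_in[OF nbr_space] delta_in_component_in[OF j y])
  then show ?thesis using y by (simp only: delta_in_def restrict_apply' )
qed

lemma ip_delta_in:
  assumes j: "j \<in> nbrs G i" and y: "y \<in> carrier (sp \<pi> j)" and z: "z \<in> carrier (nbr_sum i)"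
  shows "ip (nbr_sum i) (delta_in i j y) z = rt i * (ip (sp \<pi> j) y (coord z j)
    - complex_of_real (1 / f i) * (\<Sum>k\<in>nbrs G i. ip (sp \<pi> k) (gam \<pi> k i (gam \<pi> i j y)) (coord z k)))"
proof -
  have "ip (sp \<pi> k) (coord (delta_in i j y) k) (coord z k)
      = rt i * (if k = j then ip (sp \<pi> j) y (coord z j) else 0)
        - rt i * (complex_of_real (1 / f i) * ip (sp \<pi> k) (gam \<pi> k i (gam \<pi> i j y)) (coord z k))"
    if k: "k \<in> nbrs G i" for k
  proof -
    interpret Hk: complex_inner_space "sp \<pi> k" by (rule nbr_space[OF k])
    note zk = coord_nbr_in[OF z k] and ck = delta_in_component_in[OF j y k]
    have "ip (sp \<pi> k) (if k = j then y else \<zero>\<^bsub>sp \<pi> k\<^esub>) (coord z k)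
        = (if k = j then ip (sp \<pi> j) y (coord z j) else 0)"
      using Hk.ip_zero_left[OF zk] by (cases "k = j") simp_all
    then show ?thesis
      unfolding coord_delta_in[OF k y] Hk.ip_smult[OF Hk.diff_in[OF ck] zk] Hk.ip_diff_left[OF ck zk]
        Hk.ip_smult[OF gam_nbr_in[OF k gam_back_in[OF j y]] zk]
      by (simp only: right_diff_distrib)
  qed
  then have "ip (nbr_sum i) (delta_in i j y) z = (\<Sum>k\<in>nbrs G i. rt i * (if k = j then ip (sp \<pi> j) y (coord z j) else 0)
        - rt i * (complex_of_real (1 / f i) * ip (sp \<pi> k) (gam \<pi> k i (gam \<pi> i j y)) (coord z k)))"
    unfolding hilbert_sum_ip by (rule sum.cong[OF refl])
  also have "\<dots> = rt i * (\<Sum>k\<in>nbrs G i. if k = j then ip (sp \<pi> j) y (coord z j) else 0)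
        - rt i * (complex_of_real (1 / f i) * (\<Sum>k\<in>nbrs G i. ip (sp \<pi> k) (gam \<pi> k i (gam \<pi> i j y)) (coord z k)))"
    by (simp only: sum_subtractf sum_distrib_left)
  also have "(\<Sum>k\<in>nbrs G i. if k = j then ip (sp \<pi> j) y (coord z j) else 0) = ip (sp \<pi> j) y (coord z j)"
    using j finite_nbrs by simp
  finally show ?thesis by (simp only: right_diff_distrib)
qed

text \<open>The two terms of the inner product with \<open>U i w\<close> cancel by the character identity at \<open>i\<close>.\<close>

lemma delta_in_hat:
  assumes i: "i \<in> A" and j: "j \<in> nbrs G i" and y: "y \<in> carrier (sp \<pi> j)"
  shows "delta_in i j y \<in> carrier (hat i)"
  unfolding hat_iff
proof (intro conjI ballI)
  show K: "delta_in i j y \<in> carrier (nbr_sum i)" by (rule delta_in_nbr_sum[OF j y])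
  fix w assume w: "w \<in> carrier (sp \<pi> i)"
  interpret Ki: complex_inner_space "nbr_sum i" by (rule nbr_sum_space)
  have "(\<Sum>k\<in>nbrs G i. ip (sp \<pi> k) (gam \<pi> k i (gam \<pi> i j y)) (coord (U i w) k))
      = (\<Sum>k\<in>nbrs G i. 1 / rt i * ip (sp \<pi> k) (gam \<pi> k i (gam \<pi> i j y)) (gam \<pi> k i w))"
    by (intro sum.cong refl)
      (simp add: coord_U complex_inner_space.ip_smult_right[OF nbr_space] gam_nbr_in gam_back_in j w y)
  also have "\<dots> = 1 / rt i * (complex_of_real (f i) * ip (sp \<pi> i) (gam \<pi> i j y) w)"
    using char_ip[OF A_vert[OF i] gam_back_in[OF j y] w] by (simp only: sum_distrib_left[symmetric])
  finally have "complex_of_real (1 / f i) * (\<Sum>k\<in>nbrs G i. ip (sp \<pi> k) (gam \<pi> k i (gam \<pi> i j y)) (coord (U i w) k))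
      = 1 / rt i * ip (sp \<pi> i) (gam \<pi> i j y) w"
    using rt_eqs(3)[OF i] by simp
  moreover have "ip (sp \<pi> j) y (coord (U i w) j) = 1 / rt i * ip (sp \<pi> j) y (gam \<pi> j i w)"
    using j w y by (simp add: coord_U complex_inner_space.ip_smult_right[OF nbr_space] gam_nbr_in)
  moreover have "ip (sp \<pi> i) (gam \<pi> i j y) w = ip (sp \<pi> j) y (gam \<pi> j i w)"
    using gam_adjoint[of i j y w] j y w by (simp add: in_nbrs_iff)
  ultimately have "ip (nbr_sum i) (delta_in i j y) (U i w) = 0"
    unfolding ip_delta_in[OF j y U_in[OF w]] by simp
  then show "ip (nbr_sum i) (U i w) (delta_in i j y) = 0"
    using Ki.ip_commute[OF U_in[OF w] K] by simp
qed

lemma delta_in_adjoint: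
  assumes i: "i \<in> A" and j: "j \<in> nbrs G i"
  shows "is_adjoint (sp \<pi> j) (hat i) (delta_in i j) (delta_out G \<pi> f j i)"
  unfolding is_adjoint_def
proof (intro ballI)
  fix y x assume y: "y \<in> carrier (sp \<pi> j)" and x: "x \<in> carrier (hat i)"
  have "ip (hat i) (delta_in i j y) x = rt i * ip (sp \<pi> j) y (coord x j)"
    using ip_delta_in[OF j y hat_in_nbr_sum[OF x]] hat_sum_zero[OF i x gam_back_in[OF j y]] by simp
  also have "\<dots> = ip (sp \<pi> j) y (delta_out G \<pi> f j i x)"
    using complex_inner_space.ip_smult_right[OF nbr_space[OF j] y coord_hat_in[OF x j]]
    by (simp add: delta_out[OF x])
  finally show "ip (hat i) (delta_in i j y) x = ip (sp \<pi> j) y (delta_out G \<pi> f j i x)" .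
qed

lemma delta_in_bounded:
  assumes i: "i \<in> A" and j: "j \<in> nbrs G i"
  shows "delta_in i j \<in> bounded_ops (sp \<pi> j) (hat i)"
proof (rule adjoint_in_bounded_ops[OF hat_space fspace[OF nbrs_verts[OF j]] _ _ _ delta_in_adjoint[OF i j]])
  show "delta_in i j \<in> extensional (carrier (sp \<pi> j))" by (simp add: delta_in_def)
qed (simp_all add: delta_out_in j delta_in_hat[OF i j])

lemma adjoint_delta_out:
  assumes i: "i \<in> A" and j: "j \<in> nbrs G i"
  shows "adjoint_op (hat i) (sp \<pi> j) (delta_out G \<pi> f j i) = delta_in i j"
proof (rule adjoint_op_eqI[OF hat_space _ delta_in_bounded[OF i j]])
  show "delta_out G \<pi> f j i x \<in> carrier (sp \<pi> j)" if "x \<in> carrier (hat i)" for x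
    using delta_out_in[OF that j] .
  show "is_adjoint (hat i) (sp \<pi> j) (delta_out G \<pi> f j i) (delta_in i j)"
    by (rule is_adjoint_commute[OF delta_in_adjoint[OF i j] nbr_space[OF j] hat_space])
      (simp_all add: delta_out_in j delta_in_hat[OF i j])
qed

abbreviation rep' where "rep' \<equiv> reflect_rep G A (\<pi>, f)"
abbreviation f' where "f' \<equiv> reflect_char G B (dim_vec G \<pi>) f"

lemma sp'_A: "i \<in> A \<Longrightarrow> sp rep' i = hat i" and sp'_B: "j \<in> B \<Longrightarrow> sp rep' j = sp \<pi> j"
  using A_vert B_vert B_not_A by (auto simp: reflect_rep_def)

lemma gam'_out: "\<lbrakk>i \<in> A; j \<in> nbrs G i\<rbrakk> \<Longrightarrow> gam rep' j i = delta_out G \<pi> f j i"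
  using nbrs_A[of i j] by (simp add: reflect_rep_def)

lemma gam'_in: "\<lbrakk>i \<in> A; j \<in> nbrs G i\<rbrakk> \<Longrightarrow> gam rep' i j = delta_in i j"
  using nbrs_A[of i j] by (simp add: reflect_rep_def adjoint_delta_out)

lemma fd_rep': "fd_rep G A B rep'"
proof (rule fd_repI)
  show "sp rep' \<in> extensional (pverts G)" by (simp add: reflect_rep_def)
  show "gam rep' i j = undefined" if "(i, j) \<notin> parcs G" for i j using that by (simp add: reflect_rep_def)
  show "finite_inner_space (sp rep' i)" if "i \<in> pverts G" for i
    using vert_cases[OF that] fspace[OF that] hat_fin by (auto simp: sp'_A sp'_B)
  show "gam rep' i j \<in> bounded_ops (sp rep' j) (sp rep' i)" if ij: "(i, j) \<in> parcs G" for i j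
  proof (cases "j \<in> A")
    case True
    then have "i \<in> nbrs G j" "i \<in> B" using ij arc_sym arc_parity[OF ij] by (auto simp: in_nbrs_iff)
    then show ?thesis using True delta_out_bounded by (simp add: sp'_A sp'_B gam'_out)
  next
    case False
    then have "i \<in> A" "j \<in> B" "j \<in> nbrs G i" using ij arc_parity[OF ij] by (auto simp: in_nbrs_iff)
    then show ?thesis using delta_in_bounded by (simp add: sp'_A sp'_B gam'_in)
  qed
  show "is_adjoint (sp rep' j) (sp rep' i) (gam rep' i j) (gam rep' j i)" if ij: "(i, j) \<in> parcs G" and j: "j \<in> A" for i j
  proof -
    have i: "i \<in> nbrs G j" "i \<in> B" using ij arc_sym arc_parity[OF ij] j by (auto simp: in_nbrs_iff)
    have "is_adjoint (hat j) (sp \<pi> i) (delta_out G \<pi> f i j) (delta_in j i)"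
      by (rule is_adjoint_commute[OF delta_in_adjoint[OF j i(1)] nbr_space[OF i(1)] hat_space])
        (simp_all add: delta_out_in i delta_in_hat[OF j i(1)])
    then show ?thesis using i j by (simp add: sp'_A sp'_B gam'_out gam'_in)
  qed
qed

lemma dim_vec': "dim_vec G rep' = reflect_vec G A (dim_vec G \<pi>)"
proof
  fix i
  consider "i \<notin> pverts G" | "i \<in> A" | "i \<in> B" using vert_cases by blast
  then show "dim_vec G rep' i = reflect_vec G A (dim_vec G \<pi>) i"
  proof cases
    case 2
    have "(\<Sum>j\<in>nbrs G i. dim_vec G \<pi> j) = (\<Sum>j\<in>nbrs G i. real (hdim (sp \<pi> j)))"
      using nbrs_verts by (intro sum.cong) (auto simp: dim_vec_def)
    also have "\<dots> = real (hdim (hat i)) + real (hdim (sp \<pi> i))"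
      using arg_cong[OF hat_hdim[OF 2], of real] by simp
    finally show ?thesis
      using 2 A_vert[OF 2] by (simp add: dim_vec_def reflect_vec_def sp'_A)
  next
    case 3
    then show ?thesis using B_vert[OF 3] B_not_A[OF 3] by (simp add: dim_vec_def reflect_vec_def sp'_B)
  qed (simp add: dim_vec_def reflect_vec_def)
qed

lemma f'_A: "i \<in> A \<Longrightarrow> f' i = f i"
  using A_vert decomposition by (auto simp: reflect_char_def)

text \<open>At \<open>i\<close> in \<open>A\<close> the form is \<open>f i\<close> times the inner product of the direct sum. At \<open>i\<close> in \<open>B\<close> the explicit formula
  for \<open>delta_in\<close> turns the contribution of a neighbour \<open>j\<close> into \<open>f j\<close> times the inner product minus the old
  contribution. Where the space is zero, both sides vanish for every value of the character, which is why
  the reflected character can keep its old value there.\<close>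

lemma character': "is_character G rep' f'"
proof (rule fd_rep.is_characterI[OF fd_rep'])
  show "f' \<in> VG G" by (simp add: reflect_char_def VG_def)
  fix i x y assume i: "i \<in> pverts G" and x: "x \<in> carrier (sp rep' i)" and y: "y \<in> carrier (sp rep' i)"
  show "(\<Sum>j\<in>nbrs G i. ip (sp rep' j) (gam rep' j i x) (gam rep' j i y)) = complex_of_real (f' i) * ip (sp rep' i) x y"
  proof (cases "i \<in> A")
    case True
    then have x: "x \<in> carrier (hat i)" and y: "y \<in> carrier (hat i)" using x y by (simp_all add: sp'_A)
    have "ip (sp rep' j) (gam rep' j i x) (gam rep' j i y)
        = complex_of_real (f i) * ip (sp \<pi> j) (coord x j) (coord y j)" if j: "j \<in> nbrs G i" for j
    proof -
      interpret Hj: complex_inner_space "sp \<pi> j" by (rule nbr_space[OF j])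
      have "ip (sp rep' j) (gam rep' j i x) (gam rep' j i y)
          = ip (sp \<pi> j) (rt i \<odot>\<^bsub>sp \<pi> j\<^esub> coord x j) (rt i \<odot>\<^bsub>sp \<pi> j\<^esub> coord y j)"
        using nbrs_A[OF True j] j True by (simp add: sp'_B gam'_out delta_out x y)
      also have "\<dots> = rt i * rt i * ip (sp \<pi> j) (coord x j) (coord y j)"
        using coord_hat_in[OF x j] coord_hat_in[OF y j] by (simp add: Hj.ip_smult Hj.ip_smult_right)
      finally show ?thesis by (simp only: rt_eqs(1)[OF True])
    qed
    then have "(\<Sum>j\<in>nbrs G i. ip (sp rep' j) (gam rep' j i x) (gam rep' j i y))
        = (\<Sum>j\<in>nbrs G i. complex_of_real (f i) * ip (sp \<pi> j) (coord x j) (coord y j))"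
      by (rule sum.cong[OF refl])
    then show ?thesis
      using True by (simp add: sp'_A f'_A hilbert_sum_ip sum_distrib_left)
  next
    case False
    then have iB: "i \<in> B" using vert_cases[OF i] by simp
    then have x: "x \<in> carrier (sp \<pi> i)" and y: "y \<in> carrier (sp \<pi> i)" using x y by (simp_all add: sp'_B)
    interpret Hi: finite_inner_space "sp \<pi> i" by (rule fspace[OF i])
    have "ip (sp rep' j) (gam rep' j i x) (gam rep' j i y)
        = complex_of_real (f j) * ip (sp \<pi> i) x y - ip (sp \<pi> j) (gam \<pi> j i x) (gam \<pi> j i y)"
      if j: "j \<in> nbrs G i" for j
    proof -
      have jA: "j \<in> A" and ij: "i \<in> nbrs G j" using nbrs_B[OF iB j] by (auto simp: in_nbrs_iff)
      note yj = gam_nbr_in[OF j y] and xj = gam_nbr_in[OF j x]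
      have g: "gam \<pi> i j (gam \<pi> j i y) \<in> carrier (sp \<pi> i)" by (rule gam_nbr_in[OF ij yj])
      have "ip (sp rep' j) (gam rep' j i x) (gam rep' j i y) = ip (hat j) (delta_in j i x) (delta_in j i y)"
        using jA ij by (simp add: sp'_A gam'_in)
      also have "\<dots> = ip (sp \<pi> i) x (delta_out G \<pi> f i j (delta_in j i y))"
        using delta_in_adjoint[OF jA ij] x delta_in_hat[OF jA ij y] by (simp only: is_adjoint_def)
      also have "\<dots> = rt j * (rt j * (ip (sp \<pi> i) x y - complex_of_real (1 / f j) * ip (sp \<pi> i) x (gam \<pi> i j (gam \<pi> j i y))))"
        using x y g by (simp add: delta_out[OF delta_in_hat[OF jA ij y]] coord_delta_in[OF ij y]
            Hi.ip_smult_right Hi.ip_diff_right)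
      also have "\<dots> = complex_of_real (f j) * ip (sp \<pi> i) x y - ip (sp \<pi> i) x (gam \<pi> i j (gam \<pi> j i y))"
        using rt_eqs(3)[OF jA] by (simp add: mult.assoc[symmetric] rt_eqs(1)[OF jA] right_diff_distrib)
      also have "ip (sp \<pi> i) x (gam \<pi> i j (gam \<pi> j i y)) = ip (sp \<pi> j) (gam \<pi> j i x) (gam \<pi> j i y)"
        using gam_adjoint[of j i x "gam \<pi> j i y"] ij x yj by (simp add: in_nbrs_iff)
      finally show ?thesis .
    qed
    then have "(\<Sum>j\<in>nbrs G i. ip (sp rep' j) (gam rep' j i x) (gam rep' j i y))
        = (\<Sum>j\<in>nbrs G i. complex_of_real (f j) * ip (sp \<pi> i) x y - ip (sp \<pi> j) (gam \<pi> j i x) (gam \<pi> j i y))"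
      by (rule sum.cong[OF refl])
    also have "\<dots> = (\<Sum>j\<in>nbrs G i. complex_of_real (f j)) * ip (sp \<pi> i) x y - complex_of_real (f i) * ip (sp \<pi> i) x y"
      by (simp only: sum_subtractf sum_distrib_right char_ip[OF i x y])
    also have "\<dots> = complex_of_real (- f i + (\<Sum>j\<in>nbrs G i. f j)) * ip (sp \<pi> i) x y"
      by (simp add: algebra_simps)
    also have "\<dots> = complex_of_real (f' i) * ip (sp \<pi> i) x y"
    proof (cases "hdim (sp \<pi> i) = 0")
      case True
      then have "x = \<zero>\<^bsub>sp \<pi> i\<^esub>" using Hi.hdim_zero_carrier[OF Hi.finite_dim] x by simp
      then show ?thesis using y by simp
    next
      case False
      then have "f' i = - f i + (\<Sum>j\<in>nbrs G i. f j)"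
        using i iB by (simp add: reflect_char_def X_supp_def dim_vec_def reflect_vec_def)
      then show ?thesis by simp
    qed
    finally show ?thesis using iB by (simp add: sp'_B)
  qed
qed

lemma refl_rep': "refl_rep G A B rep' f'"
proof -
  interpret R: fd_rep G A B rep' by (rule fd_rep')
  show ?thesis
    by unfold_locales (use character' pos f'_A in auto)
qed

end

section \<open>Morphisms of representations\<close>

lemma rep_homD:
  assumes "C \<in> rep_hom G \<pi> \<rho>"
  shows rep_hom_ext: "C \<in> extensional (pverts G)"
    and rep_hom_bounded: "i \<in> pverts G \<Longrightarrow> C i \<in> bounded_ops (sp \<pi> i) (sp \<rho> i)"
    and rep_hom_gam: "\<lbrakk>(j, i) \<in> parcs G; x \<in> carrier (sp \<pi> i)\<rbrakk> \<Longrightarrow> C j (gam \<pi> j i x) = gam \<rho> j i (C i x)"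
  using assms by (auto simp: rep_hom_def PiE_def)

lemma rep_homI:
  assumes "C \<in> extensional (pverts G)"
    and "\<And>i. i \<in> pverts G \<Longrightarrow> C i \<in> bounded_ops (sp \<pi> i) (sp \<rho> i)"
    and "\<And>i j x. \<lbrakk>(j, i) \<in> parcs G; x \<in> carrier (sp \<pi> i)\<rbrakk> \<Longrightarrow> C j (gam \<pi> j i x) = gam \<rho> j i (C i x)"
  shows "C \<in> rep_hom G \<pi> \<rho>"
  using assms by (auto simp: rep_hom_def PiE_def)

lemma rep_hom_in: "\<lbrakk>C \<in> rep_hom G \<pi> \<rho>; i \<in> pverts G; x \<in> carrier (sp \<pi> i)\<rbrakk> \<Longrightarrow> C i x \<in> carrier (sp \<rho> i)"
  using bounded_ops_in[OF rep_hom_bounded] .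

lemma rep_hom_eqI:
  assumes C: "C \<in> rep_hom G \<pi> \<rho>" and D: "D \<in> rep_hom G \<pi> \<rho>"
    and eq: "\<And>i x. \<lbrakk>i \<in> pverts G; x \<in> carrier (sp \<pi> i)\<rbrakk> \<Longrightarrow> C i x = D i x"
  shows "C = D"
proof (rule extensionalityI[OF rep_hom_ext[OF C] rep_hom_ext[OF D]])
  fix i assume i: "i \<in> pverts G"
  show "C i = D i"
    by (rule extensionalityI[OF bounded_ops_ext[OF rep_hom_bounded[OF C i]]
          bounded_ops_ext[OF rep_hom_bounded[OF D i]] eq[OF i]])
qed

text \<open>The identities and composites of all categories of representations, free of the dimension and the
  character.\<close>

definition rep_id :: "'v pair_pre_digraph \<Rightarrow> ('v, 'a) rep \<Rightarrow> 'v \<Rightarrow> 'a \<Rightarrow> 'a" where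
  "rep_id G \<pi> = (\<lambda>i\<in>pverts G. \<lambda>x\<in>carrier (sp \<pi> i). x)"

definition rep_comp ::
    "'v pair_pre_digraph \<Rightarrow> ('v, 'a) rep \<Rightarrow> ('v \<Rightarrow> 'a \<Rightarrow> 'a) \<Rightarrow> ('v \<Rightarrow> 'a \<Rightarrow> 'a) \<Rightarrow> 'v \<Rightarrow> 'a \<Rightarrow> 'a" where
  "rep_comp G \<pi> D C = (\<lambda>i\<in>pverts G. compose (carrier (sp \<pi> i)) (D i) (C i))"

lemma rep_id_apply: "\<lbrakk>i \<in> pverts G; x \<in> carrier (sp \<pi> i)\<rbrakk> \<Longrightarrow> rep_id G \<pi> i x = x"
  by (simp add: rep_id_def)

lemma rep_comp_apply: "\<lbrakk>i \<in> pverts G; x \<in> carrier (sp \<pi> i)\<rbrakk> \<Longrightarrow> rep_comp G \<pi> D C i x = D i (C i x)"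
  by (simp add: rep_comp_def compose_eq)

context bipartition
begin

lemma rep_id_hom:
  assumes "fd_rep G A B \<pi>"
  shows "rep_id G \<pi> \<in> rep_hom G \<pi> \<pi>"
proof -
  interpret fd_rep G A B \<pi> by fact
  show ?thesis
  proof (rule rep_homI)
    show "rep_id G \<pi> \<in> extensional (pverts G)" by (simp add: rep_id_def)
    fix i assume i: "i \<in> pverts G"
    interpret Hi: complex_inner_space "sp \<pi> i" by (rule space[OF i])
    show "rep_id G \<pi> i \<in> bounded_ops (sp \<pi> i) (sp \<pi> i)"
      by (rule bounded_opsI[OF fspace[OF i] space[OF i]])
        (simp_all add: rep_id_apply[OF i] Hi.add_in Hi.smult_in, simp add: rep_id_def i)
  next
    fix i j x assume ij: "(j, i) \<in> parcs G" and x: "x \<in> carrier (sp \<pi> i)"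
    show "rep_id G \<pi> j (gam \<pi> j i x) = gam \<pi> j i (rep_id G \<pi> i x)"
      using arc_verts[OF ij] gam_in[OF ij x] x by (simp add: rep_id_apply)
  qed
qed

lemma rep_comp_hom:
  assumes \<pi>: "fd_rep G A B \<pi>" and \<sigma>: "fd_rep G A B \<sigma>"
    and C: "C \<in> rep_hom G \<pi> \<rho>" and D: "D \<in> rep_hom G \<rho> \<sigma>"
  shows "rep_comp G \<pi> D C \<in> rep_hom G \<pi> \<sigma>"
proof (rule rep_homI)
  interpret P: fd_rep G A B \<pi> by fact
  interpret S: fd_rep G A B \<sigma> by fact
  show "rep_comp G \<pi> D C \<in> extensional (pverts G)" by (simp add: rep_comp_def)
  {
    fix i assume i: "i \<in> pverts G"
    interpret Hi: complex_inner_space "sp \<pi> i" by (rule P.space[OF i])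
    note Ci = rep_hom_bounded[OF C i] and Di = rep_hom_bounded[OF D i]
    show "rep_comp G \<pi> D C i \<in> bounded_ops (sp \<pi> i) (sp \<sigma> i)"
      by (rule bounded_opsI[OF P.fspace[OF i] S.space[OF i]])
        (simp_all add: rep_comp_apply[OF i] Hi.add_in Hi.smult_in bounded_ops_add[OF Ci] bounded_ops_add[OF Di]
          bounded_ops_smult[OF Ci] bounded_ops_smult[OF Di] bounded_ops_in[OF Ci] bounded_ops_in[OF Di],
          simp add: rep_comp_def i)
  }
  fix i j x assume ij: "(j, i) \<in> parcs G" and x: "x \<in> carrier (sp \<pi> i)"
  show "rep_comp G \<pi> D C j (gam \<pi> j i x) = gam \<sigma> j i (rep_comp G \<pi> D C i x)"
    using arc_verts[OF ij] P.gam_in[OF ij x] x rep_hom_gam[OF C ij x]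
      rep_hom_gam[OF D ij rep_hom_in[OF C arc_verts(2)[OF ij] x]]
    by (simp add: rep_comp_apply)
qed

text \<open>Taking adjoints in the equations for the operators out of \<open>A\<close> yields those for the operators into \<open>A\<close>,
  because a surjective isometry is unitary.\<close>

lemma unitary_rep_isomorphism:
  assumes \<pi>: "fd_rep G A B \<pi>" and \<rho>: "fd_rep G A B \<rho>"
    and ext: "\<theta> \<in> extensional (pverts G)"
    and bd: "\<And>i. i \<in> pverts G \<Longrightarrow> \<theta> i \<in> bounded_ops (sp \<pi> i) (sp \<rho> i)"
    and iso: "\<And>i x y. \<lbrakk>i \<in> pverts G; x \<in> carrier (sp \<pi> i); y \<in> carrier (sp \<pi> i)\<rbrakk>
      \<Longrightarrow> ip (sp \<rho> i) (\<theta> i x) (\<theta> i y) = ip (sp \<pi> i) x y"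
    and surj: "\<And>i y. \<lbrakk>i \<in> pverts G; y \<in> carrier (sp \<rho> i)\<rbrakk> \<Longrightarrow> \<exists>x\<in>carrier (sp \<pi> i). \<theta> i x = y"
    and out: "\<And>i j x. \<lbrakk>(j, i) \<in> parcs G; i \<in> A; x \<in> carrier (sp \<pi> i)\<rbrakk> \<Longrightarrow> \<theta> j (gam \<pi> j i x) = gam \<rho> j i (\<theta> i x)"
  shows "\<theta> \<in> rep_hom G \<pi> \<rho>"
    and "\<exists>\<phi>\<in>rep_hom G \<rho> \<pi>. rep_comp G \<pi> \<phi> \<theta> = rep_id G \<pi> \<and> rep_comp G \<rho> \<theta> \<phi> = rep_id G \<rho>"
proof -
  interpret P: fd_rep G A B \<pi> by fact
  interpret R: fd_rep G A B \<rho> by fact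
  have th_in: "\<theta> i x \<in> carrier (sp \<rho> i)" if "i \<in> pverts G" "x \<in> carrier (sp \<pi> i)" for i x
    using bounded_ops_in[OF bd[OF that(1)] that(2)] .
  have gam: "\<theta> j (gam \<pi> j i x) = gam \<rho> j i (\<theta> i x)"
    if ji: "(j, i) \<in> parcs G" and x: "x \<in> carrier (sp \<pi> i)" for i j x
  proof (cases "i \<in> A")
    case False
    then have jA: "j \<in> A" using arc_parity[OF ji] by simp
    have i: "i \<in> pverts G" and j: "j \<in> pverts G" using arc_verts[OF ji] by simp_all
    note g = P.gam_in[OF ji x] and g' = R.gam_in[OF ji th_in[OF i x]]
    show ?thesis
    proof (rule complex_inner_space.ip_ext[OF R.space[OF j] th_in[OF j g] g'])
      fix z assume "z \<in> carrier (sp \<rho> j)"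
      then obtain w where w: "w \<in> carrier (sp \<pi> j)" "z = \<theta> j w" using surj[OF j] by blast
      have gw: "gam \<pi> i j w \<in> carrier (sp \<pi> i)" by (rule P.gam_in[OF arc_sym[OF ji] w(1)])
      have "ip (sp \<rho> j) (gam \<rho> j i (\<theta> i x)) z = ip (sp \<rho> i) (\<theta> i x) (gam \<rho> i j (\<theta> j w))"
        unfolding w(2) by (rule R.gam_adjoint[OF ji th_in[OF i x] th_in[OF j w(1)]])
      also have "\<dots> = ip (sp \<rho> i) (\<theta> i x) (\<theta> i (gam \<pi> i j w))"
        by (simp only: out[OF arc_sym[OF ji] jA w(1)])
      also have "\<dots> = ip (sp \<pi> i) x (gam \<pi> i j w)" by (rule iso[OF i x gw])
      also have "\<dots> = ip (sp \<pi> j) (gam \<pi> j i x) w" by (rule P.gam_adjoint[OF ji x w(1), symmetric])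
      also have "\<dots> = ip (sp \<rho> j) (\<theta> j (gam \<pi> j i x)) z" unfolding w(2) by (rule iso[OF j g w(1), symmetric])
      finally show "ip (sp \<rho> j) (\<theta> j (gam \<pi> j i x)) z = ip (sp \<rho> j) (gam \<rho> j i (\<theta> i x)) z" by simp
    qed
  qed (use out ji x in simp)
  show th: "\<theta> \<in> rep_hom G \<pi> \<rho>"
    by (rule rep_homI[OF ext bd gam])
  have inj: "x = y" if i: "i \<in> pverts G" and x: "x \<in> carrier (sp \<pi> i)" and y: "y \<in> carrier (sp \<pi> i)"
    and eq: "\<theta> i x = \<theta> i y" for i x y
  proof (rule complex_inner_space.ip_ext[OF P.space[OF i] x y])
    fix z assume z: "z \<in> carrier (sp \<pi> i)"
    show "ip (sp \<pi> i) x z = ip (sp \<pi> i) y z"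
      using iso[OF i x z] iso[OF i y z] eq by simp
  qed
  define \<phi> where "\<phi> = (\<lambda>i\<in>pverts G. \<lambda>y\<in>carrier (sp \<rho> i). inv_into (carrier (sp \<pi> i)) (\<theta> i) y)"
  have phi: "\<phi> i y \<in> carrier (sp \<pi> i)" "\<theta> i (\<phi> i y) = y" if i: "i \<in> pverts G" and y: "y \<in> carrier (sp \<rho> i)" for i y
  proof -
    have "y \<in> \<theta> i ` carrier (sp \<pi> i)" using surj[OF i y] by auto
    then show "\<phi> i y \<in> carrier (sp \<pi> i)" "\<theta> i (\<phi> i y) = y"
      using i y by (simp_all add: \<phi>_def inv_into_into f_inv_into_f)
  qed
  have ph: "\<phi> \<in> rep_hom G \<rho> \<pi>"
  proof (rule rep_homI)
    show "\<phi> \<in> extensional (pverts G)" by (simp add: \<phi>_def)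
    {
      fix i assume i: "i \<in> pverts G"
      interpret Pi: complex_inner_space "sp \<pi> i" by (rule P.space[OF i])
      interpret Ri: complex_inner_space "sp \<rho> i" by (rule R.space[OF i])
      show "\<phi> i \<in> bounded_ops (sp \<rho> i) (sp \<pi> i)"
      proof (rule bounded_opsI[OF R.fspace[OF i] P.space[OF i] phi(1)[OF i]])
        show "\<phi> i \<in> extensional (carrier (sp \<rho> i))" using i by (simp add: \<phi>_def)
        show "\<phi> i (x \<oplus>\<^bsub>sp \<rho> i\<^esub> y) = \<phi> i x \<oplus>\<^bsub>sp \<pi> i\<^esub> \<phi> i y"
          if x: "x \<in> carrier (sp \<rho> i)" and y: "y \<in> carrier (sp \<rho> i)" for x y
          by (rule inj[OF i phi(1)[OF i Ri.add_in[OF x y]] Pi.add_in[OF phi(1)[OF i x] phi(1)[OF i y]]])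
            (simp only: phi(2)[OF i] Ri.add_in[OF x y] x y bounded_ops_add[OF bd[OF i] phi(1)[OF i x] phi(1)[OF i y]])
        show "\<phi> i (a \<odot>\<^bsub>sp \<rho> i\<^esub> x) = a \<odot>\<^bsub>sp \<pi> i\<^esub> \<phi> i x" if x: "x \<in> carrier (sp \<rho> i)" for a x
          by (rule inj[OF i phi(1)[OF i Ri.smult_in[OF x]] Pi.smult_in[OF phi(1)[OF i x]]])
            (simp only: phi(2)[OF i] Ri.smult_in[OF x] x bounded_ops_smult[OF bd[OF i] phi(1)[OF i x]])
      qed
    }
    fix i j y assume ji: "(j, i) \<in> parcs G" and y: "y \<in> carrier (sp \<rho> i)"
    have i: "i \<in> pverts G" and j: "j \<in> pverts G" using arc_verts[OF ji] by simp_all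
    show "\<phi> j (gam \<rho> j i y) = gam \<pi> j i (\<phi> i y)"
      by (rule inj[OF j phi(1)[OF j R.gam_in[OF ji y]] P.gam_in[OF ji phi(1)[OF i y]]])
        (simp only: phi(2)[OF j R.gam_in[OF ji y]] gam[OF ji phi(1)[OF i y]] phi(2)[OF i y])
  qed
  have "rep_comp G \<pi> \<phi> \<theta> = rep_id G \<pi>"
  proof (rule rep_hom_eqI[OF rep_comp_hom[OF \<pi> \<pi> th ph] rep_id_hom[OF \<pi>]])
    fix i x assume i: "i \<in> pverts G" and x: "x \<in> carrier (sp \<pi> i)"
    have "\<phi> i (\<theta> i x) = x"
      by (rule inj[OF i phi(1)[OF i th_in[OF i x]] x phi(2)[OF i th_in[OF i x]]])
    then show "rep_comp G \<pi> \<phi> \<theta> i x = rep_id G \<pi> i x" using i x by (simp add: rep_comp_apply rep_id_apply)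
  qed
  moreover have "rep_comp G \<rho> \<theta> \<phi> = rep_id G \<rho>"
    by (rule rep_hom_eqI[OF rep_comp_hom[OF \<rho> \<rho> ph th] rep_id_hom[OF \<rho>]])
      (simp add: rep_comp_apply rep_id_apply phi)
  ultimately show "\<exists>\<phi>\<in>rep_hom G \<rho> \<pi>. rep_comp G \<pi> \<phi> \<theta> = rep_id G \<pi> \<and> rep_comp G \<rho> \<theta> \<phi> = rep_id G \<rho>"
    using ph by blast
qed

end

section \<open>The reflected morphism\<close>

text \<open>The vector form of \<open>hat_sum_zero\<close>.\<close>

lemma (in refl_rep) hat_finsum_zero:
  assumes i: "i \<in> A" and x: "x \<in> carrier (hat i)"
  shows "finsum (sp \<pi> i) (\<lambda>j. gam \<pi> i j (coord x j)) (nbrs G i) = \<zero>\<^bsub>sp \<pi> i\<^esub>"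
proof -
  interpret Hi: complex_inner_space "sp \<pi> i" by (rule space[OF A_vert[OF i]])
  have g: "gam \<pi> i j (coord x j) \<in> carrier (sp \<pi> i)" if "j \<in> nbrs G i" for j
    by (rule gam_back_in[OF that coord_hat_in[OF x that]])
  then have s: "finsum (sp \<pi> i) (\<lambda>j. gam \<pi> i j (coord x j)) (nbrs G i) \<in> carrier (sp \<pi> i)"
    by (intro Hi.finsum_in) auto
  show ?thesis
  proof (rule Hi.ip_ext[OF s Hi.zero_in])
    fix w assume w: "w \<in> carrier (sp \<pi> i)"
    have "ip (sp \<pi> i) w (finsum (sp \<pi> i) (\<lambda>j. gam \<pi> i j (coord x j)) (nbrs G i))
        = (\<Sum>j\<in>nbrs G i. ip (sp \<pi> i) w (gam \<pi> i j (coord x j)))"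
      using g w by (intro Hi.ip_finsum_right finite_nbrs) auto
    also have "\<dots> = (\<Sum>j\<in>nbrs G i. ip (sp \<pi> j) (gam \<pi> j i w) (coord x j))"
    proof (rule sum.cong[OF refl])
      fix j assume j: "j \<in> nbrs G i"
      show "ip (sp \<pi> i) w (gam \<pi> i j (coord x j)) = ip (sp \<pi> j) (gam \<pi> j i w) (coord x j)"
        using gam_adjoint[of j i w "coord x j"] w coord_hat_in[OF x j] nbrs_A[OF i j] by simp
    qed
    also have "\<dots> = 0" by (rule hat_sum_zero[OF i x w])
    finally show "ip (sp \<pi> i) (finsum (sp \<pi> i) (\<lambda>j. gam \<pi> i j (coord x j)) (nbrs G i)) w = ip (sp \<pi> i) \<zero>\<^bsub>sp \<pi> i\<^esub> w"
      using Hi.ip_commute[OF s w] w by simp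
  qed
qed

locale refl_hom = refl_rep G A B \<pi> f + T: refl_rep G A B \<rho> f
  for G :: "'v pair_pre_digraph" and A B and \<pi> \<rho> :: "('v, ('v, 'b) hvec) rep" and f +
  fixes C
  assumes hom: "C \<in> rep_hom G \<pi> \<rho>"
begin

abbreviation C' where "C' \<equiv> reflect_hom G A (\<pi>, f) (\<rho>, f) C"

definition tuplewise where
  "tuplewise i x = Tuple (\<lambda>k\<in>nbrs G i. C k (coord x k))"

lemma coord_tuplewise: "k \<in> nbrs G i \<Longrightarrow> coord (tuplewise i x) k = C k (coord x k)"
  by (simp add: tuplewise_def)

lemma C_in: "\<lbrakk>k \<in> nbrs G i; x \<in> carrier (sp \<pi> k)\<rbrakk> \<Longrightarrow> C k x \<in> carrier (sp \<rho> k)"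
  using rep_hom_in[OF hom nbrs_verts] .

lemma tuplewise_nbr_sum: "x \<in> carrier (nbr_sum i) \<Longrightarrow> tuplewise i x \<in> carrier (T.nbr_sum i)"
  unfolding tuplewise_def by (intro Tuple_in C_in coord_nbr_in)

lemma tuplewise_hat:
  assumes i: "i \<in> A" and x: "x \<in> carrier (hat i)"
  shows "tuplewise i x \<in> carrier (T.hat i)"
proof (rule T.hatI[OF i tuplewise_nbr_sum[OF hat_in_nbr_sum[OF x]]])
  fix w assume w: "w \<in> carrier (sp \<rho> i)"
  note iv = A_vert[OF i]
  interpret Ti: complex_inner_space "sp \<rho> i" by (rule T.space[OF iv])
  note Ci = rep_hom_bounded[OF hom iv]
  have g: "gam \<pi> i j (coord x j) \<in> carrier (sp \<pi> i)" if "j \<in> nbrs G i" for j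
    by (rule gam_back_in[OF that coord_hat_in[OF x that]])
  have "ip (sp \<rho> j) (gam \<rho> j i w) (coord (tuplewise i x) j) = ip (sp \<rho> i) w (C i (gam \<pi> i j (coord x j)))"
    if j: "j \<in> nbrs G i" for j
    using T.gam_adjoint[of j i w "C j (coord x j)"] rep_hom_gam[OF hom, of i j "coord x j"]
      w coord_hat_in[OF x j] nbrs_A[OF i j] C_in[OF j] by (simp add: coord_tuplewise[OF j])
  then have "(\<Sum>j\<in>nbrs G i. ip (sp \<rho> j) (gam \<rho> j i w) (coord (tuplewise i x) j))
      = (\<Sum>j\<in>nbrs G i. ip (sp \<rho> i) w (C i (gam \<pi> i j (coord x j))))"
    by (rule sum.cong[OF refl])
  also have "\<dots> = ip (sp \<rho> i) w (finsum (sp \<rho> i) (\<lambda>j. C i (gam \<pi> i j (coord x j))) (nbrs G i))"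
    using g w bounded_ops_in[OF Ci] by (intro Ti.ip_finsum_right[symmetric] finite_nbrs) auto
  also have "finsum (sp \<rho> i) (\<lambda>j. C i (gam \<pi> i j (coord x j))) (nbrs G i)
      = C i (finsum (sp \<pi> i) (\<lambda>j. gam \<pi> i j (coord x j)) (nbrs G i))"
    by (rule bounded_ops_finsum[OF Ci space[OF iv] T.space[OF iv] finite_nbrs g, symmetric])
  also have "\<dots> = \<zero>\<^bsub>sp \<rho> i\<^esub>"
    unfolding hat_finsum_zero[OF i x] by (rule bounded_ops_zero[OF Ci space[OF iv] T.space[OF iv]])
  finally show "(\<Sum>j\<in>nbrs G i. ip (sp \<rho> j) (gam \<rho> j i w) (coord (tuplewise i x) j)) = 0"
    using w by simp
qed

text \<open>The reflected morphism acts componentwise: the compression of the direct sum of the operators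
  \<open>C j\<close> to the complements is a restriction, because the complements are the kernels of maps that
  the morphism intertwines.\<close>

lemma C'_A:
  assumes i: "i \<in> A" and x: "x \<in> carrier (hat i)"
  shows "C' i x = tuplewise i x"
proof -
  interpret TH: complex_inner_space "T.hat i" by (rule T.hat_space)
  let ?d = "\<lambda>j. T.delta_in i j (C j (delta_out G \<pi> f j i x))"
  have iv: "i \<in> pverts G" by (rule A_vert[OF i])
  have Cd: "C j (delta_out G \<pi> f j i x) \<in> carrier (sp \<rho> j)" if "j \<in> nbrs G i" for j
    by (rule C_in[OF that delta_out_in[OF x that]])
  have d: "?d j \<in> carrier (T.hat i)" if "j \<in> nbrs G i" for j
    by (rule T.delta_in_hat[OF i that Cd[OF that]])
  have eq: "C' i x = complex_of_real (1 / f i) \<odot>\<^bsub>T.hat i\<^esub> finsum (T.hat i) ?d (nbrs G i)"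
  proof -
    have "C' i x = complex_of_real (1 / f i) \<odot>\<^bsub>T.hat i\<^esub>
        finsum (T.hat i) (\<lambda>j. gam T.rep' i j (C j (gam rep' j i x))) (nbrs G i)"
      using i iv x by (simp only: reflect_hom_def Let_def restrict_apply' if_True snd_conv sp'_A T.sp'_A)
    also have "finsum (T.hat i) (\<lambda>j. gam T.rep' i j (C j (gam rep' j i x))) (nbrs G i) = finsum (T.hat i) ?d (nbrs G i)"
      using d by (intro TH.M.finsum_cong') (auto simp: gam'_out[OF i] T.gam'_in[OF i])
    finally show ?thesis .
  qed
  have sum_in: "finsum (T.hat i) ?d (nbrs G i) \<in> carrier (T.hat i)" using d by (intro TH.finsum_in) auto
  show ?thesis
    unfolding eq
  proof (rule TH.ip_ext[OF TH.smult_in[OF sum_in] tuplewise_hat[OF i x]])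
    fix z assume z: "z \<in> carrier (T.hat i)"
    have "ip (T.hat i) (?d j) z = complex_of_real (f i) * ip (sp \<rho> j) (coord (tuplewise i x) j) (coord z j)"
      if j: "j \<in> nbrs G i" for j
    proof -
      interpret Tj: complex_inner_space "sp \<rho> j" by (rule T.nbr_space[OF j])
      note Cj = rep_hom_bounded[OF hom nbrs_verts[OF j]]
      note xj = coord_hat_in[OF x j] and zj = T.coord_hat_in[OF z j]
      have "ip (T.hat i) (?d j) z = ip (sp \<rho> j) (C j (delta_out G \<pi> f j i x)) (delta_out G \<rho> f j i z)"
        using T.delta_in_adjoint[OF i j] Cd[OF j] z unfolding is_adjoint_def by blast
      also have "\<dots> = ip (sp \<rho> j) (rt i \<odot>\<^bsub>sp \<rho> j\<^esub> C j (coord x j)) (rt i \<odot>\<^bsub>sp \<rho> j\<^esub> coord z j)"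
        by (simp only: delta_out[OF x] T.delta_out[OF z] bounded_ops_smult[OF Cj xj])
      also have "\<dots> = rt i * (cnj (rt i) * ip (sp \<rho> j) (C j (coord x j)) (coord z j))"
        by (simp only: Tj.ip_smult Tj.ip_smult_right C_in[OF j xj] zj Tj.smult_in mult.left_commute)
      also have "\<dots> = (rt i * rt i) * ip (sp \<rho> j) (C j (coord x j)) (coord z j)"
        by (simp only: rt_eqs(4) mult.assoc)
      finally show ?thesis by (simp only: rt_eqs(1)[OF i] coord_tuplewise[OF j])
    qed
    then have "(\<Sum>j\<in>nbrs G i. ip (T.hat i) (?d j) z)
        = (\<Sum>j\<in>nbrs G i. complex_of_real (f i) * ip (sp \<rho> j) (coord (tuplewise i x) j) (coord z j))"
      by (rule sum.cong[OF refl])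
    also have "\<dots> = complex_of_real (f i) * ip (T.hat i) (tuplewise i x) z"
      by (simp add: hilbert_sum_ip sum_distrib_left)
    finally have s: "ip (T.hat i) (finsum (T.hat i) ?d (nbrs G i)) z = complex_of_real (f i) * ip (T.hat i) (tuplewise i x) z"
      using d z by (subst TH.ip_finsum_left) (auto simp: finite_nbrs)
    show "ip (T.hat i) (complex_of_real (1 / f i) \<odot>\<^bsub>T.hat i\<^esub> finsum (T.hat i) ?d (nbrs G i)) z
        = ip (T.hat i) (tuplewise i x) z"
      unfolding TH.ip_smult[OF sum_in z] s using rt_eqs(3)[OF i] by simp
  qed
qed

lemma C'_B: "j \<in> B \<Longrightarrow> C' j = C j"
  using B_vert B_not_A by (simp add: reflect_hom_def Let_def)

lemma C'_hom: "C' \<in> rep_hom G rep' T.rep'"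
proof (rule rep_homI)
  show "C' \<in> extensional (pverts G)" by (simp add: reflect_hom_def Let_def)
  show "C' i \<in> bounded_ops (sp rep' i) (sp T.rep' i)" if iv: "i \<in> pverts G" for i
  proof (cases "i \<in> A")
    case True
    interpret Hat: complex_inner_space "hat i" by (rule hat_space)
    interpret TH: complex_inner_space "T.hat i" by (rule T.hat_space)
    have "C' i \<in> bounded_ops (hat i) (T.hat i)"
    proof (rule bounded_opsI[OF hat_fin T.hat_space])
      show "C' i \<in> extensional (carrier (hat i))"
        using True iv by (simp add: reflect_hom_def Let_def sp'_A)
      show "C' i x \<in> carrier (T.hat i)" if "x \<in> carrier (hat i)" for x
        using C'_A[OF True that] tuplewise_hat[OF True that] by simp
      show "C' i (x \<oplus>\<^bsub>hat i\<^esub> y) = C' i x \<oplus>\<^bsub>T.hat i\<^esub> C' i y"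
        if x: "x \<in> carrier (hat i)" and y: "y \<in> carrier (hat i)" for x y
        unfolding C'_A[OF True x] C'_A[OF True y] C'_A[OF True Hat.add_in[OF x y]]
      proof (rule hilbert_sum_ext)
        fix j assume j: "j \<in> nbrs G i"
        show "coord (tuplewise i (x \<oplus>\<^bsub>hat i\<^esub> y)) j = coord (tuplewise i x \<oplus>\<^bsub>T.hat i\<^esub> tuplewise i y) j"
          using bounded_ops_add[OF rep_hom_bounded[OF hom nbrs_verts[OF j]] coord_hat_in[OF x j] coord_hat_in[OF y j]]
          by (simp add: coord_tuplewise[OF j] nbr_sum_add_coord[OF j] T.nbr_sum_add_coord[OF j])
      qed (rule T.hat_in_nbr_sum tuplewise_hat[OF True] Hat.add_in TH.add_in x y)+
      show "C' i (a \<odot>\<^bsub>hat i\<^esub> x) = a \<odot>\<^bsub>T.hat i\<^esub> C' i x" if x: "x \<in> carrier (hat i)" for a x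
        unfolding C'_A[OF True x] C'_A[OF True Hat.smult_in[OF x]]
      proof (rule hilbert_sum_ext)
        fix j assume j: "j \<in> nbrs G i"
        show "coord (tuplewise i (a \<odot>\<^bsub>hat i\<^esub> x)) j = coord (a \<odot>\<^bsub>T.hat i\<^esub> tuplewise i x) j"
          using bounded_ops_smult[OF rep_hom_bounded[OF hom nbrs_verts[OF j]] coord_hat_in[OF x j]]
          by (simp add: coord_tuplewise[OF j] nbr_sum_smult_coord[OF j] T.nbr_sum_smult_coord[OF j])
      qed (rule T.hat_in_nbr_sum tuplewise_hat[OF True] Hat.smult_in TH.smult_in x)+
    qed
    then show ?thesis by (simp only: sp'_A[OF True] T.sp'_A[OF True])
  next
    case False
    then have "i \<in> B" using vert_cases[OF iv] by simp
    then show ?thesis using rep_hom_bounded[OF hom iv] by (simp add: sp'_B T.sp'_B C'_B)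
  qed
  fix i j x assume ji: "(j, i) \<in> parcs G" and x: "x \<in> carrier (sp rep' i)"
  show "C' j (gam rep' j i x) = gam T.rep' j i (C' i x)"
  proof (cases "i \<in> A")
    case True
    then have jB: "j \<in> B" and j: "j \<in> nbrs G i" using arc_parity[OF ji] arc_sym[OF ji] by (auto simp: in_nbrs_iff)
    have x: "x \<in> carrier (hat i)" using x True by (simp add: sp'_A)
    show ?thesis
      using bounded_ops_smult[OF rep_hom_bounded[OF hom nbrs_verts[OF j]] coord_hat_in[OF x j]]
      by (simp add: gam'_out[OF True j] T.gam'_out[OF True j] C'_A[OF True x] C'_B[OF jB] delta_out[OF x]
          T.delta_out[OF tuplewise_hat[OF True x]] coord_tuplewise[OF j])
  next
    case False
    then have jA: "j \<in> A" and iB: "i \<in> B" and i: "i \<in> nbrs G j" using arc_parity[OF ji] ji by (auto simp: in_nbrs_iff)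
    have x: "x \<in> carrier (sp \<pi> i)" using x iB by (simp add: sp'_B)
    have Cx: "C i x \<in> carrier (sp \<rho> i)" by (rule C_in[OF i x])
    have "tuplewise j (delta_in j i x) = T.delta_in j i (C i x)"
    proof (rule hilbert_sum_ext[OF tuplewise_nbr_sum[OF delta_in_nbr_sum[OF i x]] T.delta_in_nbr_sum[OF i Cx]])
      fix k assume k: "k \<in> nbrs G j"
      note kj = nbrs_A[OF jA k] and kv = nbrs_verts[OF k]
      note Ck = rep_hom_bounded[OF hom kv]
      interpret Hk: complex_inner_space "sp \<pi> k" by (rule space[OF kv])
      note c = delta_in_component_in[OF i x k]
      have g: "gam \<pi> j i x \<in> carrier (sp \<pi> j)" by (rule gam_in[OF ji x])
      have "C k (if k = i then x else \<zero>\<^bsub>sp \<pi> k\<^esub>) = (if k = i then C i x else \<zero>\<^bsub>sp \<rho> k\<^esub>)"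
        using bounded_ops_zero[OF Ck space[OF kv] T.space[OF kv]] by simp
      moreover have "C k (gam \<pi> k j (gam \<pi> j i x)) = gam \<rho> k j (gam \<rho> j i (C i x))"
        using rep_hom_gam[OF hom, of k j "gam \<pi> j i x"] kj g rep_hom_gam[OF hom ji x] by simp
      ultimately show "coord (tuplewise j (delta_in j i x)) k = coord (T.delta_in j i (C i x)) k"
        unfolding coord_tuplewise[OF k] coord_delta_in[OF k x] T.coord_delta_in[OF k Cx]
          bounded_ops_smult[OF Ck Hk.diff_in[OF c]] bounded_ops_diff[OF Ck space[OF kv] T.space[OF kv] c]
          bounded_ops_smult[OF Ck gam_nbr_in[OF k g]]
        by simp
    qed
    then show ?thesis
      by (simp add: gam'_in[OF jA i] T.gam'_in[OF jA i] C'_B[OF iB] C'_A[OF jA delta_in_hat[OF jA i x]])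
  qed
qed

end

section \<open>Reflecting twice\<close>

lemma hilbert_sum_cong: "(\<And>j. j \<in> J \<Longrightarrow> H j = K j) \<Longrightarrow> hilbert_sum J H = hilbert_sum J K"
  unfolding hilbert_sum_def by (simp cong: restrict_cong PiE_cong sum.cong)

context refl_rep
begin

abbreviation rep'' where "rep'' \<equiv> reflect_rep G A (rep', f')"

lemma nbr_sum': "i \<in> A \<Longrightarrow> hilbert_sum (nbrs G i) (sp rep') = nbr_sum i"
  by (rule hilbert_sum_cong) (use nbrs_A sp'_B in blast)

text \<open>The second isometry is the inclusion of the first complement.\<close>

lemma isometry_in': "\<lbrakk>i \<in> A; w \<in> carrier (hat i)\<rbrakk> \<Longrightarrow> isometry_in G rep' f' i w = w"
proof (rule hilbert_sum_ext)
  interpret R: refl_rep G A B rep' f' by (rule refl_rep')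
  assume i: "i \<in> A" and w: "w \<in> carrier (hat i)"
  show "isometry_in G rep' f' i w \<in> carrier (nbr_sum i)"
    using R.U_in[of w i] w by (simp add: sp'_A[OF i] nbr_sum'[OF i])
  show "w \<in> carrier (nbr_sum i)" by (rule hat_in_nbr_sum[OF w])
  fix j assume j: "j \<in> nbrs G i"
  have jB: "j \<in> B" using nbrs_A[OF i j] by simp
  have "coord (isometry_in G rep' f' i w) j = (1 / rt i) \<odot>\<^bsub>sp \<pi> j\<^esub> (rt i \<odot>\<^bsub>sp \<pi> j\<^esub> coord w j)"
    using R.coord_U[OF j] by (simp only: f'_A[OF i] sp'_B[OF jB] gam'_out[OF i j] delta_out[OF w])
  also have "\<dots> = coord w j"
    using rt_eqs(2)[OF i] coord_hat_in[OF w j] complex_inner_space.smult_smult[OF nbr_space[OF j]]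
      complex_inner_space.smult_one'[OF nbr_space[OF j]] by simp
  finally show "coord (isometry_in G rep' f' i w) j = coord w j" .
qed

lemma hat''_iff:
  assumes i: "i \<in> A"
  shows "x \<in> carrier (hat_space G rep' f' i) \<longleftrightarrow>
    x \<in> carrier (nbr_sum i) \<and> (\<forall>w\<in>carrier (hat i). ip (nbr_sum i) w x = 0)"
proof -
  interpret R: refl_rep G A B rep' f' by (rule refl_rep')
  show ?thesis
    using isometry_in'[OF i] by (simp add: R.hat_iff sp'_A[OF i] nbr_sum'[OF i])
qed

lemma sp''_A: "i \<in> A \<Longrightarrow> sp rep'' i = hat_space G rep' f' i"
  using A_vert by (simp add: reflect_rep_def[of G A "(rep', f')"])

lemma sp''_B: "j \<in> B \<Longrightarrow> sp rep'' j = sp \<pi> j"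
  using B_vert B_not_A sp'_B by (simp add: reflect_rep_def[of G A "(rep', f')"])

lemma hat''_simps:
  assumes "i \<in> A"
  shows "add (hat_space G rep' f' i) = add (nbr_sum i)" "smult (hat_space G rep' f' i) = smult (nbr_sum i)"
    "ip (hat_space G rep' f' i) = ip (nbr_sum i)"
  by (simp_all add: hat_space_def nbr_sum'[OF assms])

text \<open>The double complement of the image of an isometry is the image itself; it is identified with
  the original space by the isometry.\<close>

lemma U_hat'':
  assumes i: "i \<in> A" and x: "x \<in> carrier (sp \<pi> i)"
  shows "U i x \<in> carrier (hat_space G rep' f' i)"
  unfolding hat''_iff[OF i]
proof (intro conjI ballI U_in[OF x])
  interpret K: complex_inner_space "nbr_sum i" by (rule nbr_sum_space)
  fix w assume w: "w \<in> carrier (hat i)"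
  then have "ip (nbr_sum i) (U i x) w = 0" using x by (simp add: hat_iff)
  then show "ip (nbr_sum i) w (U i x) = 0"
    using K.ip_commute[OF hat_in_nbr_sum[OF w] U_in[OF x]] by simp
qed

lemma U_surj_hat'':
  assumes i: "i \<in> A" and x: "x \<in> carrier (hat_space G rep' f' i)"
  shows "\<exists>w\<in>carrier (sp \<pi> i). U i w = x"
proof -
  interpret K: complex_inner_space "nbr_sum i" by (rule nbr_sum_space)
  interpret Hi: complex_inner_space "sp \<pi> i" by (rule space[OF A_vert[OF i]])
  have xK: "x \<in> carrier (nbr_sum i)" and orth: "\<And>w. w \<in> carrier (hat i) \<Longrightarrow> ip (nbr_sum i) w x = 0"
    using x hat''_iff[OF i] by auto
  have g: "gam \<pi> i j (coord x j) \<in> carrier (sp \<pi> i)" if "j \<in> nbrs G i" for j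
    by (rule gam_back_in[OF that coord_nbr_in[OF xK that]])
  define p where "p = finsum (sp \<pi> i) (\<lambda>j. gam \<pi> i j (coord x j)) (nbrs G i)"
  define q where "q = (1 / rt i) \<odot>\<^bsub>sp \<pi> i\<^esub> p"
  have p: "p \<in> carrier (sp \<pi> i)" unfolding p_def using g by (intro Hi.finsum_in) auto
  have q: "q \<in> carrier (sp \<pi> i)" unfolding q_def by (rule Hi.smult_in[OF p])
  define y where "y = x \<ominus>\<^bsub>nbr_sum i\<^esub> U i q"
  have yK: "y \<in> carrier (nbr_sum i)" unfolding y_def by (rule K.diff_in[OF xK U_in[OF q]])
  have "ip (nbr_sum i) (U i w) y = 0" if w: "w \<in> carrier (sp \<pi> i)" for w
  proof -
    have "ip (sp \<pi> i) w p = (\<Sum>j\<in>nbrs G i. ip (sp \<pi> i) w (gam \<pi> i j (coord x j)))"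
      unfolding p_def using g w by (intro Hi.ip_finsum_right finite_nbrs) auto
    also have "\<dots> = (\<Sum>j\<in>nbrs G i. ip (sp \<pi> j) (gam \<pi> j i w) (coord x j))"
    proof (rule sum.cong[OF refl])
      fix j assume j: "j \<in> nbrs G i"
      show "ip (sp \<pi> i) w (gam \<pi> i j (coord x j)) = ip (sp \<pi> j) (gam \<pi> j i w) (coord x j)"
        using gam_adjoint[of j i w "coord x j"] w coord_nbr_in[OF xK j] nbrs_A[OF i j] by simp
    qed
    finally have "ip (nbr_sum i) (U i w) x = 1 / rt i * ip (sp \<pi> i) w p"
      using ip_U[OF w xK] by simp
    moreover have "ip (sp \<pi> i) w q = 1 / rt i * ip (sp \<pi> i) w p"
      unfolding q_def by (simp add: Hi.ip_smult_right w p)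
    ultimately show ?thesis
      unfolding y_def K.ip_diff_right[OF xK U_in[OF q] U_in[OF w]] by (simp add: ip_U_U[OF i w q])
  qed
  then have y: "y \<in> carrier (hat i)" using yK by (simp add: hat_iff)
  have "ip (nbr_sum i) y (U i q) = 0"
    using U_hat''[OF i q] y by (simp add: hat''_iff[OF i])
  then have "ip (nbr_sum i) y y = 0"
    using orth[OF y] K.ip_diff_right[OF xK U_in[OF q] yK] by (simp add: y_def[symmetric])
  then have "x \<ominus>\<^bsub>nbr_sum i\<^esub> U i q = \<zero>\<^bsub>nbr_sum i\<^esub>"
    using K.ip_definite[OF yK] by (simp add: y_def)
  then have "x = U i q" using xK U_in[OF q] by simp
  then show ?thesis using q by blast
qed

text \<open>The component at \<open>\<pi>\<close> of the isomorphism from the identity to the square of the reflection functor.\<close>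

definition square_unit where
  "square_unit = (\<lambda>i\<in>pverts G. \<lambda>x\<in>carrier (sp \<pi> i). if i \<in> A then U i x else x)"

lemma square_unit_A: "\<lbrakk>i \<in> A; x \<in> carrier (sp \<pi> i)\<rbrakk> \<Longrightarrow> square_unit i x = U i x"
  and square_unit_B: "\<lbrakk>i \<in> B; x \<in> carrier (sp \<pi> i)\<rbrakk> \<Longrightarrow> square_unit i x = x"
  using A_vert B_vert B_not_A by (auto simp: square_unit_def)

lemma square_unit_isomorphism:
  shows "square_unit \<in> rep_hom G \<pi> rep''"
    and "\<exists>\<phi>\<in>rep_hom G rep'' \<pi>. rep_comp G \<pi> \<phi> square_unit = rep_id G \<pi>
      \<and> rep_comp G rep'' square_unit \<phi> = rep_id G rep''"
proof -
  interpret R: refl_rep G A B rep' f' by (rule refl_rep')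
  have 1: "square_unit i \<in> bounded_ops (sp \<pi> i) (sp rep'' i)" if i: "i \<in> pverts G" for i
  proof -
    interpret Hi: complex_inner_space "sp \<pi> i" by (rule space[OF i])
    have ext: "square_unit i \<in> extensional (carrier (sp \<pi> i))" using i by (simp add: square_unit_def)
    show ?thesis
    proof (cases "i \<in> A")
      case True
      have "square_unit i \<in> bounded_ops (sp \<pi> i) (hat_space G rep' f' i)"
        by (rule bounded_opsI[OF fspace[OF i] R.hat_space _ _ _ ext])
          (simp_all only: square_unit_A[OF True] U_hat''[OF True] U_add[OF i] U_smult[OF i]
            hat''_simps[OF True] Hi.add_in Hi.smult_in)
      then show ?thesis by (simp only: sp''_A[OF True])
    next
      case False
      then have iB: "i \<in> B" using vert_cases[OF i] by simp
      have "square_unit i \<in> bounded_ops (sp \<pi> i) (sp \<pi> i)"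
        by (rule bounded_opsI[OF fspace[OF i] space[OF i] _ _ _ ext])
          (simp_all only: square_unit_B[OF iB] Hi.add_in Hi.smult_in)
      then show ?thesis by (simp only: sp''_B[OF iB])
    qed
  qed
  have 2: "ip (sp rep'' i) (square_unit i x) (square_unit i y) = ip (sp \<pi> i) x y"
    if i: "i \<in> pverts G" and x: "x \<in> carrier (sp \<pi> i)" and y: "y \<in> carrier (sp \<pi> i)" for i x y
  proof (cases "i \<in> A")
    case True
    show ?thesis
      by (simp only: square_unit_A[OF True] sp''_A[OF True] hat''_simps[OF True] ip_U_U[OF True] x y)
  next
    case False
    then have iB: "i \<in> B" using vert_cases[OF i] by simp
    show ?thesis by (simp only: square_unit_B[OF iB] sp''_B[OF iB] x y)
  qed
  have 3: "\<exists>x\<in>carrier (sp \<pi> i). square_unit i x = y"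
    if i: "i \<in> pverts G" and y: "y \<in> carrier (sp rep'' i)" for i y
  proof (cases "i \<in> A")
    case True
    then show ?thesis using U_surj_hat''[OF True, of y] y square_unit_A[OF True] by (auto simp: sp''_A)
  next
    case False
    then have iB: "i \<in> B" using vert_cases[OF i] by simp
    then show ?thesis using y square_unit_B[OF iB] by (auto simp: sp''_B)
  qed
  have 4: "square_unit j (gam \<pi> j i x) = gam rep'' j i (square_unit i x)"
    if ji: "(j, i) \<in> parcs G" and i: "i \<in> A" and x: "x \<in> carrier (sp \<pi> i)" for i j x
  proof -
    have jB: "j \<in> B" and j: "j \<in> nbrs G i" using arc_parity[OF ji] arc_sym[OF ji] i by (auto simp: in_nbrs_iff)
    have "gam rep'' j i (square_unit i x) = rt i \<odot>\<^bsub>sp \<pi> j\<^esub> ((1 / rt i) \<odot>\<^bsub>sp \<pi> j\<^esub> gam \<pi> j i x)"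
      using R.gam'_out[OF i j] R.delta_out[OF U_hat''[OF i x]]
      by (simp only: square_unit_A[OF i x] f'_A[OF i] sp'_B[OF jB] coord_U[OF j])
    also have "\<dots> = gam \<pi> j i x"
      using rt_eqs(2)[OF i] gam_in[OF ji x] complex_inner_space.smult_smult[OF nbr_space[OF j]]
        complex_inner_space.smult_one'[OF nbr_space[OF j]] by simp
    finally show ?thesis using square_unit_B[OF jB gam_in[OF ji x]] by simp
  qed
  have "square_unit \<in> extensional (pverts G)" by (simp add: square_unit_def)
  note iso = unitary_rep_isomorphism[OF fd_rep_axioms R.fd_rep' this 1 2 3 4]
  show "square_unit \<in> rep_hom G \<pi> rep''" by (rule iso(1))
  show "\<exists>\<phi>\<in>rep_hom G rep'' \<pi>. rep_comp G \<pi> \<phi> square_unit = rep_id G \<pi>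
      \<and> rep_comp G rep'' square_unit \<phi> = rep_id G rep''" by (rule iso(2))
qed

end

text \<open>At \<open>i\<close> in \<open>A\<close>, the twice reflected morphism acts componentwise on the values of \<open>U i\<close>, whose components are
  multiples of the operators that the morphism intertwines.\<close>

lemma (in refl_hom) square_unit_natural:
  assumes dim: "dim_vec G \<rho> = dim_vec G \<pi>"
  shows "rep_comp G \<pi> T.square_unit C
    = rep_comp G \<pi> (reflect_hom G A (rep', f') (T.rep', T.f') C') square_unit"
proof -
  have f': "T.f' = f'" by (simp only: dim)
  interpret R: refl_rep G A B rep' f' by (rule refl_rep')
  interpret TR: refl_rep G A B T.rep' f' using T.refl_rep' by (simp only: f')
  interpret RH: refl_hom G A B rep' T.rep' f' C' by unfold_locales (rule C'_hom)
  let ?sq = "reflect_hom G A (rep', f') (T.rep', f') C'"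
  have hom1: "rep_comp G \<pi> T.square_unit C \<in> rep_hom G \<pi> TR.rep'"
    using rep_comp_hom[OF fd_rep_axioms TR.fd_rep' hom] T.square_unit_isomorphism(1) by (simp only: f')
  have hom2: "rep_comp G \<pi> ?sq square_unit \<in> rep_hom G \<pi> TR.rep'"
    by (rule rep_comp_hom[OF fd_rep_axioms TR.fd_rep' square_unit_isomorphism(1) RH.C'_hom])
  have "rep_comp G \<pi> T.square_unit C = rep_comp G \<pi> ?sq square_unit"
  proof (rule rep_hom_eqI[OF hom1 hom2])
    fix i x assume i: "i \<in> pverts G" and x: "x \<in> carrier (sp \<pi> i)"
    note Cx = rep_hom_in[OF hom i x]
    have "T.square_unit i (C i x) = ?sq i (square_unit i x)"
    proof (cases "i \<in> A")
      case True
      have "?sq i (U i x) = Tuple (\<lambda>k\<in>nbrs G i. C' k (coord (U i x) k))"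
        using RH.C'_A[OF True U_hat''[OF True x]] by (simp only: RH.tuplewise_def)
      also have "\<dots> = T.U i (C i x)"
        unfolding isometry_in_def[of G \<rho>]
      proof (intro arg_cong[where f = Tuple] restrict_ext)
        fix k assume k: "k \<in> nbrs G i"
        have kB: "k \<in> B" and ki: "(k, i) \<in> parcs G" using nbrs_A[OF True k] by simp_all
        show "C' k (coord (U i x) k) = complex_of_real (1 / sqrt (f i)) \<odot>\<^bsub>sp \<rho> k\<^esub> gam \<rho> k i (C i x)"
          by (simp only: C'_B[OF kB] coord_U[OF k] rt_eqs(5) rep_hom_gam[OF hom ki x]
              bounded_ops_smult[OF rep_hom_bounded[OF hom nbrs_verts[OF k]] gam_in[OF ki x]])
      qed
      finally show ?thesis by (simp only: square_unit_A[OF True x] T.square_unit_A[OF True Cx])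
    next
      case False
      then have iB: "i \<in> B" using vert_cases[OF i] by simp
      show ?thesis
        by (simp only: square_unit_B[OF iB x] T.square_unit_B[OF iB Cx] RH.C'_B[OF iB] C'_B[OF iB])
    qed
    then show "rep_comp G \<pi> T.square_unit C i x = rep_comp G \<pi> ?sq square_unit i x"
      using i x by (simp add: rep_comp_apply)
  qed
  then show ?thesis by (simp only: f')
qed

section \<open>Dimensions and characters\<close>

context bipartition
begin

lemma reflect_vec_not_A: "i \<in> B \<Longrightarrow> reflect_vec G A x i = x i"
  using B_vert B_not_A by (simp add: reflect_vec_def)

lemma reflect_vec_twice:
  assumes "x \<in> VG G"
  shows "reflect_vec G A (reflect_vec G A x) = x"
proof (rule extensionalityI)
  show "reflect_vec G A (reflect_vec G A x) \<in> extensional (pverts G)" by (simp add: reflect_vec_def)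
  show "x \<in> extensional (pverts G)" using assms by (simp add: VG_def)
  fix i assume i: "i \<in> pverts G"
  show "reflect_vec G A (reflect_vec G A x) i = x i"
  proof (cases "i \<in> A")
    case True
    have "(\<Sum>j\<in>nbrs G i. reflect_vec G A x j) = (\<Sum>j\<in>nbrs G i. x j)"
      using nbrs_A[OF True] by (intro sum.cong refl reflect_vec_not_A) blast
    then have "reflect_vec G A (reflect_vec G A x) i = - reflect_vec G A x i + (\<Sum>j\<in>nbrs G i. x j)"
      using True i by (subst reflect_vec_def) simp
    also have "\<dots> = x i" using True i by (simp add: reflect_vec_def)
    finally show ?thesis .
  next
    case False
    then have "i \<in> B" using vert_cases[OF i] by simp
    then show ?thesis by (simp add: reflect_vec_not_A)
  qed
qed

lemma reflect_char_A: "i \<in> A \<Longrightarrow> reflect_char G B d f i = f i"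
  using A_vert B_not_A by (auto simp: reflect_char_def)

lemma reflect_char_B:
  "i \<in> B \<Longrightarrow> reflect_char G B d f i = (if d i = 0 then f i else - f i + (\<Sum>j\<in>nbrs G i. f j))"
  using B_vert by (simp add: reflect_char_def X_supp_def reflect_vec_def)

lemma reflect_char_twice:
  assumes "f \<in> VG G"
  shows "reflect_char G B (reflect_vec G A d) (reflect_char G B d f) = f"
proof (rule extensionalityI)
  show "reflect_char G B (reflect_vec G A d) (reflect_char G B d f) \<in> extensional (pverts G)"
    by (simp add: reflect_char_def)
  show "f \<in> extensional (pverts G)" using assms by (simp add: VG_def)
  fix i assume i: "i \<in> pverts G"
  show "reflect_char G B (reflect_vec G A d) (reflect_char G B d f) i = f i"
  proof (cases "i \<in> A")
    case False
    then have iB: "i \<in> B" using vert_cases[OF i] by simp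
    have "(\<Sum>j\<in>nbrs G i. reflect_char G B d f j) = (\<Sum>j\<in>nbrs G i. f j)"
      using nbrs_B[OF iB] by (intro sum.cong refl reflect_char_A) blast
    then show ?thesis by (simp add: reflect_char_B[OF iB] reflect_vec_not_A[OF iB])
  qed (simp add: reflect_char_A)
qed

text \<open>The reflected pair may violate positivity, but not if it belongs to a representation: then the
  dimension is a nonnegative integer, the character is nonnegative wherever the dimension is not zero,
  and elsewhere it has its old value. The dimension does not vanish identically, because
  reflecting back yields the nonzero \<open>d\<close>. The character does not either: on \<open>A\<close> it is \<open>f\<close>, hence
  positive, and if \<open>A\<close> is empty, a positive value of \<open>f\<close> can only change into a negative one.\<close>

lemma S_parity_reflect:
  assumes S: "(d, f) \<in> S_parity G A"
    and rep: "char_rep G A B \<rho> (reflect_char G B d f)" and dim: "dim_vec G \<rho> = reflect_vec G A d"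
  shows "(reflect_vec G A d, reflect_char G B d f) \<in> S_parity G A"
proof -
  interpret R: char_rep G A B \<rho> "reflect_char G B d f" by (rule rep)
  let ?d = "reflect_vec G A d" and ?f = "reflect_char G B d f"
  have d: "d \<in> VG G" "\<exists>i\<in>pverts G. d i \<noteq> 0" "\<And>i. i \<in> pverts G \<Longrightarrow> 0 \<le> d i"
    and f: "f \<in> VG G" "\<exists>i\<in>pverts G. f i \<noteq> 0" "\<And>i. i \<in> pverts G \<Longrightarrow> 0 \<le> f i"
    and df: "\<And>i. i \<in> pverts G \<Longrightarrow> 0 < d i + f i" "\<And>i. \<lbrakk>i \<in> A; i \<in> pverts G; d i \<noteq> 0\<rbrakk> \<Longrightarrow> 0 < f i"
    using S by (auto simp: S_parity_def S_pairs_def ZG_plus_def VG_plus_def X_supp_def)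
  have fA: "0 < f i" if i: "i \<in> A" for i
    using df(1)[OF A_vert[OF i]] df(2)[OF i A_vert[OF i]] by (cases "d i = 0") auto
  have d': "?d i = real (hdim (sp \<rho> i))" if "i \<in> pverts G" for i
    using fun_cong[OF dim, of i] that by (simp add: dim_vec_def)
  have fB: "0 \<le> ?f i" "d i = 0 \<Longrightarrow> ?f i = f i" if i: "i \<in> B" for i
  proof -
    show "d i = 0 \<Longrightarrow> ?f i = f i" using i by (simp add: reflect_char_B)
    then show "0 \<le> ?f i"
      using f(3)[OF B_vert[OF i]] R.char_nonneg[OF B_vert[OF i]] d'[OF B_vert[OF i]]
        reflect_vec_not_A[OF i, of d] by (cases "d i = 0") auto
  qed
  have "?d \<in> ZG_plus G"
  proof -
    have "\<exists>i\<in>pverts G. ?d i \<noteq> 0"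
    proof (rule ccontr)
      assume "\<not> (\<exists>i\<in>pverts G. ?d i \<noteq> 0)"
      then have 0: "?d i = 0" if "i \<in> pverts G" for i using that by blast
      then have "reflect_vec G A ?d i = 0" if "i \<in> pverts G" for i
        using that nbrs_verts by (subst reflect_vec_def) auto
      then show False using d(2) by (simp add: reflect_vec_twice[OF d(1)])
    qed
    then show ?thesis
      using d' by (auto simp: ZG_plus_def VG_plus_def VG_def reflect_vec_def[of G A d])
  qed
  moreover have "?f \<in> VG_plus G"
  proof -
    obtain i where i: "i \<in> pverts G" "f i \<noteq> 0" using f(2) by blast
    have "\<exists>i\<in>pverts G. ?f i \<noteq> 0"
    proof (cases "i \<in> A \<or> d i = 0")
      case True
      then have "?f i = f i" using vert_cases[OF i(1)] fB(2) by (auto simp: reflect_char_A)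
      then show ?thesis using i by (intro bexI[of _ i]) simp_all
    next
      case False
      then have iB: "i \<in> B" using vert_cases[OF i(1)] by simp
      \<comment> \<open>Without neighbours, the reflected value at \<open>i\<close> would be \<open>- f i < 0\<close>.\<close>
      have "nbrs G i \<noteq> {}"
        using fB(1)[OF iB] f(3)[OF i(1)] i(2) False by (auto simp: reflect_char_B[OF iB])
      then obtain j where "j \<in> nbrs G i" by blast
      then have j: "j \<in> A" using nbrs_B[OF iB] by blast
      then have "?f j \<noteq> 0" using fA[OF j] by (simp add: reflect_char_A)
      then show ?thesis using A_vert[OF j] by blast
    qed
    moreover have "0 \<le> ?f i" if "i \<in> pverts G" for i
      using vert_cases[OF that] fB(1) fA by (auto simp: reflect_char_A less_imp_le)
    ultimately show ?thesis by (simp add: VG_plus_def R.f_VG)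
  qed
  moreover have "0 < ?d i + ?f i" if i: "i \<in> pverts G" for i
  proof (cases "i \<in> A")
    case True
    then show ?thesis using fA[OF True] d'[OF i] by (simp add: reflect_char_A)
  next
    case False
    then have iB: "i \<in> B" using vert_cases[OF i] by simp
    show ?thesis
      using fB[OF iB] df(1)[OF i] d(3)[OF i] reflect_vec_not_A[OF iB, of d] by (cases "d i = 0") auto
  qed
  moreover have "0 < ?f i" if "i \<in> A" for i
    using fA[OF that] by (simp add: reflect_char_A[OF that])
  ultimately show ?thesis by (auto simp: S_parity_def S_pairs_def)
qed

section \<open>The categories of representations\<close>

lemma char_rep_iff:
  "char_rep G A B \<pi> f \<longleftrightarrow> is_rep G \<pi> \<and> finite_dimensional_rep G \<pi> \<and> is_character G \<pi> f"
  by (simp add: char_rep_def char_rep_axioms_def fd_rep_def fd_rep_axioms_def bipartition_axioms)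

lemma Obj_Rep:
  "X \<in> Obj (Rep G d f) \<longleftrightarrow> char_rep G A B (fst X) (snd X) \<and> dim_vec G (fst X) = d \<and> snd X = f"
proof -
  have "locally_scalar G (fst X)" if "char_rep G A B (fst X) (snd X)"
  proof -
    interpret char_rep G A B "fst X" "snd X" by (rule that)
    show ?thesis using locally_scalar[OF char] .
  qed
  then show ?thesis
    unfolding Rep_def by (cases X) (auto simp: char_rep_iff)
qed

lemma Obj_Rep_parity:
  "X \<in> Obj (Rep_parity G A d f) \<longleftrightarrow> char_rep G A B (fst X) (snd X) \<and> dim_vec G (fst X) = d \<and> snd X = f
    \<and> (\<forall>i\<in>X_supp G d \<inter> A. 0 < f i)"
proof -
  have "X \<in> Obj (Rep_parity G A d f) \<longleftrightarrow> X \<in> Obj (Rep G d f) \<and> (\<forall>i\<in>X_supp G d \<inter> A. 0 < snd X i)"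
    by (simp add: Rep_parity_def full_sub_def)
  then show ?thesis unfolding Obj_Rep by auto
qed

lemma Obj_coprod:
  "X \<in> Obj (Rep_coprod_parity G A) \<longleftrightarrow>
    char_rep G A B (fst X) (snd X) \<and> (dim_vec G (fst X), snd X) \<in> S_parity G A"
proof -
  have "X \<in> Obj (Rep_coprod_parity G A) \<longleftrightarrow>
      (\<exists>(d, f)\<in>S_pairs G. X \<in> Obj (Rep G d f)) \<and> (dim_vec G (fst X), snd X) \<in> S_parity G A"
    by (auto simp: Rep_coprod_parity_def full_sub_def Rep_coprod_def)
  then show ?thesis unfolding Obj_Rep by (auto simp: S_parity_def)
qed

lemma Hom_coprod:
  assumes "X \<in> Obj (Rep_coprod_parity G A)" "Y \<in> Obj (Rep_coprod_parity G A)"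
  shows "h \<in> Hom (Rep_coprod_parity G A) X Y \<longleftrightarrow>
    dim_vec G (fst X) = dim_vec G (fst Y) \<and> snd X = snd Y \<and> h \<in> rep_hom G (fst X) (fst Y)"
proof -
  have hom: "Hom (Rep G d f) X Y = rep_hom G (fst X) (fst Y)" for d f by (simp add: Rep_def)
  have "h \<in> Hom (Rep_coprod_parity G A) X Y \<longleftrightarrow>
      (\<exists>(d, f)\<in>S_pairs G. X \<in> Obj (Rep G d f) \<and> Y \<in> Obj (Rep G d f) \<and> h \<in> rep_hom G (fst X) (fst Y))"
    by (simp add: Rep_coprod_parity_def full_sub_def Rep_coprod_def hom)
  then show ?thesis
    using assms unfolding Obj_Rep Obj_coprod by (auto simp: S_parity_def)
qed

lemma Ident_coprod: "Ident (Rep_coprod_parity G A) X = rep_id G (fst X)"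
  by (simp add: Rep_coprod_parity_def full_sub_def Rep_coprod_def Rep_def rep_id_def)

lemma Comp_coprod: "Comp (Rep_coprod_parity G A) X Y Z D C = rep_comp G (fst X) D C"
  by (simp add: Rep_coprod_parity_def full_sub_def Rep_coprod_def Rep_def rep_comp_def)

lemma coprod_fd: "X \<in> Obj (Rep_coprod_parity G A) \<Longrightarrow> fd_rep G A B (fst X)"
  by (simp add: Obj_coprod char_rep_def)

lemma coprod_category: "is_category (Rep_coprod_parity G A :: ('v, 'a) rep_cat)"
  (is "is_category ?C")
  unfolding is_category_def
proof (intro conjI ballI)
  show "Ident ?C X \<in> Hom ?C X X" if X: "X \<in> Obj ?C" for X
    using rep_id_hom[OF coprod_fd[OF X]] by (simp add: Hom_coprod[OF X X] Ident_coprod)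
  show "Comp ?C X Y Z g h \<in> Hom ?C X Z"
    if X: "X \<in> Obj ?C" and Y: "Y \<in> Obj ?C" and Z: "Z \<in> Obj ?C" and h: "h \<in> Hom ?C X Y" and g: "g \<in> Hom ?C Y Z"
    for X Y Z h g
    using h g rep_comp_hom[OF coprod_fd[OF X] coprod_fd[OF Z], of h "fst Y" g]
    by (simp add: Hom_coprod X Y Z Comp_coprod)
  show "Comp ?C X X Y h (Ident ?C X) = h" "Comp ?C X Y Y (Ident ?C Y) h = h"
    if X: "X \<in> Obj ?C" and Y: "Y \<in> Obj ?C" and h: "h \<in> Hom ?C X Y" for X Y h
  proof -
    have h: "h \<in> rep_hom G (fst X) (fst Y)" using h by (simp add: Hom_coprod X Y)
    note fX = coprod_fd[OF X] and fY = coprod_fd[OF Y]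
    show "Comp ?C X X Y h (Ident ?C X) = h"
      unfolding Comp_coprod Ident_coprod
      by (rule rep_hom_eqI[OF rep_comp_hom[OF fX fY rep_id_hom[OF fX] h] h])
        (simp add: rep_comp_apply rep_id_apply)
    show "Comp ?C X Y Y (Ident ?C Y) h = h"
      unfolding Comp_coprod Ident_coprod
      by (rule rep_hom_eqI[OF rep_comp_hom[OF fX fY h rep_id_hom[OF fY]] h])
        (simp add: rep_comp_apply rep_id_apply rep_hom_in[OF h])
  qed
  show "Comp ?C W Y Z k (Comp ?C W X Y g h) = Comp ?C W X Z (Comp ?C X Y Z k g) h"
    if W: "W \<in> Obj ?C" and X: "X \<in> Obj ?C" and Y: "Y \<in> Obj ?C" and Z: "Z \<in> Obj ?C"
      and h: "h \<in> Hom ?C W X" and g: "g \<in> Hom ?C X Y" and k: "k \<in> Hom ?C Y Z"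
    for W X Y Z h g k
  proof -
    have h: "h \<in> rep_hom G (fst W) (fst X)" and g: "g \<in> rep_hom G (fst X) (fst Y)"
      and k: "k \<in> rep_hom G (fst Y) (fst Z)"
      using h g k by (simp_all add: Hom_coprod W X Y Z)
    note fd = coprod_fd[OF W] coprod_fd[OF X] coprod_fd[OF Y] coprod_fd[OF Z]
    show ?thesis
      unfolding Comp_coprod
      by (rule rep_hom_eqI[OF rep_comp_hom[OF fd(1,4) rep_comp_hom[OF fd(1,3) h g] k]
            rep_comp_hom[OF fd(1,4) h rep_comp_hom[OF fd(2,4) g k]]])
        (simp add: rep_comp_apply rep_hom_in[OF h])
  qed
qed

text \<open>The hypothesis is vacuous if the category has no objects, as can happen for the reflection of an
  admissible pair.\<close>

lemma full_subcategory_Rep_parity: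
  assumes "\<And>X :: ('v, 'a) rep_obj. X \<in> Obj (Rep_parity G A d f) \<Longrightarrow> (d, f) \<in> S_parity G A"
  shows "is_full_subcategory (Rep_parity G A d f) (Rep_coprod_parity G A :: ('v, 'a) rep_cat)"
    (is "is_full_subcategory ?D ?C")
proof -
  have obj: "X \<in> Obj ?C" if "X \<in> Obj ?D" for X
    using that assms[OF that] by (auto simp: Obj_Rep_parity Obj_coprod)
  have hom: "Hom ?D X Y = Hom ?C X Y" if X: "X \<in> Obj ?D" and Y: "Y \<in> Obj ?D" for X Y
  proof -
    have "Hom ?D X Y = rep_hom G (fst X) (fst Y)" by (simp add: Rep_parity_def full_sub_def Rep_def)
    then show ?thesis
      using X Y by (auto simp: Hom_coprod[OF obj[OF X] obj[OF Y]] Obj_Rep_parity)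
  qed
  show ?thesis
    unfolding is_full_subcategory_def
    using obj hom by (auto simp: Ident_coprod Comp_coprod rep_id_def rep_comp_def
        Rep_parity_def full_sub_def Rep_def)
qed

section \<open>The reflection functor is an involution up to isomorphism\<close>

lemma coprod_refl_rep:
  assumes X: "X \<in> Obj (Rep_coprod_parity G A)"
  shows "refl_rep G A B (fst X) (snd X)"
proof -
  interpret char_rep G A B "fst X" "snd X" using X by (simp add: Obj_coprod)
  have "0 < snd X i" if i: "i \<in> A" for i
  proof -
    have "0 < dim_vec G (fst X) i + snd X i" "dim_vec G (fst X) i \<noteq> 0 \<Longrightarrow> 0 < snd X i"
      using X A_vert[OF i] i by (auto simp: Obj_coprod S_parity_def S_pairs_def X_supp_def)
    then show ?thesis by (cases "dim_vec G (fst X) i = 0") auto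
  qed
  then show ?thesis by unfold_locales
qed

lemma coprod_refl_hom:
  assumes X: "X \<in> Obj (Rep_coprod_parity G A)" and Y: "Y \<in> Obj (Rep_coprod_parity G A)"
    and h: "h \<in> Hom (Rep_coprod_parity G A) X Y"
  shows "refl_hom G A B (fst X) (fst Y) (snd X) h"
proof -
  have h: "snd Y = snd X" "h \<in> rep_hom G (fst X) (fst Y)" using h by (simp_all add: Hom_coprod[OF X Y])
  interpret refl_rep G A B "fst X" "snd X" by (rule coprod_refl_rep[OF X])
  interpret T: refl_rep G A B "fst Y" "snd X" using coprod_refl_rep[OF Y] by (simp only: h(1))
  show ?thesis by unfold_locales (rule h(2))
qed

lemma omap_reflection: "omap (reflection_functor G A B) X
    = (reflect_rep G A X, reflect_char G B (dim_vec G (fst X)) (snd X))"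
  by (simp add: reflection_functor_def)

lemma amap_reflection: "amap (reflection_functor G A B) = reflect_hom G A"
  by (simp add: reflection_functor_def)

lemma reflection_Obj:
  assumes X: "X \<in> Obj (Rep_coprod_parity G A)"
  shows "omap (reflection_functor G A B) X \<in> Obj (Rep_coprod_parity G A)"
    and "dim_vec G (fst (omap (reflection_functor G A B) X)) = reflect_vec G A (dim_vec G (fst X))"
proof -
  interpret refl_rep G A B "fst X" "snd X" by (rule coprod_refl_rep[OF X])
  interpret R: refl_rep G A B rep' f' by (rule refl_rep')
  show "dim_vec G (fst (omap (reflection_functor G A B) X)) = reflect_vec G A (dim_vec G (fst X))"
    using dim_vec' by (simp add: omap_reflection)
  have "(reflect_vec G A (dim_vec G (fst X)), f') \<in> S_parity G A"
    using X by (intro S_parity_reflect[OF _ R.char_rep_axioms dim_vec']) (simp add: Obj_coprod)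
  then show "omap (reflection_functor G A B) X \<in> Obj (Rep_coprod_parity G A)"
    using R.char_rep_axioms dim_vec' by (simp add: Obj_coprod omap_reflection)
qed

lemma reflection_Hom:
  assumes X: "X \<in> Obj (Rep_coprod_parity G A)" and Y: "Y \<in> Obj (Rep_coprod_parity G A)"
    and h: "h \<in> Hom (Rep_coprod_parity G A) X Y"
  shows "reflect_hom G A X Y h \<in> rep_hom G (reflect_rep G A X) (reflect_rep G A Y)"
proof -
  interpret refl_hom G A B "fst X" "fst Y" "snd X" h by (rule coprod_refl_hom[OF X Y h])
  have "snd Y = snd X" using h by (simp add: Hom_coprod[OF X Y])
  then show ?thesis using C'_hom by (cases X, cases Y) simp
qed

lemma reflection_is_functor:
  "is_functor (Rep_coprod_parity G A) (Rep_coprod_parity G A) (reflection_functor G A B)"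
  (is "is_functor ?C _ ?F")
  unfolding is_functor_def
proof (intro conjI ballI coprod_category reflection_Obj(1))
  show hom: "amap ?F X Y h \<in> Hom ?C (omap ?F X) (omap ?F Y)"
    if X: "X \<in> Obj ?C" and Y: "Y \<in> Obj ?C" and h: "h \<in> Hom ?C X Y" for X Y h
    using reflection_Hom[OF X Y h] reflection_Obj(2)[OF X] reflection_Obj(2)[OF Y] h
    unfolding Hom_coprod[OF reflection_Obj(1)[OF X] reflection_Obj(1)[OF Y]] Hom_coprod[OF X Y]
    by (simp add: amap_reflection omap_reflection)
  show "amap ?F X X (Ident ?C X) = Ident ?C (omap ?F X)" if X: "X \<in> Obj ?C" for X
  proof -
    have id: "Ident ?C X \<in> Hom ?C X X" by (rule category_id(3)[OF coprod_category X])
    interpret refl_hom G A B "fst X" "fst X" "snd X" "Ident ?C X" by (rule coprod_refl_hom[OF X X id])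
    interpret R: refl_rep G A B rep' f' by (rule refl_rep')
    have "C' = rep_id G rep'"
    proof (rule rep_hom_eqI[OF C'_hom rep_id_hom[OF R.fd_rep_axioms]])
      fix i x assume i: "i \<in> pverts G" and x: "x \<in> carrier (sp rep' i)"
      show "C' i x = rep_id G rep' i x"
      proof (cases "i \<in> A")
        case True
        then have xh: "x \<in> carrier (hat i)" using x by (simp only: sp'_A)
        have "C' i x = Tuple (\<lambda>k\<in>nbrs G i. coord x k)"
          unfolding C'_A[OF True xh] tuplewise_def
          unfolding Ident_coprod
          using coord_hat_in[OF xh] nbrs_verts
          by (intro arg_cong[where f = Tuple] restrict_ext) (simp add: rep_id_apply)
        also have "\<dots> = x" by (rule Tuple_coord[OF hat_in_nbr_sum[OF xh]])
        finally show ?thesis using i x by (simp add: rep_id_apply)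
      next
        case False
        then have iB: "i \<in> B" using vert_cases[OF i] by simp
        have x': "x \<in> carrier (sp (fst X) i)" using x by (simp only: sp'_B[OF iB])
        show ?thesis
          unfolding C'_B[OF iB]
          unfolding Ident_coprod by (simp only: rep_id_apply[OF i x'] rep_id_apply[OF i x])
      qed
    qed
    then show ?thesis by (simp add: amap_reflection omap_reflection Ident_coprod)
  qed
  show "amap ?F X Z (Comp ?C X Y Z g h) = Comp ?C (omap ?F X) (omap ?F Y) (omap ?F Z) (amap ?F Y Z g) (amap ?F X Y h)"
    if X: "X \<in> Obj ?C" and Y: "Y \<in> Obj ?C" and Z: "Z \<in> Obj ?C" and h: "h \<in> Hom ?C X Y" and g: "g \<in> Hom ?C Y Z"
    for X Y Z h g
  proof -
    note gh = category_comp[OF coprod_category X Y Z h g]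
    have f: "snd Y = snd X" "snd Z = snd X"
      using h g by (simp_all add: Hom_coprod[OF X Y] Hom_coprod[OF Y Z])
    interpret h: refl_hom G A B "fst X" "fst Y" "snd X" h by (rule coprod_refl_hom[OF X Y h])
    interpret g: refl_hom G A B "fst Y" "fst Z" "snd X" g
      using coprod_refl_hom[OF Y Z g] by (simp only: f(1))
    interpret gh: refl_hom G A B "fst X" "fst Z" "snd X" "Comp ?C X Y Z g h"
      by (rule coprod_refl_hom[OF X Z gh])
    have "gh.C' = rep_comp G h.rep' g.C' h.C'"
    proof (rule rep_hom_eqI[OF gh.C'_hom rep_comp_hom[OF h.fd_rep' g.T.fd_rep' h.C'_hom g.C'_hom]])
      fix i x assume i: "i \<in> pverts G" and x: "x \<in> carrier (sp h.rep' i)"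
      show "gh.C' i x = rep_comp G h.rep' g.C' h.C' i x"
      proof (cases "i \<in> A")
        case True
        then have xh: "x \<in> carrier (h.hat i)" using x by (simp only: h.sp'_A)
        have "gh.C' i x = g.tuplewise i (h.tuplewise i x)"
          unfolding gh.C'_A[OF True xh] gh.tuplewise_def g.tuplewise_def
          unfolding Comp_coprod
          using h.coord_hat_in[OF xh] nbrs_verts
          by (intro arg_cong[where f = Tuple] restrict_ext) (simp add: rep_comp_apply h.coord_tuplewise)
        also have "\<dots> = g.C' i (h.C' i x)"
          by (simp only: h.C'_A[OF True xh] g.C'_A[OF True h.tuplewise_hat[OF True xh]])
        finally show ?thesis by (simp only: rep_comp_apply[OF i x])
      next
        case False
        then have iB: "i \<in> B" using vert_cases[OF i] by simp
        have x': "x \<in> carrier (sp (fst X) i)" using x by (simp only: h.sp'_B[OF iB])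
        show ?thesis
          unfolding gh.C'_B[OF iB] h.C'_B[OF iB] g.C'_B[OF iB] rep_comp_apply[OF i x]
          by (simp only: Comp_coprod rep_comp_apply[OF i x'])
      qed
    qed
    then show ?thesis
      using f by (cases X, cases Y, cases Z) (simp add: amap_reflection omap_reflection Comp_coprod)
  qed
qed

lemma reflection_square:
  "naturally_isomorphic (Rep_coprod_parity G A) (Rep_coprod_parity G A)
     (comp_fctr (reflection_functor G A B) (reflection_functor G A B)) id_fctr"
  (is "naturally_isomorphic ?C _ (comp_fctr ?F _) _")
proof (rule naturally_isomorphic_sym)
  have sq: "omap ?F (omap ?F X) \<in> Obj ?C" "dim_vec G (fst (omap ?F (omap ?F X))) = dim_vec G (fst X)"
    "snd (omap ?F (omap ?F X)) = snd X" if X: "X \<in> Obj ?C" for X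
  proof -
    interpret refl_rep G A B "fst X" "snd X" by (rule coprod_refl_rep[OF X])
    note X' = reflection_Obj[OF X]
    show "omap ?F (omap ?F X) \<in> Obj ?C" by (rule reflection_Obj(1)[OF X'(1)])
    have "dim_vec G (fst X) \<in> VG G" by (simp add: dim_vec_def VG_def)
    then show "dim_vec G (fst (omap ?F (omap ?F X))) = dim_vec G (fst X)"
      by (simp add: reflection_Obj(2)[OF X'(1)] X'(2) reflect_vec_twice)
    show "snd (omap ?F (omap ?F X)) = snd X"
      using reflect_char_twice[OF f_VG, of "dim_vec G (fst X)"] dim_vec' by (simp add: omap_reflection)
  qed
  show "naturally_isomorphic ?C ?C id_fctr (comp_fctr ?F ?F)"
    unfolding naturally_isomorphic_def
  proof (intro conjI exI[of _ "\<lambda>X. refl_rep.square_unit G A (fst X) (snd X)"] ballI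
      is_functor_id[OF coprod_category] is_functor_comp[OF reflection_is_functor reflection_is_functor])
    fix X assume X: "X \<in> Obj ?C"
    interpret refl_rep G A B "fst X" "snd X" by (rule coprod_refl_rep[OF X])
    have r: "fst (omap ?F (omap ?F X)) = rep''" by (simp add: omap_reflection)
    obtain \<phi> where \<phi>: "\<phi> \<in> rep_hom G rep'' (fst X)" "rep_comp G (fst X) \<phi> square_unit = rep_id G (fst X)"
      "rep_comp G rep'' square_unit \<phi> = rep_id G rep''"
      using square_unit_isomorphism(2) by blast
    show "is_isomorphism ?C (omap id_fctr X) (omap (comp_fctr ?F ?F) X) square_unit"
      unfolding is_isomorphism_def id_fctr_def comp_fctr_def fctr.simps
      using square_unit_isomorphism(1) \<phi> sq[OF X]
      by (auto simp: Hom_coprod[OF X sq(1)[OF X]] Hom_coprod[OF sq(1)[OF X] X] Comp_coprod Ident_coprod r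
          intro!: bexI[of _ \<phi>])
    fix Y h assume Y: "Y \<in> Obj ?C" and h: "h \<in> Hom ?C X Y"
    have e: "snd Y = snd X" "dim_vec G (fst Y) = dim_vec G (fst X)" using h by (simp_all add: Hom_coprod[OF X Y])
    interpret H: refl_hom G A B "fst X" "fst Y" "snd X" h by (rule coprod_refl_hom[OF X Y h])
    show "Comp ?C (omap id_fctr X) (omap id_fctr Y) (omap (comp_fctr ?F ?F) Y)
        (refl_rep.square_unit G A (fst Y) (snd Y)) (amap id_fctr X Y h)
      = Comp ?C (omap id_fctr X) (omap (comp_fctr ?F ?F) X) (omap (comp_fctr ?F ?F) Y)
        (amap (comp_fctr ?F ?F) X Y h) square_unit"
      using H.square_unit_natural[OF e(2)] e
      by (cases X, cases Y) (simp add: id_fctr_def comp_fctr_def Comp_coprod omap_reflection amap_reflection)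
  qed
qed

lemma reflection_equivalence:
  "is_equivalence (Rep_coprod_parity G A) (Rep_coprod_parity G A) (reflection_functor G A B)"
  by (rule is_equivalence_of_involution[OF reflection_is_functor reflection_square
        is_full_subcategory_refl is_full_subcategory_refl])
    (rule reflection_Obj(1), assumption)+

text \<open>Reflecting the pair twice restores it, so the functor interchanges the two subcategories.\<close>

lemma reflection_equivalence_component:
  assumes S: "(d, f) \<in> S_parity G A"
  defines "d' \<equiv> reflect_vec G A d" and "f' \<equiv> reflect_char G B d f"
  shows "is_full_subcategory (Rep_parity G A d f) (Rep_coprod_parity G A :: ('v, ('v, 'b) hvec) rep_cat)"
    and "is_full_subcategory (Rep_parity G A d' f') (Rep_coprod_parity G A :: ('v, ('v, 'b) hvec) rep_cat)"
    and "is_equivalence (Rep_parity G A d f) (Rep_parity G A d' f') (reflection_functor G A B :: ('v, 'b) rep_fctr)"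
proof -
  let ?C = "Rep_coprod_parity G A :: ('v, ('v, 'b) hvec) rep_cat"
  let ?F = "reflection_functor G A B :: ('v, 'b) rep_fctr"
  have S': "(d', f') \<in> S_parity G A"
    if X: "X \<in> Obj (Rep_parity G A d' f' :: ('v, ('v, 'b) hvec) rep_cat)" for X
    using X S_parity_reflect[OF S, of "fst X"] by (auto simp: Obj_Rep_parity d'_def f'_def)
  show D: "is_full_subcategory (Rep_parity G A d f) ?C"
    by (rule full_subcategory_Rep_parity) (rule S)
  show D': "is_full_subcategory (Rep_parity G A d' f') ?C"
    by (rule full_subcategory_Rep_parity) (rule S')
  have map: "omap ?F X \<in> Obj (Rep_parity G A (reflect_vec G A e) (reflect_char G B e g))"
    if X: "X \<in> Obj ?C" "dim_vec G (fst X) = e" "snd X = g" for X e g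
  proof -
    note X' = reflection_Obj[OF X(1)]
    have "snd (omap ?F X) = reflect_char G B e g" using X by (simp add: omap_reflection)
    then show ?thesis
      using X' X by (auto simp: Obj_Rep_parity Obj_coprod S_parity_def)
  qed
  have dV: "d \<in> VG G" and fV: "f \<in> VG G"
    using S by (auto simp: S_parity_def S_pairs_def ZG_plus_def VG_plus_def)
  show "is_equivalence (Rep_parity G A d f) (Rep_parity G A d' f') ?F"
  proof (rule is_equivalence_of_involution[OF reflection_is_functor reflection_square D D'])
    show "omap ?F X \<in> Obj (Rep_parity G A d' f')" if X: "X \<in> Obj (Rep_parity G A d f)" for X
      unfolding d'_def f'_def
      using D X by (intro map) (auto simp: is_full_subcategory_def Obj_Rep_parity)
    show "omap ?F X \<in> Obj (Rep_parity G A d f)" if X: "X \<in> Obj (Rep_parity G A d' f')" for X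
    proof -
      have "omap ?F X \<in> Obj (Rep_parity G A (reflect_vec G A d') (reflect_char G B d' f'))"
        using D' X by (intro map) (auto simp: is_full_subcategory_def Obj_Rep_parity)
      then show ?thesis
        by (simp only: d'_def f'_def reflect_vec_twice[OF dV] reflect_char_twice[OF fV])
    qed
  qed
qed

end

theorem theorem2p1:
  fixes G :: "'v pair_pre_digraph" and Gev God :: "'v set"
    and Fev Fod :: "('v, 'b) rep_fctr"
  assumes graph: "pair_graph G"
    and connected: "Digraph_Component.connected (with_proj G)"
    and acyclic: "acyclic_graph G"
    and decomposition: "Gev \<union> God = pverts G" "Gev \<inter> God = {}"
    and edges: "\<And>i j. (i, j) \<in> parcs G \<Longrightarrow> i \<in> Gev \<and> j \<in> God \<or> i \<in> God \<and> j \<in> Gev"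
    and Fev: "Fev = reflection_functor G Gev God"
    and Fod: "Fod = reflection_functor G God Gev"
  shows "is_functor (Rep_coprod_parity G Gev) (Rep_coprod_parity G Gev) Fev
    \<and> is_functor (Rep_coprod_parity G God) (Rep_coprod_parity G God) Fod
    \<and> is_equivalence (Rep_coprod_parity G Gev) (Rep_coprod_parity G Gev) Fev
    \<and> is_equivalence (Rep_coprod_parity G God) (Rep_coprod_parity G God) Fod
    \<and> (\<forall>(d, f) \<in> S_parity G Gev.
         is_full_subcategory (Rep_parity G Gev d f)
           (Rep_coprod_parity G Gev :: ('v, ('v, 'b) hvec) rep_cat)
       \<and> is_full_subcategory (Rep_parity G Gev (reflect_vec G Gev d) (reflect_char G God d f))
           (Rep_coprod_parity G Gev :: ('v, ('v, 'b) hvec) rep_cat)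
       \<and> is_equivalence (Rep_parity G Gev d f)
           (Rep_parity G Gev (reflect_vec G Gev d) (reflect_char G God d f)) Fev)
    \<and> (\<forall>(d, f) \<in> S_parity G God.
         is_full_subcategory (Rep_parity G God d f)
           (Rep_coprod_parity G God :: ('v, ('v, 'b) hvec) rep_cat)
       \<and> is_full_subcategory (Rep_parity G God (reflect_vec G God d) (reflect_char G Gev d f))
           (Rep_coprod_parity G God :: ('v, ('v, 'b) hvec) rep_cat)
       \<and> is_equivalence (Rep_parity G God d f)
           (Rep_parity G God (reflect_vec G God d) (reflect_char G Gev d f)) Fod)
    \<and> naturally_isomorphic (Rep_coprod_parity G Gev) (Rep_coprod_parity G Gev)
        (comp_fctr Fev Fev) id_fctr
    \<and> naturally_isomorphic (Rep_coprod_parity G God) (Rep_coprod_parity G God)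
        (comp_fctr Fod Fod) id_fctr"
proof -
  interpret E: bipartition G Gev God
    by (rule bipartition.intro[OF graph]) (use decomposition edges in blast)+
  interpret O: bipartition G God Gev
    by (rule bipartition.intro[OF graph]) (use decomposition edges in blast)+
  show ?thesis
    unfolding Fev Fod
    by (intro conjI ballI E.reflection_is_functor O.reflection_is_functor E.reflection_equivalence
        O.reflection_equivalence E.reflection_square O.reflection_square)
      (auto intro: E.reflection_equivalence_component O.reflection_equivalence_component)
qed

end
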